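(* Let $\Lambda^{\dag}$ be the flat distributive law of the double copresheaf 2-monad $\mathbb{P}^{\dag}\mathbb{P}$ over the presheaf 2-monad $\mathbb{P}$ given by $\Lambda^{\dag}_X=\overleftarrow{((\mathsf{y}_X)_{!\,\text{!`}})_*}=((\mathsf{y}_X)_{!\,\text{!`}})^!\cdot\mathsf{y}_{\mathsf{P}^{\dag}\mathsf{P}\mathsf{P}X}:\mathsf{P}^{\dag}\mathsf{P}\mathsf{P}X\to\mathsf{P}\mathsf{P}^{\dag}\mathsf{P}X$. Then there is an isomorphism of 2-categories $$(\Lambda^{\dag},\mathcal{Q})\text{-}\mathbf{Alg}\cong\mathcal{Q}\text{-}\mathbf{Cls}$$ between lax $\Lambda^{\dag}$-algebras over $\mathcal{Q}$ and $\mathcal{Q}$-closure spaces.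
   Context: Basic conventions. $\mathcal{Q}$ is a small quantaloid: a small category whose hom-sets are complete lattices (order $\preceq$) and whose composition preserves arbitrary suprema in each variable; $\mathcal{Q}_0$ is its object set. For $u:r\to s$, $v:s\to t$, $w:r\to t$ in $\mathcal{Q}$, the arrows $v\searrow w:r\to s$ and $w\swarrow u:s\to t$ are defined by $u\preceq v\searrow w\iff v\circ u\preceq w\iff v\preceq w\swarrow u$. For sets $X,Y$ equipped with type maps $|\text{-}|$ to $\mathcal{Q}_0$, a $\mathcal{Q}$-relation $\phi:X\nrightarrow Y$ assigns to each $(x,y)$ a morphism $\phi(x,y):|x|\to|y|$ of $\mathcal{Q}$; these are ordered pointwise by $\preceq$ and composed by $(\psi\circ\phi)(x,z)=\bigvee_y\psi(y,z)\circ\phi(x,y)$. A $\mathcal{Q}$-category is a set $X$ over $\mathcal{Q}_0$ with a $\mathcal{Q}$-relation $1_X^*:X\nrightarrow X$ (its hom) such that $1_{|x|}\preceq 1_X^*(x,x)$ and $1_X^*\circ 1_X^*\preceq 1_X^*$; it is preordered by $x\leq x'\iff |x|=|x'|$ and $1_{|x|}\preceq 1_X^*(x,x')$. A $\mathcal{Q}$-functor $f:X\to Y$ is a type-preserving map with $1_X^*(x,x')\preceq 1_Y^*(fx,fx')$; $f\leq g$ is pointwise. This gives the locally preordered 2-category $\mathcal{Q}\text{-}\mathbf{Cat}$. A 2-functor on it is a functor that is monotone on homs; a 2-monad $(T,m,e)$ is a monad whose functor $T$ is a 2-functor (multiplication $m:TT\to T$, unit $e:1\to T$). A distributor $\phi:X\nrightarrow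 Y$ is a $\mathcal{Q}$-relation with $1_Y^*\circ\phi\circ 1_X^*\preceq\phi$. For a $\mathcal{Q}$-functor $f:X\to Y$: $f_*:X\nrightarrow Y$, $f_*(x,y)=1_Y^*(fx,y)$, and $f^*:Y\nrightarrow X$, $f^*(y,x)=1_Y^*(y,fx)$. Let $\{s\}$ be the one-object $\mathcal{Q}$-category of type $s\in\mathcal{Q}_0$ with hom $1_s$. $\mathsf{P}X$ is the $\mathcal{Q}$-category of distributors $\sigma:X\nrightarrow\{s\}$ ($|\sigma|=s$) with $1_{\mathsf{P}X}^*(\sigma,\sigma')=\bigwedge_x\sigma'(x)\swarrow\sigma(x)$; $\mathsf{P}^{\dag}X$ is the $\mathcal{Q}$-category of distributors $\tau:\{s\}\nrightarrow X$ ($|\tau|=s$) with $1_{\mathsf{P}^{\dag}X}^*(\tau,\tau')=\bigwedge_x\tau'(x)\searrow\tau(x)$ (so $\tau\leq\tau'$ in $\mathsf{P}^{\dag}X$ iff $\tau'\preceq\tau$). Yoneda embeddings: $\mathsf{y}_X:X\to\mathsf{P}X$, $x\mapsto 1_X^*(-,x)$; $\mathsf{y}^{\dag}_X:X\to\mathsf{P}^{\dag}X$, $x\mapsto 1_X^*(x,-)$. For $f:X\to Y$: $f_!:\mathsf{P}X\to\mathsf{P}Y$, $\sigma\mapsto\sigma\circ f^*$; $f^!:\mathsf{P}Y\to\mathsf{P}X$, $\sigma\mapsto\sigma\circ f_*$; $f_{\text{!`}}:\mathsf{P}^{\dag}X\to\mathsf{P}^{\dag}Y$, $\tau\mapsto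 f_*\circ\tau$; $f^{\text{!`}}:\mathsf{P}^{\dag}Y\to\mathsf{P}^{\dag}X$, $\tau\mapsto f^*\circ\tau$; iterated decorations are applied from left to right, e.g. $f_{!\,\text{!`}}=(f_!)_{\text{!`}}$. For a distributor $\phi:X\nrightarrow Y$, $\overleftarrow{\phi}:Y\to\mathsf{P}X$ is $y\mapsto\phi(-,y)$. The presheaf 2-monad $\mathbb{P}=(\mathsf{P},\mathsf{s},\mathsf{y})$ sends $f$ to $f_!$, with unit $\mathsf{y}$ and multiplication $\mathsf{s}_X=\mathsf{y}_X^!:\mathsf{P}\mathsf{P}X\to\mathsf{P}X$. The double copresheaf 2-monad $\mathbb{P}^{\dag}\mathbb{P}$ has underlying 2-functor $X\mapsto\mathsf{P}^{\dag}\mathsf{P}X$, $f\mapsto f_{!\,\text{!`}}$, unit $\mathfrak{y}^{\dag}_X=\mathsf{y}^{\dag}_{\mathsf{P}X}\cdot\mathsf{y}_X:X\to\mathsf{P}^{\dag}\mathsf{P}X$ and multiplication $\mathfrak{s}^{\dag}_X=(\mathsf{y}_{\mathsf{P}^{\dag}\mathsf{P}X}\cdot\mathsf{y}^{\dag}_{\mathsf{P}X})^{\text{!`}}:\mathsf{P}^{\dag}\mathsf{P}\mathsf{P}^{\dag}\mathsf{P}X\to\mathsf{P}^{\dag}\mathsf{P}X$. Distributive laws ("distributive law" means lax distributive law). For a 2-monad $\mathbb{T}=(T,m,e)$ on $\mathcal{Q}\text{-}\mathbf{Cat}$, a distributive law $\lambda:T\mathsf{P}\to\mathsf{P}T$ of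 $\mathbb{T}$ over $\mathbb{P}$ is a family of $\mathcal{Q}$-functors $\lambda_X:T\mathsf{P}X\to\mathsf{P}TX$ such that for all $\mathcal{Q}$-functors $f:X\to Y$: (a) $(Tf)_!\cdot\lambda_X\leq\lambda_Y\cdot T(f_!)$; (b) $\mathsf{y}_{TX}\leq\lambda_X\cdot T\mathsf{y}_X$; (c) $\mathsf{s}_{TX}\cdot(\lambda_X)_!\cdot\lambda_{\mathsf{P}X}\leq\lambda_X\cdot T\mathsf{s}_X$; (d) $(e_X)_!\leq\lambda_X\cdot e_{\mathsf{P}X}$; (e) $(m_X)_!\cdot\lambda_{TX}\cdot T\lambda_X\leq\lambda_X\cdot m_{\mathsf{P}X}$. It is flat if (b) is an equality for all $X$. Lax algebras. For a distributive law $\lambda$ of $\mathbb{T}$ over $\mathbb{P}$, a lax $\lambda$-algebra $(X,p)$ over $\mathcal{Q}$ is a $\mathcal{Q}$-category $X$ with a $\mathcal{Q}$-functor $p:TX\to\mathsf{P}X$ such that $\mathsf{y}_X\leq p\cdot e_X$ and $\mathsf{s}_X\cdot p_!\cdot\lambda_X\cdot Tp\leq p\cdot m_X$. A lax $\lambda$-homomorphism $f:(X,p)\to(Y,q)$ is a $\mathcal{Q}$-functor $f:X\to Y$ with $f_!\cdot p\leq q\cdot Tf$. With the local order of $\mathcal{Q}\text{-}\mathbf{Cat}$ these form the 2-category $(\lambda,\mathcal{Q})\text{-}\mathbf{Alg}$. (Here $\mathbb{T}=\mathbb{P}^{\dag}\mathbb{P}$, $\lambda=\Lambda^{\dag}$.)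 $\mathcal{Q}$-closure spaces. A $\mathcal{Q}$-closure space $(X,c)$ is a $\mathcal{Q}$-category $X$ with a $\mathcal{Q}$-functor $c:\mathsf{P}X\to\mathsf{P}X$ satisfying $1_{\mathsf{P}X}\leq c$ and $c\cdot c=c$. A continuous $\mathcal{Q}$-functor $f:(X,c)\to(Y,d)$ is a $\mathcal{Q}$-functor $f:X\to Y$ with $f_!\cdot c\leq d\cdot f_!$. With the local order of $\mathcal{Q}\text{-}\mathbf{Cat}$ these form the 2-category $\mathcal{Q}\text{-}\mathbf{Cls}$. *)

theory Defs
  imports "HOL-Algebra.Complete_Lattice" "HOL-Library.FuncSet"
begin

section \<open>Locally preordered 2-categories\<close>

text \<open>
  Hom-sets are given as a family indexed by two objects and need not be disjoint, so composition
  carries the three objects involved; \<open>cmp2 C a b c g f\<close> is \<open>g\<close> after \<open>f\<close> for \<open>f : a \<rightarrow> b\<close> and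
  \<open>g : b \<rightarrow> c\<close>.  There is at most one 2-cell between parallel 1-cells, namely an instance of the
  preorder \<open>le2\<close>.
\<close>

record ('b, 'm) two_cat =
  ob2 :: "'b set"
  hom2 :: "'b \<Rightarrow> 'b \<Rightarrow> 'm set"
  id2 :: "'b \<Rightarrow> 'm"
  cmp2 :: "'b \<Rightarrow> 'b \<Rightarrow> 'b \<Rightarrow> 'm \<Rightarrow> 'm \<Rightarrow> 'm"
  le2 :: "'b \<Rightarrow> 'b \<Rightarrow> 'm \<Rightarrow> 'm \<Rightarrow> bool"

definition is_two_cat :: "('b, 'm) two_cat \<Rightarrow> bool" where
  "is_two_cat C \<longleftrightarrow>
     (\<forall>a\<in>ob2 C. id2 C a \<in> hom2 C a a) \<and>
     (\<forall>a\<in>ob2 C. \<forall>b\<in>ob2 C. \<forall>c\<in>ob2 C. \<forall>f\<in>hom2 C a b. \<forall>g\<in>hom2 C b c.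
        cmp2 C a b c g f \<in> hom2 C a c) \<and>
     (\<forall>a\<in>ob2 C. \<forall>b\<in>ob2 C. \<forall>f\<in>hom2 C a b.
        cmp2 C a a b f (id2 C a) = f \<and> cmp2 C a b b (id2 C b) f = f) \<and>
     (\<forall>a\<in>ob2 C. \<forall>b\<in>ob2 C. \<forall>c\<in>ob2 C. \<forall>d\<in>ob2 C.
        \<forall>f\<in>hom2 C a b. \<forall>g\<in>hom2 C b c. \<forall>h\<in>hom2 C c d.
        cmp2 C a c d h (cmp2 C a b c g f) = cmp2 C a b d (cmp2 C b c d h g) f) \<and>
     (\<forall>a\<in>ob2 C. \<forall>b\<in>ob2 C. \<forall>f\<in>hom2 C a b. le2 C a b f f) \<and>
     (\<forall>a\<in>ob2 C. \<forall>b\<in>ob2 C. \<forall>f\<in>hom2 C a b. \<forall>g\<in>hom2 C a b. \<forall>h\<in>hom2 C a b.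
        le2 C a b f g \<longrightarrow> le2 C a b g h \<longrightarrow> le2 C a b f h) \<and>
     (\<forall>a\<in>ob2 C. \<forall>b\<in>ob2 C. \<forall>c\<in>ob2 C.
        \<forall>f\<in>hom2 C a b. \<forall>f'\<in>hom2 C a b. \<forall>g\<in>hom2 C b c. \<forall>g'\<in>hom2 C b c.
        le2 C a b f f' \<longrightarrow> le2 C b c g g' \<longrightarrow> le2 C a c (cmp2 C a b c g f) (cmp2 C a b c g' f'))"

definition is_two_functor ::
  "('b, 'm) two_cat \<Rightarrow> ('c, 'n) two_cat \<Rightarrow> ('b \<Rightarrow> 'c) \<Rightarrow> ('b \<Rightarrow> 'b \<Rightarrow> 'm \<Rightarrow> 'n) \<Rightarrow> bool" where
  "is_two_functor C D Fo Fm \<longleftrightarrow>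
     (\<forall>a\<in>ob2 C. Fo a \<in> ob2 D) \<and>
     (\<forall>a\<in>ob2 C. \<forall>b\<in>ob2 C. \<forall>f\<in>hom2 C a b. Fm a b f \<in> hom2 D (Fo a) (Fo b)) \<and>
     (\<forall>a\<in>ob2 C. Fm a a (id2 C a) = id2 D (Fo a)) \<and>
     (\<forall>a\<in>ob2 C. \<forall>b\<in>ob2 C. \<forall>c\<in>ob2 C. \<forall>f\<in>hom2 C a b. \<forall>g\<in>hom2 C b c.
        Fm a c (cmp2 C a b c g f) = cmp2 D (Fo a) (Fo b) (Fo c) (Fm b c g) (Fm a b f)) \<and>
     (\<forall>a\<in>ob2 C. \<forall>b\<in>ob2 C. \<forall>f\<in>hom2 C a b. \<forall>g\<in>hom2 C a b.
        le2 C a b f g \<longrightarrow> le2 D (Fo a) (Fo b) (Fm a b f) (Fm a b g))"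

definition isomorphic_two_cats :: "('b, 'm) two_cat \<Rightarrow> ('c, 'n) two_cat \<Rightarrow> bool" where
  "isomorphic_two_cats C D \<longleftrightarrow>
     is_two_cat C \<and> is_two_cat D \<and>
     (\<exists>Fo Fm Go Gm.
        is_two_functor C D Fo Fm \<and> is_two_functor D C Go Gm \<and>
        (\<forall>a\<in>ob2 C. Go (Fo a) = a) \<and> (\<forall>x\<in>ob2 D. Fo (Go x) = x) \<and>
        (\<forall>a\<in>ob2 C. \<forall>b\<in>ob2 C. \<forall>f\<in>hom2 C a b. Gm (Fo a) (Fo b) (Fm a b f) = f) \<and>
        (\<forall>x\<in>ob2 D. \<forall>y\<in>ob2 D. \<forall>g\<in>hom2 D x y. Fm (Go x) (Go y) (Gm x y g) = g))"


section \<open>Quantaloids\<close>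

text \<open>\<open>qle\<close> is only ever used to compare parallel arrows.\<close>

record ('o, 'q) qdata =
  Ob :: "'o set"
  Arr :: "'q set"
  Dom :: "'q \<Rightarrow> 'o"
  Cod :: "'q \<Rightarrow> 'o"
  Idn :: "'o \<Rightarrow> 'q"
  Cmp :: "'q \<Rightarrow> 'q \<Rightarrow> 'q"
  qle :: "'q \<Rightarrow> 'q \<Rightarrow> bool"

definition Hom :: "('o, 'q) qdata \<Rightarrow> 'o \<Rightarrow> 'o \<Rightarrow> 'q set" where
  "Hom Q r s = {u \<in> Arr Q. Dom Q u = r \<and> Cod Q u = s}"

definition hom_order :: "('o, 'q) qdata \<Rightarrow> 'o \<Rightarrow> 'o \<Rightarrow> 'q gorder" where
  "hom_order Q r s = \<lparr>carrier = Hom Q r s, eq = (=), le = qle Q\<rparr>"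

locale quantaloid =
  fixes Q :: "('o, 'q) qdata"
  assumes dom_cod: "u \<in> Arr Q \<Longrightarrow> Dom Q u \<in> Ob Q \<and> Cod Q u \<in> Ob Q"
    and idn_hom: "r \<in> Ob Q \<Longrightarrow> Idn Q r \<in> Hom Q r r"
    and cmp_hom: "u \<in> Hom Q r s \<Longrightarrow> v \<in> Hom Q s t \<Longrightarrow> Cmp Q v u \<in> Hom Q r t"
    and cmp_idn: "u \<in> Hom Q r s \<Longrightarrow> Cmp Q u (Idn Q r) = u"
    and idn_cmp: "u \<in> Hom Q r s \<Longrightarrow> Cmp Q (Idn Q s) u = u"
    and cmp_assoc: "u \<in> Hom Q r s \<Longrightarrow> v \<in> Hom Q s t \<Longrightarrow> w \<in> Hom Q t z \<Longrightarrow>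
          Cmp Q w (Cmp Q v u) = Cmp Q (Cmp Q w v) u"
    and hom_complete: "r \<in> Ob Q \<Longrightarrow> s \<in> Ob Q \<Longrightarrow> complete_lattice (hom_order Q r s)"
    and cmp_sup_right: "r \<in> Ob Q \<Longrightarrow> A \<subseteq> Hom Q r s \<Longrightarrow> v \<in> Hom Q s t \<Longrightarrow>
          Cmp Q v (\<Squnion>\<^bsub>hom_order Q r s\<^esub> A) = \<Squnion>\<^bsub>hom_order Q r t\<^esub> (Cmp Q v ` A)"
    and cmp_sup_left: "t \<in> Ob Q \<Longrightarrow> A \<subseteq> Hom Q s t \<Longrightarrow> u \<in> Hom Q r s \<Longrightarrow>
          Cmp Q (\<Squnion>\<^bsub>hom_order Q s t\<^esub> A) u = \<Squnion>\<^bsub>hom_order Q r t\<^esub> ((\<lambda>v. Cmp Q v u) ` A)"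


section \<open>Data for Q-categories\<close>

text \<open>
  A Q-category is supported on a set \<open>Car X\<close> of elements of a type.  Type maps, Q-relations and
  maps are required to be \<open>undefined\<close> off their domains, so that HOL equality of them is equality
  in the mathematical sense.
\<close>

record ('a, 'o, 'q) qcat =
  Car :: "'a set"
  Ty :: "'a \<Rightarrow> 'o"
  Hm :: "'a \<Rightarrow> 'a \<Rightarrow> 'q"

text \<open>
  A presheaf \<open>\<sigma> : X -|-> {s}\<close> is the pair of its type \<open>s\<close> and the distributor itself, the one-object
  category \<open>{s}\<close> having carrier \<open>{()}\<close>; likewise for copresheaves \<open>\<tau> : {s} -|-> X\<close>.
\<close>

type_synonym ('a, 'o, 'q) psh = "'o \<times> ('a \<Rightarrow> unit \<Rightarrow> 'q)"
type_synonym ('a, 'o, 'q) copsh = "'o \<times> (unit \<Rightarrow> 'a \<Rightarrow> 'q)"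
type_synonym ('a, 'o, 'q) dcopsh = "(('a, 'o, 'q) psh, 'o, 'q) copsh"


context quantaloid
begin

abbreviation qcomp (infixr \<open>\<cdot>\<close> 75) where "v \<cdot> u \<equiv> Cmp Q v u"
abbreviation qless (infix \<open>\<preceq>\<close> 50) where "u \<preceq> v \<equiv> qle Q u v"
abbreviation hsup where "hsup r s A \<equiv> \<Squnion>\<^bsub>hom_order Q r s\<^esub> A"
abbreviation hinf where "hinf r s A \<equiv> \<Sqinter>\<^bsub>hom_order Q r s\<^esub> A"

text \<open>
  \<open>rimp v w\<close> is \<open>v \<searrow> w\<close> for \<open>v\<close>, \<open>w\<close> with common codomain,
  \<open>limp w u\<close> is \<open>w \<swarrow> u\<close> for \<open>w\<close>, \<open>u\<close> with common domain.
\<close>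

definition rimp :: "'q \<Rightarrow> 'q \<Rightarrow> 'q" where
  "rimp v w = (THE x. x \<in> Hom Q (Dom Q w) (Dom Q v) \<and>
     (\<forall>u \<in> Hom Q (Dom Q w) (Dom Q v). u \<preceq> x \<longleftrightarrow> v \<cdot> u \<preceq> w))"

definition limp :: "'q \<Rightarrow> 'q \<Rightarrow> 'q" where
  "limp w u = (THE x. x \<in> Hom Q (Cod Q u) (Cod Q w) \<and>
     (\<forall>v \<in> Hom Q (Cod Q u) (Cod Q w). v \<preceq> x \<longleftrightarrow> v \<cdot> u \<preceq> w))"


section \<open>Q-relations, Q-categories, Q-functors, distributors\<close>

definition qrel :: "('a, 'o, 'q) qcat \<Rightarrow> ('b, 'o, 'q) qcat \<Rightarrow> ('a \<Rightarrow> 'b \<Rightarrow> 'q) \<Rightarrow> bool" where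
  "qrel X Y \<phi> \<longleftrightarrow>
     (\<forall>x\<in>Car X. \<forall>y\<in>Car Y. \<phi> x y \<in> Hom Q (Ty X x) (Ty Y y)) \<and>
     (\<forall>x y. \<not> (x \<in> Car X \<and> y \<in> Car Y) \<longrightarrow> \<phi> x y = undefined)"

definition rel_le ::
  "('a, 'o, 'q) qcat \<Rightarrow> ('b, 'o, 'q) qcat \<Rightarrow> ('a \<Rightarrow> 'b \<Rightarrow> 'q) \<Rightarrow> ('a \<Rightarrow> 'b \<Rightarrow> 'q) \<Rightarrow> bool" where
  "rel_le X Y \<phi> \<phi>' \<longleftrightarrow> (\<forall>x\<in>Car X. \<forall>y\<in>Car Y. \<phi> x y \<preceq> \<phi>' x y)"

definition rcomp ::
  "('a, 'o, 'q) qcat \<Rightarrow> ('b, 'o, 'q) qcat \<Rightarrow> ('c, 'o, 'q) qcat \<Rightarrow>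
   ('b \<Rightarrow> 'c \<Rightarrow> 'q) \<Rightarrow> ('a \<Rightarrow> 'b \<Rightarrow> 'q) \<Rightarrow> 'a \<Rightarrow> 'c \<Rightarrow> 'q" where
  "rcomp X Y Z \<psi> \<phi> = (\<lambda>x z. if x \<in> Car X \<and> z \<in> Car Z
     then hsup (Ty X x) (Ty Z z) ((\<lambda>y. \<psi> y z \<cdot> \<phi> x y) ` Car Y) else undefined)"

definition qcategory :: "('a, 'o, 'q) qcat \<Rightarrow> bool" where
  "qcategory X \<longleftrightarrow>
     Ty X \<in> Car X \<rightarrow>\<^sub>E Ob Q \<and> qrel X X (Hm X) \<and>
     (\<forall>x\<in>Car X. Idn Q (Ty X x) \<preceq> Hm X x x) \<and>
     rel_le X X (rcomp X X X (Hm X) (Hm X)) (Hm X)"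

definition ord_le :: "('a, 'o, 'q) qcat \<Rightarrow> 'a \<Rightarrow> 'a \<Rightarrow> bool" where
  "ord_le X x x' \<longleftrightarrow> Ty X x = Ty X x' \<and> Idn Q (Ty X x) \<preceq> Hm X x x'"

definition qfunctor :: "('a, 'o, 'q) qcat \<Rightarrow> ('b, 'o, 'q) qcat \<Rightarrow> ('a \<Rightarrow> 'b) \<Rightarrow> bool" where
  "qfunctor X Y f \<longleftrightarrow>
     f \<in> Car X \<rightarrow>\<^sub>E Car Y \<and> (\<forall>x\<in>Car X. Ty Y (f x) = Ty X x) \<and>
     (\<forall>x\<in>Car X. \<forall>x'\<in>Car X. Hm X x x' \<preceq> Hm Y (f x) (f x'))"

definition fun_le :: "('a, 'o, 'q) qcat \<Rightarrow> ('b, 'o, 'q) qcat \<Rightarrow> ('a \<Rightarrow> 'b) \<Rightarrow> ('a \<Rightarrow> 'b) \<Rightarrow> bool" where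
  "fun_le X Y f g \<longleftrightarrow> (\<forall>x\<in>Car X. ord_le Y (f x) (g x))"

definition distributor :: "('a, 'o, 'q) qcat \<Rightarrow> ('b, 'o, 'q) qcat \<Rightarrow> ('a \<Rightarrow> 'b \<Rightarrow> 'q) \<Rightarrow> bool" where
  "distributor X Y \<phi> \<longleftrightarrow>
     qrel X Y \<phi> \<and> rel_le X Y (rcomp X Y Y (Hm Y) (rcomp X X Y \<phi> (Hm X))) \<phi>"

text \<open>\<open>graph X Y f\<close> is \<open>f\<^sub>* : X -|-> Y\<close> and \<open>cograph X Y f\<close> is \<open>f\<^sup>* : Y -|-> X\<close>.\<close>

definition graph :: "('a, 'o, 'q) qcat \<Rightarrow> ('b, 'o, 'q) qcat \<Rightarrow> ('a \<Rightarrow> 'b) \<Rightarrow> 'a \<Rightarrow> 'b \<Rightarrow> 'q" where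
  "graph X Y f = (\<lambda>x y. if x \<in> Car X \<and> y \<in> Car Y then Hm Y (f x) y else undefined)"

definition cograph :: "('a, 'o, 'q) qcat \<Rightarrow> ('b, 'o, 'q) qcat \<Rightarrow> ('a \<Rightarrow> 'b) \<Rightarrow> 'b \<Rightarrow> 'a \<Rightarrow> 'q" where
  "cograph X Y f = (\<lambda>y x. if x \<in> Car X \<and> y \<in> Car Y then Hm Y y (f x) else undefined)"


section \<open>Presheaves and copresheaves\<close>

definition single :: "'o \<Rightarrow> (unit, 'o, 'q) qcat" where
  "single s = \<lparr>Car = {()}, Ty = (\<lambda>_. s), Hm = (\<lambda>_ _. Idn Q s)\<rparr>"

definition PCar :: "('a, 'o, 'q) qcat \<Rightarrow> ('a, 'o, 'q) psh set" where
  "PCar X = {(s, \<sigma>). s \<in> Ob Q \<and> distributor X (single s) \<sigma>}"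

definition P :: "('a, 'o, 'q) qcat \<Rightarrow> (('a, 'o, 'q) psh, 'o, 'q) qcat" where
  "P X = \<lparr>Car = PCar X, Ty = restrict fst (PCar X),
     Hm = (\<lambda>p p'. if p \<in> PCar X \<and> p' \<in> PCar X
       then hinf (fst p) (fst p') ((\<lambda>x. limp (snd p' x ()) (snd p x ())) ` Car X)
       else undefined)\<rparr>"

definition PdagCar :: "('a, 'o, 'q) qcat \<Rightarrow> ('a, 'o, 'q) copsh set" where
  "PdagCar X = {(s, \<tau>). s \<in> Ob Q \<and> distributor (single s) X \<tau>}"

definition Pdag :: "('a, 'o, 'q) qcat \<Rightarrow> (('a, 'o, 'q) copsh, 'o, 'q) qcat" where
  "Pdag X = \<lparr>Car = PdagCar X, Ty = restrict fst (PdagCar X),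
     Hm = (\<lambda>t t'. if t \<in> PdagCar X \<and> t' \<in> PdagCar X
       then hinf (fst t) (fst t') ((\<lambda>x. rimp (snd t' () x) (snd t () x)) ` Car X)
       else undefined)\<rparr>"

definition yon :: "('a, 'o, 'q) qcat \<Rightarrow> 'a \<Rightarrow> ('a, 'o, 'q) psh" where
  "yon X = (\<lambda>x\<in>Car X. (Ty X x, \<lambda>z _. Hm X z x))"

definition coyon :: "('a, 'o, 'q) qcat \<Rightarrow> 'a \<Rightarrow> ('a, 'o, 'q) copsh" where
  "coyon X = (\<lambda>x\<in>Car X. (Ty X x, \<lambda>_ z. Hm X x z))"

text \<open>
  For \<open>f : X \<rightarrow> Y\<close>: \<open>Pdir X Y f : P X \<rightarrow> P Y\<close> is \<open>f\<^sub>!\<close>, \<open>Pinv X Y f : P Y \<rightarrow> P X\<close> is \<open>f\<^sup>!\<close>;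
  \<open>Cdir X Y f : Pdag X \<rightarrow> Pdag Y\<close> and \<open>Cinv X Y f : Pdag Y \<rightarrow> Pdag X\<close> are the corresponding maps on
  copresheaves (subscript, respectively superscript, inverted exclamation mark).
\<close>

definition Pdir ::
  "('a, 'o, 'q) qcat \<Rightarrow> ('b, 'o, 'q) qcat \<Rightarrow> ('a \<Rightarrow> 'b) \<Rightarrow> ('a, 'o, 'q) psh \<Rightarrow> ('b, 'o, 'q) psh" where
  "Pdir X Y f = (\<lambda>(s, \<sigma>)\<in>Car (P X). (s, rcomp Y X (single s) \<sigma> (cograph X Y f)))"

definition Pinv ::
  "('a, 'o, 'q) qcat \<Rightarrow> ('b, 'o, 'q) qcat \<Rightarrow> ('a \<Rightarrow> 'b) \<Rightarrow> ('b, 'o, 'q) psh \<Rightarrow> ('a, 'o, 'q) psh" where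
  "Pinv X Y f = (\<lambda>(s, \<sigma>)\<in>Car (P Y). (s, rcomp X Y (single s) \<sigma> (graph X Y f)))"

definition Cdir ::
  "('a, 'o, 'q) qcat \<Rightarrow> ('b, 'o, 'q) qcat \<Rightarrow> ('a \<Rightarrow> 'b) \<Rightarrow> ('a, 'o, 'q) copsh \<Rightarrow> ('b, 'o, 'q) copsh" where
  "Cdir X Y f = (\<lambda>(s, \<tau>)\<in>Car (Pdag X). (s, rcomp (single s) X Y (graph X Y f) \<tau>))"

definition Cinv ::
  "('a, 'o, 'q) qcat \<Rightarrow> ('b, 'o, 'q) qcat \<Rightarrow> ('a \<Rightarrow> 'b) \<Rightarrow> ('b, 'o, 'q) copsh \<Rightarrow> ('a, 'o, 'q) copsh" where
  "Cinv X Y f = (\<lambda>(s, \<tau>)\<in>Car (Pdag Y). (s, rcomp (single s) Y X (cograph X Y f) \<tau>))"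

definition left_arrow ::
  "('a, 'o, 'q) qcat \<Rightarrow> ('b, 'o, 'q) qcat \<Rightarrow> ('a \<Rightarrow> 'b \<Rightarrow> 'q) \<Rightarrow> 'b \<Rightarrow> ('a, 'o, 'q) psh" where
  "left_arrow X Y \<phi> = (\<lambda>y\<in>Car Y. (Ty Y y, \<lambda>x _. \<phi> x y))"

definition Pmult :: "('a, 'o, 'q) qcat \<Rightarrow> (('a, 'o, 'q) psh, 'o, 'q) psh \<Rightarrow> ('a, 'o, 'q) psh" where
  "Pmult X = Pinv X (P X) (yon X)"


section \<open>The double copresheaf monad and its distributive law\<close>

definition T :: "('a, 'o, 'q) qcat \<Rightarrow> (('a, 'o, 'q) dcopsh, 'o, 'q) qcat" where
  "T X = Pdag (P X)"

definition Tmap ::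
  "('a, 'o, 'q) qcat \<Rightarrow> ('b, 'o, 'q) qcat \<Rightarrow> ('a \<Rightarrow> 'b) \<Rightarrow> ('a, 'o, 'q) dcopsh \<Rightarrow> ('b, 'o, 'q) dcopsh" where
  "Tmap X Y f = Cdir (P X) (P Y) (Pdir X Y f)"

definition Tunit :: "('a, 'o, 'q) qcat \<Rightarrow> 'a \<Rightarrow> ('a, 'o, 'q) dcopsh" where
  "Tunit X = compose (Car X) (coyon (P X)) (yon X)"

definition Tmult ::
  "('a, 'o, 'q) qcat \<Rightarrow> (('a, 'o, 'q) dcopsh, 'o, 'q) dcopsh \<Rightarrow> ('a, 'o, 'q) dcopsh" where
  "Tmult X = Cinv (P X) (P (T X)) (compose (Car (P X)) (yon (T X)) (coyon (P X)))"

definition Lam ::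
  "('a, 'o, 'q) qcat \<Rightarrow> (('a, 'o, 'q) psh, 'o, 'q) dcopsh \<Rightarrow> (('a, 'o, 'q) dcopsh, 'o, 'q) psh" where
  "Lam X = left_arrow (T X) (T (P X)) (graph (T X) (T (P X)) (Tmap X (P X) (yon X)))"

text \<open>
  \<open>Lam\<close> is a lax distributive law of \<open>T\<close> over \<open>P\<close>.  A family indexed by all Q-categories
  is a polymorphic constant, which HOL cannot quantify over; hence the notion is spelled out for
  \<open>Lam\<close>, with the types supporting the Q-categories \<open>X\<close> and \<open>Y\<close> as parameters.
\<close>

definition Lam_distributive_law :: "'a itself \<Rightarrow> 'b itself \<Rightarrow> bool" where
  "Lam_distributive_law _ _ \<longleftrightarrow>
     (\<forall>X :: ('a, 'o, 'q) qcat. qcategory X \<longrightarrow>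
        qfunctor (T (P X)) (P (T X)) (Lam X)) \<and>
     (\<forall>(X :: ('a, 'o, 'q) qcat) (Y :: ('b, 'o, 'q) qcat) f.
        qcategory X \<longrightarrow> qcategory Y \<longrightarrow> qfunctor X Y f \<longrightarrow>
        fun_le (T (P X)) (P (T Y))
          (Pdir (T X) (T Y) (Tmap X Y f) \<circ> Lam X)
          (Lam Y \<circ> Tmap (P X) (P Y) (Pdir X Y f))) \<and>
     (\<forall>X :: ('a, 'o, 'q) qcat. qcategory X \<longrightarrow>
        fun_le (T X) (P (T X))
          (yon (T X))
          (Lam X \<circ> Tmap X (P X) (yon X)) \<and>
        fun_le (T (P (P X))) (P (T X))
          (Pmult (T X) \<circ> Pdir (T (P X)) (P (T X)) (Lam X) \<circ> Lam (P X))
          (Lam X \<circ> Tmap (P (P X)) (P X) (Pmult X)) \<and>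
        fun_le (P X) (P (T X))
          (Pdir X (T X) (Tunit X))
          (Lam X \<circ> Tunit (P X)) \<and>
        fun_le (T (T (P X))) (P (T X))
          (Pdir (T (T X)) (T X) (Tmult X) \<circ> Lam (T X) \<circ> Tmap (T (P X)) (P (T X)) (Lam X))
          (Lam X \<circ> Tmult (P X)))"

definition Lam_flat :: "'a itself \<Rightarrow> bool" where
  "Lam_flat _ \<longleftrightarrow>
     (\<forall>X :: ('a, 'o, 'q) qcat. qcategory X \<longrightarrow>
        yon (T X) = compose (Car (T X)) (Lam X) (Tmap X (P X) (yon X)))"


section \<open>Lax algebras and Q-closure spaces\<close>

definition lax_algebra ::
  "('a, 'o, 'q) qcat \<times> (('a, 'o, 'q) dcopsh \<Rightarrow> ('a, 'o, 'q) psh) \<Rightarrow> bool" where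
  "lax_algebra = (\<lambda>(X, p).
     qcategory X \<and> qfunctor (T X) (P X) p \<and>
     fun_le X (P X) (yon X) (p \<circ> Tunit X) \<and>
     fun_le (T (T X)) (P X)
       (Pmult X \<circ> Pdir (T X) (P X) p \<circ> Lam X \<circ> Tmap (T X) (P X) p)
       (p \<circ> Tmult X))"

definition lax_hom ::
  "('a, 'o, 'q) qcat \<times> (('a, 'o, 'q) dcopsh \<Rightarrow> ('a, 'o, 'q) psh) \<Rightarrow>
   ('b, 'o, 'q) qcat \<times> (('b, 'o, 'q) dcopsh \<Rightarrow> ('b, 'o, 'q) psh) \<Rightarrow> ('a \<Rightarrow> 'b) \<Rightarrow> bool" where
  "lax_hom = (\<lambda>(X, p) (Y, q) f.
     qfunctor X Y f \<and> fun_le (T X) (P Y) (Pdir X Y f \<circ> p) (q \<circ> Tmap X Y f))"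

definition closure_space ::
  "('a, 'o, 'q) qcat \<times> (('a, 'o, 'q) psh \<Rightarrow> ('a, 'o, 'q) psh) \<Rightarrow> bool" where
  "closure_space = (\<lambda>(X, c).
     qcategory X \<and> qfunctor (P X) (P X) c \<and>
     fun_le (P X) (P X) id c \<and> compose (Car (P X)) c c = c)"

definition continuous_qfunctor ::
  "('a, 'o, 'q) qcat \<times> (('a, 'o, 'q) psh \<Rightarrow> ('a, 'o, 'q) psh) \<Rightarrow>
   ('b, 'o, 'q) qcat \<times> (('b, 'o, 'q) psh \<Rightarrow> ('b, 'o, 'q) psh) \<Rightarrow> ('a \<Rightarrow> 'b) \<Rightarrow> bool" where
  "continuous_qfunctor = (\<lambda>(X, c) (Y, d) f.
     qfunctor X Y f \<and> fun_le (P X) (P Y) (Pdir X Y f \<circ> c) (d \<circ> Pdir X Y f))"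

definition Lax_Alg ::
  "(('a, 'o, 'q) qcat \<times> (('a, 'o, 'q) dcopsh \<Rightarrow> ('a, 'o, 'q) psh), 'a \<Rightarrow> 'a) two_cat" where
  "Lax_Alg = \<lparr>ob2 = {A. lax_algebra A},
     hom2 = (\<lambda>A B. {f. lax_hom A B f}),
     id2 = (\<lambda>A. \<lambda>x\<in>Car (fst A). x),
     cmp2 = (\<lambda>A B D g f. compose (Car (fst A)) g f),
     le2 = (\<lambda>A B. fun_le (fst A) (fst B))\<rparr>"

definition Q_Cls ::
  "(('a, 'o, 'q) qcat \<times> (('a, 'o, 'q) psh \<Rightarrow> ('a, 'o, 'q) psh), 'a \<Rightarrow> 'a) two_cat" where
  "Q_Cls = \<lparr>ob2 = {A. closure_space A},
     hom2 = (\<lambda>A B. {f. continuous_qfunctor A B f}),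
     id2 = (\<lambda>A. \<lambda>x\<in>Car (fst A). x),
     cmp2 = (\<lambda>A B D g f. compose (Car (fst A)) g f),
     le2 = (\<lambda>A B. fun_le (fst A) (fst B))\<rparr>"

end

end

theory Submission
  imports Defs
begin

text \<open>
  Write \<open>g\<^sub>c\<close> for the direct image of copresheaves along \<open>g\<close> (\<open>Cdir\<close>), \<open>T = P\<^sup>\<dagger>P\<close> with unit \<open>e\<close> and
  multiplication \<open>m\<close>, and \<open>s\<close> for the multiplication \<open>Pmult\<close> of the presheaf monad.

  Everything rests on one formula.  The direct image \<open>y\<^sub>!\<close> along the Yoneda embedding has the right
  adjoint \<open>s = y\<^sup>!\<close>, and a 2-functor preserves adjunctions, so \<open>T y\<close> is left adjoint to
  \<open>s\<^sub>c : T P X \<rightarrow> T X\<close>.  Hence \<open>\<Lambda>\<close>, which represents the graph of \<open>T y\<close>, is the composite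
  \<open>y\<^bsub>T X\<^esub> \<cdot> s\<^sub>c\<close> (\<open>Lam_eq\<close>).  The laws for \<open>\<Lambda>\<close> then reduce to identities of the presheaf monad carried
  through the functor \<open>(-)\<^sub>c\<close>.  Only two laws remain inequalities: the unit law needs \<open>y\<^sub>! \<le> y\<close>
  (\<open>Pdir_Tunit_le\<close>), the multiplication law is the mate of a commuting square
  (\<open>Tmult_Tmap_Tsup_le\<close>).

  The same formula turns the multiplication axiom of a lax algebra \<open>p : T X \<rightarrow> P X\<close> into
  \<open>p \<cdot> (s \<cdot> p\<^sub>!)\<^sub>c \<le> p \<cdot> m\<close> (\<open>lax_algebra_iff\<close>).  Since \<open>T X = P\<^sup>\<dagger>(P X)\<close> is the free completion of \<open>P X\<close>
  under infima and \<open>P X\<close> has infima \<open>inf : T X \<rightarrow> P X\<close>, right adjoint to \<open>y\<^sup>\<dagger>\<close> (\<open>Tinf_ladj\<close>), a map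
  \<open>c : P X \<rightarrow> P X\<close> extends to \<open>inf \<cdot> c\<^sub>c : T X \<rightarrow> P X\<close> and \<open>p\<close> restricts to \<open>p \<cdot> y\<^sup>\<dagger>\<close>.  The axioms for \<open>p\<close>
  force \<open>c = p \<cdot> y\<^sup>\<dagger>\<close> to satisfy \<open>1 \<le> c\<close> and \<open>p \<cdot> c\<^sub>c \<le> p\<close>.  The second inequality gives \<open>c \<cdot> c \<le> c\<close>;
  together with the first, which implies \<open>inf \<le> p\<close>, it gives \<open>inf \<cdot> c\<^sub>c \<le> p\<close>, and the converse inequality
  holds for every Q-functor \<open>p\<close>.  So \<open>p\<close> is recovered from \<open>c\<close> (\<open>closure_alg_alg_closure\<close>).  Conversely
  \<open>c \<cdot> c = c\<close> yields the multiplication axiom for \<open>inf \<cdot> c\<^sub>c\<close> (\<open>lax_algebra_closure_alg\<close>).  A Q-functor is a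
  lax homomorphism exactly if it is continuous, because direct images are lax for infima, so the
  two 2-categories differ only in how the structure on an object is recorded.

  All these identities are equalities of maps because \<open>P X\<close> and \<open>P\<^sup>\<dagger> X\<close> are separated; they are derived
  from uniqueness of adjoints, the relevant adjoints being given by explicit pointwise formulas.
\<close>

context quantaloid
begin

section \<open>Suprema, infima and residuals of arrows\<close>

lemma HomD: "u \<in> Hom Q r s \<Longrightarrow> r \<in> Ob Q" "u \<in> Hom Q r s \<Longrightarrow> s \<in> Ob Q"
    "u \<in> Hom Q r s \<Longrightarrow> Dom Q u = r" "u \<in> Hom Q r s \<Longrightarrow> Cod Q u = s"
  using dom_cod by (auto simp: Hom_def)

lemma qle_refl: "u \<in> Hom Q r s \<Longrightarrow> u \<preceq> u"
proof -
  assume u: "u \<in> Hom Q r s"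
  interpret L: complete_lattice "hom_order Q r s" using hom_complete HomD u by blast
  show ?thesis using L.le_refl[of u] u by (simp add: hom_order_def)
qed

lemma qle_antisym: "u \<in> Hom Q r s \<Longrightarrow> v \<in> Hom Q r s \<Longrightarrow> u \<preceq> v \<Longrightarrow> v \<preceq> u \<Longrightarrow> u = v"
proof -
  assume u: "u \<in> Hom Q r s" and v: "v \<in> Hom Q r s" "u \<preceq> v" "v \<preceq> u"
  interpret L: complete_lattice "hom_order Q r s" using hom_complete HomD u by blast
  show ?thesis using L.le_antisym[of u v] u v by (simp add: hom_order_def)
qed

lemma qle_trans:
  "u \<preceq> v \<Longrightarrow> v \<preceq> w \<Longrightarrow> u \<in> Hom Q r s \<Longrightarrow> v \<in> Hom Q r s \<Longrightarrow> w \<in> Hom Q r s \<Longrightarrow> u \<preceq> w"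
proof -
  assume u: "u \<in> Hom Q r s" and v: "v \<in> Hom Q r s" "w \<in> Hom Q r s" "u \<preceq> v" "v \<preceq> w"
  interpret L: complete_lattice "hom_order Q r s" using hom_complete HomD u by blast
  show ?thesis using L.le_trans[of u v w] u v by (simp add: hom_order_def)
qed

lemma hsup_hom: "A \<subseteq> Hom Q r s \<Longrightarrow> r \<in> Ob Q \<Longrightarrow> s \<in> Ob Q \<Longrightarrow> hsup r s A \<in> Hom Q r s"
proof -
  assume A: "A \<subseteq> Hom Q r s" and "r \<in> Ob Q" "s \<in> Ob Q"
  then interpret L: complete_lattice "hom_order Q r s" using hom_complete by blast
  show ?thesis using L.sup_closed[of A] A by (simp add: hom_order_def)
qed

lemma hsup_upper: "A \<subseteq> Hom Q r s \<Longrightarrow> a \<in> A \<Longrightarrow> a \<preceq> hsup r s A"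
proof -
  assume A: "A \<subseteq> Hom Q r s" "a \<in> A"
  then have "r \<in> Ob Q" "s \<in> Ob Q" using HomD by blast+
  then interpret L: complete_lattice "hom_order Q r s" using hom_complete by blast
  show ?thesis using L.sup_upper[of A a] A by (simp add: hom_order_def)
qed

lemma hsup_le_iff:
  assumes A: "A \<subseteq> Hom Q r s" and u: "u \<in> Hom Q r s"
  shows "hsup r s A \<preceq> u \<longleftrightarrow> (\<forall>a\<in>A. a \<preceq> u)"
proof -
  have o: "r \<in> Ob Q" "s \<in> Ob Q" using HomD u by blast+
  then interpret L: complete_lattice "hom_order Q r s" using hom_complete by blast
  have "(\<forall>a\<in>A. a \<preceq> u) \<Longrightarrow> hsup r s A \<preceq> u"
    using L.sup_least[of A u] A u by (auto simp: hom_order_def Upper_def)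
  then show ?thesis
    using hsup_upper[OF A] qle_trans[OF _ _ _ hsup_hom[OF A o] u] A by blast
qed

lemma hinf_hom: "A \<subseteq> Hom Q r s \<Longrightarrow> r \<in> Ob Q \<Longrightarrow> s \<in> Ob Q \<Longrightarrow> hinf r s A \<in> Hom Q r s"
proof -
  assume A: "A \<subseteq> Hom Q r s" and "r \<in> Ob Q" "s \<in> Ob Q"
  then interpret L: complete_lattice "hom_order Q r s" using hom_complete by blast
  show ?thesis using L.inf_closed[of A] A by (simp add: hom_order_def)
qed

lemma le_hinf_iff:
  assumes A: "A \<subseteq> Hom Q r s" and u: "u \<in> Hom Q r s"
  shows "u \<preceq> hinf r s A \<longleftrightarrow> (\<forall>a\<in>A. u \<preceq> a)"
proof -
  have o: "r \<in> Ob Q" "s \<in> Ob Q" using HomD u by blast+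
  then interpret L: complete_lattice "hom_order Q r s" using hom_complete by blast
  have 1: "(\<forall>a\<in>A. u \<preceq> a) \<Longrightarrow> u \<preceq> hinf r s A"
    using L.inf_greatest[of A u] A u by (auto simp: hom_order_def Lower_def)
  have 2: "a \<in> A \<Longrightarrow> hinf r s A \<preceq> a" for a
    using L.inf_lower[of A a] A u by (simp add: hom_order_def)
  show ?thesis
    using 1 2 qle_trans[OF _ _ u hinf_hom[OF A o]] A by blast
qed

lemma hom_eqI_below:
  assumes "a \<in> Hom Q r s" "b \<in> Hom Q r s" "\<And>u. u \<in> Hom Q r s \<Longrightarrow> u \<preceq> a \<longleftrightarrow> u \<preceq> b"
  shows "a = b"
  using assms qle_antisym qle_refl by metis

lemma hom_eqI_below_above:
  assumes "a \<in> Hom Q r s" "b \<in> Hom Q r s" "\<And>u. u \<in> Hom Q r s \<Longrightarrow> a \<preceq> u \<longleftrightarrow> b \<preceq> u"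
  shows "a = b"
  using assms qle_antisym qle_refl by metis

lemma cmp_hsup_le_iff:
  assumes A: "A \<subseteq> Hom Q r s" and v: "v \<in> Hom Q s t" and w: "w \<in> Hom Q r t"
  shows "v \<cdot> hsup r s A \<preceq> w \<longleftrightarrow> (\<forall>a\<in>A. v \<cdot> a \<preceq> w)"
proof -
  have "(\<lambda>a. v \<cdot> a) ` A \<subseteq> Hom Q r t" using A v cmp_hom by blast
  then show ?thesis
    using hsup_le_iff[OF _ w] cmp_sup_right[OF HomD(1)[OF w] A v] by auto
qed

lemma hsup_cmp_le_iff:
  assumes A: "A \<subseteq> Hom Q s t" and u: "u \<in> Hom Q r s" and w: "w \<in> Hom Q r t"
  shows "hsup s t A \<cdot> u \<preceq> w \<longleftrightarrow> (\<forall>a\<in>A. a \<cdot> u \<preceq> w)"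
proof -
  have "(\<lambda>a. a \<cdot> u) ` A \<subseteq> Hom Q r t" using A u cmp_hom by blast
  then show ?thesis
    using hsup_le_iff[OF _ w] cmp_sup_left[OF HomD(2)[OF w] A u] by auto
qed

text \<open>
  Monotonicity is preservation of the supremum of a two-element chain.
\<close>

lemma cmp_mono_right:
  assumes "u \<preceq> u'" "u \<in> Hom Q r s" "u' \<in> Hom Q r s" "v \<in> Hom Q s t"
  shows "v \<cdot> u \<preceq> v \<cdot> u'"
proof -
  have o: "r \<in> Ob Q" "s \<in> Ob Q" using HomD assms by blast+
  have A: "{u, u'} \<subseteq> Hom Q r s" using assms by simp
  have "hsup r s {u, u'} = u'"
    using qle_antisym[OF hsup_hom[OF A o] assms(3)] hsup_le_iff[OF A assms(3)] hsup_upper[OF A]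
      assms qle_refl by blast
  then show ?thesis
    using cmp_hsup_le_iff[OF A assms(4) cmp_hom[OF assms(3,4)]] qle_refl[OF cmp_hom[OF assms(3,4)]]
    by simp
qed

lemma cmp_mono_left:
  assumes "v \<preceq> v'" "v \<in> Hom Q s t" "v' \<in> Hom Q s t" "u \<in> Hom Q r s"
  shows "v \<cdot> u \<preceq> v' \<cdot> u"
proof -
  have o: "s \<in> Ob Q" "t \<in> Ob Q" using HomD assms by blast+
  have A: "{v, v'} \<subseteq> Hom Q s t" using assms by simp
  have "hsup s t {v, v'} = v'"
    using qle_antisym[OF hsup_hom[OF A o] assms(3)] hsup_le_iff[OF A assms(3)] hsup_upper[OF A]
      assms qle_refl by blast
  then show ?thesis
    using hsup_cmp_le_iff[OF A assms(4) cmp_hom[OF assms(4,3)]] qle_refl[OF cmp_hom[OF assms(4,3)]]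
    by simp
qed

text \<open>
  The supremum of all candidates is again a candidate since composition preserves suprema; this makes
  the definite description in the definition of \<open>rimp\<close> meaningful.
\<close>

lemma rimp_prop:
  assumes v: "v \<in> Hom Q s t" and w: "w \<in> Hom Q r t"
  shows "rimp v w \<in> Hom Q r s" "u \<in> Hom Q r s \<Longrightarrow> u \<preceq> rimp v w \<longleftrightarrow> v \<cdot> u \<preceq> w"
proof -
  let ?A = "{u \<in> Hom Q r s. v \<cdot> u \<preceq> w}" and ?x = "hsup r s {u \<in> Hom Q r s. v \<cdot> u \<preceq> w}"
  have A: "?A \<subseteq> Hom Q r s" by blast
  have x: "?x \<in> Hom Q r s" using hsup_hom[OF A] HomD v w by blast
  have vx: "v \<cdot> ?x \<preceq> w" using cmp_hsup_le_iff[OF A v w] by blast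
  have x2: "u \<preceq> ?x \<longleftrightarrow> v \<cdot> u \<preceq> w" if u: "u \<in> Hom Q r s" for u
  proof
    show "v \<cdot> u \<preceq> w" if "u \<preceq> ?x"
      using qle_trans[OF cmp_mono_right[OF that u x v] vx] cmp_hom u x v w by blast
    show "v \<cdot> u \<preceq> w \<Longrightarrow> u \<preceq> ?x" using hsup_upper[OF A] u by blast
  qed
  have "rimp v w = ?x"
    unfolding rimp_def using HomD(3)[OF v] HomD(3)[OF w]
    by (intro the_equality) (use x x2 in \<open>auto intro!: hom_eqI_below\<close>)
  then show "rimp v w \<in> Hom Q r s" "u \<in> Hom Q r s \<Longrightarrow> u \<preceq> rimp v w \<longleftrightarrow> v \<cdot> u \<preceq> w"
    using x x2 by auto
qed

lemma limp_prop:
  assumes u: "u \<in> Hom Q r s" and w: "w \<in> Hom Q r t"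
  shows "limp w u \<in> Hom Q s t" "v \<in> Hom Q s t \<Longrightarrow> v \<preceq> limp w u \<longleftrightarrow> v \<cdot> u \<preceq> w"
proof -
  let ?A = "{v \<in> Hom Q s t. v \<cdot> u \<preceq> w}" and ?x = "hsup s t {v \<in> Hom Q s t. v \<cdot> u \<preceq> w}"
  have A: "?A \<subseteq> Hom Q s t" by blast
  have x: "?x \<in> Hom Q s t" using hsup_hom[OF A] HomD u w by blast
  have xu: "?x \<cdot> u \<preceq> w" using hsup_cmp_le_iff[OF A u w] by blast
  have x2: "v \<preceq> ?x \<longleftrightarrow> v \<cdot> u \<preceq> w" if v: "v \<in> Hom Q s t" for v
  proof
    show "v \<cdot> u \<preceq> w" if "v \<preceq> ?x"
      using qle_trans[OF cmp_mono_left[OF that v x u] xu] cmp_hom u x v w by blast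
    show "v \<cdot> u \<preceq> w \<Longrightarrow> v \<preceq> ?x" using hsup_upper[OF A] v by blast
  qed
  have "limp w u = ?x"
    unfolding limp_def using HomD(4)[OF u] HomD(4)[OF w]
    by (intro the_equality) (use x x2 in \<open>auto intro!: hom_eqI_below\<close>)
  then show "limp w u \<in> Hom Q s t" "v \<in> Hom Q s t \<Longrightarrow> v \<preceq> limp w u \<longleftrightarrow> v \<cdot> u \<preceq> w"
    using x x2 by auto
qed

lemma idn_le_cmp_left:
  assumes "Idn Q s \<preceq> v" "v \<in> Hom Q s s" "u \<in> Hom Q r s"
  shows "u \<preceq> v \<cdot> u"
  using cmp_mono_left[OF assms(1) idn_hom[OF HomD(2)] assms(2,3)] idn_cmp assms by metis

lemma idn_le_cmp_right:
  assumes "Idn Q r \<preceq> v" "v \<in> Hom Q r r" "u \<in> Hom Q r s"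
  shows "u \<preceq> u \<cdot> v"
  using cmp_mono_right[OF assms(1) idn_hom[OF HomD(1)] assms(2,3)] cmp_idn assms by metis

section \<open>Q-categories, Q-functors and adjunctions\<close>

lemma qrelD:
  "qrel X Y \<phi> \<Longrightarrow> x \<in> Car X \<Longrightarrow> y \<in> Car Y \<Longrightarrow> \<phi> x y \<in> Hom Q (Ty X x) (Ty Y y)"
  "qrel X Y \<phi> \<Longrightarrow> \<not> (x \<in> Car X \<and> y \<in> Car Y) \<Longrightarrow> \<phi> x y = undefined"
  by (auto simp: qrel_def)

lemma rcomp_hom:
  assumes "qrel X Y \<phi>" "qrel Y Z \<psi>" "x \<in> Car X" "z \<in> Car Z" "Ty X x \<in> Ob Q" "Ty Z z \<in> Ob Q"
  shows "rcomp X Y Z \<psi> \<phi> x z \<in> Hom Q (Ty X x) (Ty Z z)"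
  using assms cmp_hom[OF qrelD(1)[OF assms(1)] qrelD(1)[OF assms(2)]]
  by (auto simp: rcomp_def intro!: hsup_hom)

lemma cmp_rcomp_le_iff:
  assumes "qrel X Y \<phi>" "qrel Y Z \<psi>" "x \<in> Car X" "z \<in> Car Z"
    and v: "v \<in> Hom Q (Ty Z z) t" and w: "w \<in> Hom Q (Ty X x) t"
  shows "v \<cdot> rcomp X Y Z \<psi> \<phi> x z \<preceq> w \<longleftrightarrow> (\<forall>y\<in>Car Y. v \<cdot> \<psi> y z \<cdot> \<phi> x y \<preceq> w)"
proof -
  have "(\<lambda>y. \<psi> y z \<cdot> \<phi> x y) ` Car Y \<subseteq> Hom Q (Ty X x) (Ty Z z)"
    using cmp_hom[OF qrelD(1)[OF assms(1)] qrelD(1)[OF assms(2)]] assms by auto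
  from cmp_hsup_le_iff[OF this v w] show ?thesis using assms by (simp add: rcomp_def)
qed

lemma rcomp_cmp_le_iff:
  assumes "qrel X Y \<phi>" "qrel Y Z \<psi>" "x \<in> Car X" "z \<in> Car Z"
    and v: "v \<in> Hom Q t (Ty X x)" and w: "w \<in> Hom Q t (Ty Z z)"
  shows "rcomp X Y Z \<psi> \<phi> x z \<cdot> v \<preceq> w \<longleftrightarrow> (\<forall>y\<in>Car Y. (\<psi> y z \<cdot> \<phi> x y) \<cdot> v \<preceq> w)"
proof -
  have "(\<lambda>y. \<psi> y z \<cdot> \<phi> x y) ` Car Y \<subseteq> Hom Q (Ty X x) (Ty Z z)"
    using cmp_hom[OF qrelD(1)[OF assms(1)] qrelD(1)[OF assms(2)]] assms by auto
  from hsup_cmp_le_iff[OF this v w] show ?thesis using assms by (simp add: rcomp_def)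
qed

lemma rcomp_le_iff:
  assumes "qrel X Y \<phi>" "qrel Y Z \<psi>" "x \<in> Car X" "z \<in> Car Z"
    and w: "w \<in> Hom Q (Ty X x) (Ty Z z)"
  shows "rcomp X Y Z \<psi> \<phi> x z \<preceq> w \<longleftrightarrow> (\<forall>y\<in>Car Y. \<psi> y z \<cdot> \<phi> x y \<preceq> w)"
proof -
  have "(\<lambda>y. \<psi> y z \<cdot> \<phi> x y) ` Car Y \<subseteq> Hom Q (Ty X x) (Ty Z z)"
    using cmp_hom[OF qrelD(1)[OF assms(1)] qrelD(1)[OF assms(2)]] assms by auto
  from hsup_le_iff[OF this w] show ?thesis using assms by (simp add: rcomp_def)
qed

lemma qcategory_iff:
  "qcategory X \<longleftrightarrow> Ty X \<in> Car X \<rightarrow>\<^sub>E Ob Q \<and> qrel X X (Hm X) \<and>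
     (\<forall>x\<in>Car X. Idn Q (Ty X x) \<preceq> Hm X x x) \<and>
     (\<forall>x\<in>Car X. \<forall>y\<in>Car X. \<forall>z\<in>Car X. Hm X y z \<cdot> Hm X x y \<preceq> Hm X x z)"
proof -
  have "rel_le X X (rcomp X X X (Hm X) (Hm X)) (Hm X) \<longleftrightarrow>
      (\<forall>x\<in>Car X. \<forall>y\<in>Car X. \<forall>z\<in>Car X. Hm X y z \<cdot> Hm X x y \<preceq> Hm X x z)"
    if "qrel X X (Hm X)"
    unfolding rel_le_def using rcomp_le_iff[OF that that _ _ qrelD(1)[OF that]] by auto
  then show ?thesis unfolding qcategory_def by blast
qed

lemma qcatD:
  assumes "qcategory X"
  shows Ty_Ob: "x \<in> Car X \<Longrightarrow> Ty X x \<in> Ob Q"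
    and Hm_qrel: "qrel X X (Hm X)"
    and Hm_hom: "x \<in> Car X \<Longrightarrow> y \<in> Car X \<Longrightarrow> Hm X x y \<in> Hom Q (Ty X x) (Ty X y)"
    and Hm_undef: "\<not> (x \<in> Car X \<and> y \<in> Car X) \<Longrightarrow> Hm X x y = undefined"
    and idn_le_Hm: "x \<in> Car X \<Longrightarrow> Idn Q (Ty X x) \<preceq> Hm X x x"
    and Hm_cmp_le: "x \<in> Car X \<Longrightarrow> y \<in> Car X \<Longrightarrow> z \<in> Car X \<Longrightarrow> Hm X y z \<cdot> Hm X x y \<preceq> Hm X x z"
  using assms by (auto simp: qcategory_iff qrel_def)

lemma ord_le_refl: "qcategory X \<Longrightarrow> x \<in> Car X \<Longrightarrow> ord_le X x x"
  using idn_le_Hm by (simp add: ord_le_def)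

lemma ord_le_trans:
  assumes X: "qcategory X" and le: "ord_le X x y" "ord_le X y z"
    and car: "x \<in> Car X" "y \<in> Car X" "z \<in> Car X"
  shows "ord_le X x z"
proof -
  let ?t = "Ty X z"
  have ty: "Ty X x = ?t" "Ty X y = ?t" using le by (auto simp: ord_le_def)
  have h: "Hm X x y \<in> Hom Q ?t ?t" "Hm X y z \<in> Hom Q ?t ?t" "Hm X x z \<in> Hom Q ?t ?t"
    using Hm_hom[OF X] car ty by metis+
  have i: "Idn Q ?t \<in> Hom Q ?t ?t" using idn_hom Ty_Ob[OF X] car by blast
  have "Hm X x y \<preceq> Hm X y z \<cdot> Hm X x y"
    using idn_le_cmp_left[OF _ h(2) h(1)] le ty by (simp add: ord_le_def)
  from qle_trans[OF this Hm_cmp_le[OF X car] h(1) cmp_hom[OF h(1,2)] h(3)]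
  have "Hm X x y \<preceq> Hm X x z" .
  then show ?thesis using qle_trans[OF _ _ i h(1) h(3)] le ty by (simp add: ord_le_def)
qed

text \<open>The Yoneda principle for the preorder of a Q-category, in both variances.\<close>

lemma ord_le_iff_Hm:
  assumes X: "qcategory X" and car: "x \<in> Car X" "x' \<in> Car X" and ty: "Ty X x = Ty X x'"
  shows "ord_le X x x' \<longleftrightarrow> (\<forall>z\<in>Car X. Hm X z x \<preceq> Hm X z x')" (is "_ \<longleftrightarrow> ?R")
    and "ord_le X x x' \<longleftrightarrow> (\<forall>z\<in>Car X. Hm X x' z \<preceq> Hm X x z)" (is "_ \<longleftrightarrow> ?R'")
proof -
  let ?t = "Ty X x'"
  have h: "Hm X x x' \<in> Hom Q ?t ?t" "Hm X x x \<in> Hom Q ?t ?t" "Hm X x' x' \<in> Hom Q ?t ?t"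
    using Hm_hom[OF X] car ty by metis+
  have i: "Idn Q ?t \<in> Hom Q ?t ?t" using idn_hom Ty_Ob[OF X] car by blast
  have *: "ord_le X x x' \<longleftrightarrow> Idn Q ?t \<preceq> Hm X x x'" using ty by (simp add: ord_le_def)
  show "ord_le X x x' \<longleftrightarrow> ?R"
  proof
    assume le: "ord_le X x x'"
    show ?R
    proof
      fix z assume z: "z \<in> Car X"
      have hz: "Hm X z x \<in> Hom Q (Ty X z) ?t" "Hm X z x' \<in> Hom Q (Ty X z) ?t"
        using Hm_hom[OF X z] car ty by metis+
      show "Hm X z x \<preceq> Hm X z x'"
        using qle_trans[OF idn_le_cmp_left[OF _ h(1) hz(1)] Hm_cmp_le[OF X z car] hz(1)
            cmp_hom[OF hz(1) h(1)] hz(2)] le * by blast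
    qed
  next
    assume ?R
    then show "ord_le X x x'" unfolding * using qle_trans[OF _ _ i h(2) h(1)] idn_le_Hm[OF X] car ty
      by metis
  qed
  show "ord_le X x x' \<longleftrightarrow> ?R'"
  proof
    assume le: "ord_le X x x'"
    show ?R'
    proof
      fix z assume z: "z \<in> Car X"
      have hz: "Hm X x z \<in> Hom Q ?t (Ty X z)" "Hm X x' z \<in> Hom Q ?t (Ty X z)"
        using Hm_hom[OF X _ z] car ty by metis+
      show "Hm X x' z \<preceq> Hm X x z"
        using qle_trans[OF idn_le_cmp_right[OF _ h(1) hz(2)] Hm_cmp_le[OF X car z] hz(2)
            cmp_hom[OF h(1) hz(2)] hz(1)] le * by blast
    qed
  next
    assume ?R'
    then show "ord_le X x x'" unfolding * using qle_trans[OF _ _ i h(3) h(1)] idn_le_Hm[OF X] car ty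
      by metis
  qed
qed

lemma ord_le_HmD:
  assumes "qcategory X" "ord_le X x x'" "x \<in> Car X" "x' \<in> Car X" "z \<in> Car X"
  shows "Hm X z x \<preceq> Hm X z x'" "Hm X x' z \<preceq> Hm X x z"
proof -
  have ty: "Ty X x = Ty X x'" using assms(2) by (simp add: ord_le_def)
  show "Hm X z x \<preceq> Hm X z x'" "Hm X x' z \<preceq> Hm X x z"
    using ord_le_iff_Hm[OF assms(1,3,4) ty] assms(2,5) by blast+
qed

lemma qfunctorD:
  assumes "qfunctor X Y f"
  shows qfun_ext: "f \<in> extensional (Car X)"
    and qfun_car: "x \<in> Car X \<Longrightarrow> f x \<in> Car Y"
    and qfun_ty: "x \<in> Car X \<Longrightarrow> Ty Y (f x) = Ty X x"
    and qfun_Hm: "x \<in> Car X \<Longrightarrow> x' \<in> Car X \<Longrightarrow> Hm X x x' \<preceq> Hm Y (f x) (f x')"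
  using assms by (auto simp: qfunctor_def PiE_def)

lemma qfun_Hm_hom:
  assumes "qcategory Y" "qfunctor X Y f" "x \<in> Car X" "y \<in> Car Y"
  shows "Hm Y (f x) y \<in> Hom Q (Ty X x) (Ty Y y)" "Hm Y y (f x) \<in> Hom Q (Ty Y y) (Ty X x)"
  using Hm_hom[OF assms(1) _ assms(4)] Hm_hom[OF assms(1,4)] qfun_car[OF assms(2,3)]
    qfun_ty[OF assms(2,3)] by metis+

lemma qfun_mono:
  assumes "qcategory X" "qcategory Y" "qfunctor X Y f" "ord_le X x x'" "x \<in> Car X" "x' \<in> Car X"
  shows "ord_le Y (f x) (f x')"
proof -
  have ty: "Ty X x' = Ty X x" using assms by (simp add: ord_le_def)
  have h: "Hm X x x' \<in> Hom Q (Ty X x) (Ty X x)" using Hm_hom[of X x x'] assms ty by simp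
  have h': "Hm Y (f x) (f x') \<in> Hom Q (Ty X x) (Ty X x)"
    using qfun_Hm_hom(1)[OF assms(2,3,5) qfun_car[OF assms(3,6)]] qfun_ty[OF assms(3,6)] ty by simp
  show ?thesis
    using qle_trans[OF _ qfun_Hm[OF assms(3,5,6)] idn_hom[OF Ty_Ob[OF assms(1,5)]] h h'] assms ty
      qfun_ty[OF assms(3)] by (simp add: ord_le_def)
qed

lemma qfun_id: "qcategory X \<Longrightarrow> qfunctor X X (\<lambda>x\<in>Car X. x)"
  using qle_refl[OF Hm_hom] by (auto simp: qfunctor_def)

lemma qfun_comp:
  assumes X: "qcategory X" and Y: "qcategory Y" and Z: "qcategory Z"
    and f: "qfunctor X Y f" and g: "qfunctor Y Z g"
  shows "qfunctor X Z (compose (Car X) g f)"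
  unfolding qfunctor_def
proof (intro conjI ballI)
  show "compose (Car X) g f \<in> Car X \<rightarrow>\<^sub>E Car Z"
    using qfun_car[OF f] qfun_car[OF g] by (auto simp: compose_def)
  show "Ty Z (compose (Car X) g f x) = Ty X x" if "x \<in> Car X" for x
    using that qfun_car[OF f] qfun_ty[OF f] qfun_ty[OF g] by (simp add: compose_def)
  fix x x' assume x: "x \<in> Car X" "x' \<in> Car X"
  note fx = qfun_car[OF f x(1)] qfun_car[OF f x(2)]
  have h: "Hm Z (g (f x)) (g (f x')) \<in> Hom Q (Ty X x) (Ty X x')"
    using qfun_Hm_hom(1)[OF Z g fx(1) qfun_car[OF g fx(2)]] qfun_ty[OF g fx(2)]
      qfun_ty[OF f x(1)] qfun_ty[OF f x(2)] by simp
  have h': "Hm Y (f x) (f x') \<in> Hom Q (Ty X x) (Ty X x')"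
    using qfun_Hm_hom(1)[OF Y f x(1) fx(2)] qfun_ty[OF f x(2)] by simp
  show "Hm X x x' \<preceq> Hm Z (compose (Car X) g f x) (compose (Car X) g f x')"
    using qle_trans[OF qfun_Hm[OF f x] qfun_Hm[OF g fx] Hm_hom[OF X x] h' h] x
    by (simp add: compose_def)
qed

definition separated :: "('a, 'o, 'q) qcat \<Rightarrow> bool" where
  "separated X \<longleftrightarrow> (\<forall>x\<in>Car X. \<forall>x'\<in>Car X. ord_le X x x' \<longrightarrow> ord_le X x' x \<longrightarrow> x = x')"

lemma separatedD:
  "separated X \<Longrightarrow> ord_le X x x' \<Longrightarrow> ord_le X x' x \<Longrightarrow> x \<in> Car X \<Longrightarrow> x' \<in> Car X \<Longrightarrow> x = x'"
  by (auto simp: separated_def)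

text \<open>
  Equality of generalized elements: in a separated Q-category an element is determined by its hom
  into, or out of, all others.
\<close>

lemma separated_eqI:
  assumes "separated X" "qcategory X" "x \<in> Car X" "x' \<in> Car X" "Ty X x = Ty X x'"
    and "(\<forall>z\<in>Car X. Hm X z x = Hm X z x') \<or> (\<forall>z\<in>Car X. Hm X x z = Hm X x' z)"
  shows "x = x'"
proof (rule separatedD[OF assms(1) _ _ assms(3,4)])
  have 1: "z \<in> Car X \<Longrightarrow> Hm X z x \<preceq> Hm X z x" "z \<in> Car X \<Longrightarrow> Hm X x z \<preceq> Hm X x z" for z
    using Hm_hom[OF assms(2)] assms(3) qle_refl by blast+
  show "ord_le X x x'"
    using ord_le_iff_Hm[OF assms(2-5)] assms(6) 1 by metis
  show "ord_le X x' x"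
    using ord_le_iff_Hm[OF assms(2,4,3) assms(5)[symmetric]] assms(6) 1 by metis
qed

text \<open>
  An adjunction between Q-functors, \<open>f\<close> being the left adjoint, in hom-set form.
\<close>

definition ladj :: "('a, 'o, 'q) qcat \<Rightarrow> ('b, 'o, 'q) qcat \<Rightarrow> ('a \<Rightarrow> 'b) \<Rightarrow> ('b \<Rightarrow> 'a) \<Rightarrow> bool" where
  "ladj X Y f g \<longleftrightarrow> qfunctor X Y f \<and> qfunctor Y X g \<and>
     (\<forall>x\<in>Car X. \<forall>y\<in>Car Y. Hm Y (f x) y = Hm X x (g y))"

lemma ladjD:
  assumes "ladj X Y f g"
  shows "qfunctor X Y f" "qfunctor Y X g"
    "x \<in> Car X \<Longrightarrow> y \<in> Car Y \<Longrightarrow> Hm Y (f x) y = Hm X x (g y)"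
  using assms by (auto simp: ladj_def)

text \<open>
  The hom-set bijection makes the second half of an adjunction functorial: evaluated at an identity it yields
  the unit, respectively the counit, and this is carried along by the functoriality of the first half.
\<close>

lemma ladjI_right:
  assumes X: "qcategory X" and Y: "qcategory Y" and g: "qfunctor Y X g"
    and f: "f \<in> Car X \<rightarrow>\<^sub>E Car Y" "\<And>x. x \<in> Car X \<Longrightarrow> Ty Y (f x) = Ty X x"
    and eq: "\<And>x y. x \<in> Car X \<Longrightarrow> y \<in> Car Y \<Longrightarrow> Hm Y (f x) y = Hm X x (g y)"
  shows "ladj X Y f g"
proof -
  have "Hm X x x' \<preceq> Hm Y (f x) (f x')" if x: "x \<in> Car X" "x' \<in> Car X" for x x'
  proof -
    have fx: "f x \<in> Car Y" "f x' \<in> Car Y" "g (f x') \<in> Car X" using f x qfun_car[OF g] by auto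
    have "ord_le X x' (g (f x'))"
      using idn_le_Hm[OF Y fx(2)] f(2)[OF x(2)] qfun_ty[OF g fx(2)] eq[OF x(2) fx(2)]
      by (simp add: ord_le_def)
    then have "Hm X x x' \<preceq> Hm X x (g (f x'))"
      using ord_le_HmD(1)[OF X _ x(2) fx(3) x(1)] by blast
    then show ?thesis using eq[OF x(1) fx(2)] by simp
  qed
  then show ?thesis using assms by (auto simp: ladj_def qfunctor_def)
qed

lemma ladjI_left:
  assumes X: "qcategory X" and Y: "qcategory Y" and f: "qfunctor X Y f"
    and g: "g \<in> Car Y \<rightarrow>\<^sub>E Car X" "\<And>y. y \<in> Car Y \<Longrightarrow> Ty X (g y) = Ty Y y"
    and eq: "\<And>x y. x \<in> Car X \<Longrightarrow> y \<in> Car Y \<Longrightarrow> Hm Y (f x) y = Hm X x (g y)"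
  shows "ladj X Y f g"
proof -
  have "Hm Y y y' \<preceq> Hm X (g y) (g y')" if y: "y \<in> Car Y" "y' \<in> Car Y" for y y'
  proof -
    have gy: "g y \<in> Car X" "g y' \<in> Car X" "f (g y) \<in> Car Y" using g y qfun_car[OF f] by auto
    have "ord_le Y (f (g y)) y"
      using idn_le_Hm[OF X gy(1)] g(2)[OF y(1)] qfun_ty[OF f gy(1)] eq[OF gy(1) y(1)]
      by (simp add: ord_le_def)
    then have "Hm Y y y' \<preceq> Hm Y (f (g y)) y'"
      using ord_le_HmD(2)[OF Y _ gy(3) y] by blast
    then show ?thesis using eq[OF gy(1) y(2)] by simp
  qed
  then show ?thesis using assms by (auto simp: ladj_def qfunctor_def)
qed

lemma ladj_ord_le_iff:
  assumes "ladj X Y f g" "x \<in> Car X" "y \<in> Car Y"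
  shows "ord_le Y (f x) y \<longleftrightarrow> ord_le X x (g y)"
  using ladjD(3)[OF assms] qfun_ty[OF ladjD(1)[OF assms(1)] assms(2)]
    qfun_ty[OF ladjD(2)[OF assms(1)] assms(3)] by (simp add: ord_le_def)

lemma ladj_unit: "ladj X Y f g \<Longrightarrow> qcategory Y \<Longrightarrow> x \<in> Car X \<Longrightarrow> ord_le X x (g (f x))"
  using ladj_ord_le_iff ord_le_refl qfun_car ladjD(1) by metis

lemma ladj_counit: "ladj X Y f g \<Longrightarrow> qcategory X \<Longrightarrow> y \<in> Car Y \<Longrightarrow> ord_le Y (f (g y)) y"
  using ladj_ord_le_iff ord_le_refl qfun_car ladjD(2) by metis

text \<open>
  This is the source of most functional identities below: left adjoints into a separated Q-category are
  compared through their right adjoints, which are often simple pointwise formulas while the left adjoints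
  are suprema.
\<close>

lemma left_adjoint_unique:
  assumes "ladj X Y f g" "ladj X Y f' g'" "separated Y" "qcategory Y" "x \<in> Car X"
    and "\<And>y. y \<in> Car Y \<Longrightarrow> g y = g' y"
  shows "f x = f' x"
  using qfun_car[OF ladjD(1)[OF assms(1)] assms(5)] qfun_car[OF ladjD(1)[OF assms(2)] assms(5)]
    qfun_ty[OF ladjD(1)[OF assms(1)] assms(5)] qfun_ty[OF ladjD(1)[OF assms(2)] assms(5)]
    ladjD(3)[OF assms(1) assms(5)] ladjD(3)[OF assms(2) assms(5)]
  by (intro separated_eqI[OF assms(3,4)]) (auto simp: assms(6))

lemma right_adjoint_unique:
  assumes "ladj X Y f g" "ladj X Y f' g'" "separated X" "qcategory X" "y \<in> Car Y"
    and "\<And>x. x \<in> Car X \<Longrightarrow> f x = f' x"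
  shows "g y = g' y"
  using qfun_car[OF ladjD(2)[OF assms(1)] assms(5)] qfun_car[OF ladjD(2)[OF assms(2)] assms(5)]
    qfun_ty[OF ladjD(2)[OF assms(1)] assms(5)] qfun_ty[OF ladjD(2)[OF assms(2)] assms(5)]
    ladjD(3)[OF assms(1) _ assms(5)] ladjD(3)[OF assms(2) _ assms(5)]
  by (intro separated_eqI[OF assms(3,4)]) (auto simp: assms(6))

lemma ladj_comp:
  assumes "qcategory X" "qcategory Y" "qcategory Z" "ladj X Y f g" "ladj Y Z h k"
  shows "ladj X Z (compose (Car X) h f) (compose (Car Z) g k)"
  using qfun_comp[OF assms(1-3) ladjD(1)[OF assms(4)] ladjD(1)[OF assms(5)]]
    qfun_comp[OF assms(3,2,1) ladjD(2)[OF assms(5)] ladjD(2)[OF assms(4)]]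
    ladjD(3)[OF assms(4)] ladjD(3)[OF assms(5)] qfun_car[OF ladjD(1)[OF assms(4)]]
    qfun_car[OF ladjD(2)[OF assms(5)]]
  by (auto simp: ladj_def compose_def)

lemma ladj_id: "qcategory X \<Longrightarrow> ladj X X (\<lambda>x\<in>Car X. x) (\<lambda>x\<in>Car X. x)"
  using qfun_id by (simp add: ladj_def)

section \<open>Presheaves\<close>

abbreviation ev :: "('a, 'o, 'q) psh \<Rightarrow> 'a \<Rightarrow> 'q" where
  "ev \<sigma> x \<equiv> snd \<sigma> x ()"

lemma single_simps [simp]:
  "Car (single s) = {()}" "Ty (single s) = (\<lambda>_. s)" "Hm (single s) = (\<lambda>_ _. Idn Q s)"
  by (simp_all add: single_def)

lemma qrel_single: "s \<in> Ob Q \<Longrightarrow> qrel (single s) (single s) (Hm (single s))"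
  by (simp add: qrel_def idn_hom)

lemma rcomp_qrel:
  assumes "qrel X Y \<phi>" "qrel Y Z \<psi>" "\<And>x. x \<in> Car X \<Longrightarrow> Ty X x \<in> Ob Q" "\<And>z. z \<in> Car Z \<Longrightarrow> Ty Z z \<in> Ob Q"
  shows "qrel X Z (rcomp X Y Z \<psi> \<phi>)"
  using rcomp_hom[OF assms(1,2)] assms(3,4) by (auto simp: qrel_def rcomp_def)

text \<open>
  The suprema hidden in relational composition are eliminated: a distributor is a
  Q-relation on which the homs of both sides act.
\<close>

lemma distributor_iff:
  assumes X: "qcategory X" and Y: "qrel Y Y (Hm Y)" "\<And>y. y \<in> Car Y \<Longrightarrow> Ty Y y \<in> Ob Q"
  shows "distributor X Y \<phi> \<longleftrightarrow> qrel X Y \<phi> \<and>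
    (\<forall>x\<in>Car X. \<forall>x'\<in>Car X. \<forall>y\<in>Car Y. \<forall>y'\<in>Car Y. Hm Y y y' \<cdot> \<phi> x' y \<cdot> Hm X x x' \<preceq> \<phi> x y')"
proof -
  have "rel_le X Y (rcomp X Y Y (Hm Y) (rcomp X X Y \<phi> (Hm X))) \<phi> \<longleftrightarrow>
    (\<forall>x\<in>Car X. \<forall>x'\<in>Car X. \<forall>y\<in>Car Y. \<forall>y'\<in>Car Y. Hm Y y y' \<cdot> \<phi> x' y \<cdot> Hm X x x' \<preceq> \<phi> x y')"
    if q: "qrel X Y \<phi>"
  proof -
    \<comment> \<open>The nested composite is unfolded from the outside, so that the left factor is carried along.\<close>
    note q' = rcomp_qrel[OF Hm_qrel[OF X] q Ty_Ob[OF X] Y(2)]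
    have "rcomp X Y Y (Hm Y) (rcomp X X Y \<phi> (Hm X)) x y' \<preceq> \<phi> x y' \<longleftrightarrow>
       (\<forall>y\<in>Car Y. \<forall>x'\<in>Car X. Hm Y y y' \<cdot> \<phi> x' y \<cdot> Hm X x x' \<preceq> \<phi> x y')"
      if x: "x \<in> Car X" and y': "y' \<in> Car Y" for x y'
      using rcomp_le_iff[OF q' Y(1) x y' qrelD(1)[OF q x y']]
        cmp_rcomp_le_iff[OF Hm_qrel[OF X] q x _ qrelD(1)[OF Y(1) _ y'] qrelD(1)[OF q x y']]
      by auto
    then show ?thesis unfolding rel_le_def by blast
  qed
  then show ?thesis unfolding distributor_def by blast
qed

lemma P_simps: "Car (P X) = PCar X" "\<sigma> \<in> Car (P X) \<Longrightarrow> Ty (P X) \<sigma> = fst \<sigma>"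
  by (simp_all add: P_def)

text \<open>
  For a distributor into a one-object Q-category the action of the target is by an identity arrow, which
  leaves only the action of \<open>X\<close>.
\<close>

lemma P_car_iff:
  assumes X: "qcategory X"
  shows "\<sigma> \<in> Car (P X) \<longleftrightarrow> fst \<sigma> \<in> Ob Q \<and>
    (\<forall>x\<in>Car X. ev \<sigma> x \<in> Hom Q (Ty X x) (fst \<sigma>)) \<and>
    (\<forall>x. x \<notin> Car X \<longrightarrow> ev \<sigma> x = undefined) \<and>
    (\<forall>x\<in>Car X. \<forall>x'\<in>Car X. ev \<sigma> x' \<cdot> Hm X x x' \<preceq> ev \<sigma> x)"
proof (cases "fst \<sigma> \<in> Ob Q")
  case True
  have "Idn Q (fst \<sigma>) \<cdot> ev \<sigma> x' \<cdot> Hm X x x' = ev \<sigma> x' \<cdot> Hm X x x'"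
    if "x \<in> Car X" "x' \<in> Car X" "ev \<sigma> x' \<in> Hom Q (Ty X x') (fst \<sigma>)" for x x'
    using idn_cmp cmp_hom Hm_hom[OF X that(1,2)] that(3) by blast
  then show ?thesis
    using True distributor_iff[OF X qrel_single[OF True], of "snd \<sigma>"]
    by (auto simp: P_simps PCar_def split_beta qrel_def)
next
  case False
  then show ?thesis by (auto simp: P_simps PCar_def)
qed

lemma PshD:
  assumes "qcategory X" "\<sigma> \<in> Car (P X)"
  shows psh_Ob: "fst \<sigma> \<in> Ob Q"
    and psh_hom: "x \<in> Car X \<Longrightarrow> ev \<sigma> x \<in> Hom Q (Ty X x) (fst \<sigma>)"
    and psh_undef: "x \<notin> Car X \<Longrightarrow> ev \<sigma> x = undefined"
    and psh_act: "x \<in> Car X \<Longrightarrow> x' \<in> Car X \<Longrightarrow> ev \<sigma> x' \<cdot> Hm X x x' \<preceq> ev \<sigma> x"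
  using assms P_car_iff by blast+

lemma psh_eqI:
  assumes "qcategory X" "\<sigma> \<in> Car (P X)" "\<sigma>' \<in> Car (P X)" "fst \<sigma> = fst \<sigma>'"
    and "\<And>x. x \<in> Car X \<Longrightarrow> ev \<sigma> x = ev \<sigma>' x"
  shows "\<sigma> = \<sigma>'"
proof (rule prod_eqI[OF assms(4)], intro ext)
  fix x and u :: unit
  show "snd \<sigma> x u = snd \<sigma>' x u"
    using assms(5) psh_undef[OF assms(1,2)] psh_undef[OF assms(1,3)] by (cases u; cases "x \<in> Car X") auto
qed

lemma P_Hm_hom:
  assumes X: "qcategory X" and s: "\<sigma> \<in> Car (P X)" "\<sigma>' \<in> Car (P X)"
  shows "Hm (P X) \<sigma> \<sigma>' \<in> Hom Q (fst \<sigma>) (fst \<sigma>')"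
proof -
  have "(\<lambda>x. limp (ev \<sigma>' x) (ev \<sigma> x)) ` Car X \<subseteq> Hom Q (fst \<sigma>) (fst \<sigma>')"
    using limp_prop(1)[OF psh_hom[OF X s(1)] psh_hom[OF X s(2)]] by blast
  from hinf_hom[OF this psh_Ob[OF X s(1)] psh_Ob[OF X s(2)]]
  show ?thesis using s by (simp add: P_def)
qed

lemma le_P_Hm_iff:
  assumes X: "qcategory X" and s: "\<sigma> \<in> Car (P X)" "\<sigma>' \<in> Car (P X)"
    and u: "u \<in> Hom Q (fst \<sigma>) (fst \<sigma>')"
  shows "u \<preceq> Hm (P X) \<sigma> \<sigma>' \<longleftrightarrow> (\<forall>x\<in>Car X. u \<cdot> ev \<sigma> x \<preceq> ev \<sigma>' x)"
proof -
  have "(\<lambda>x. limp (ev \<sigma>' x) (ev \<sigma> x)) ` Car X \<subseteq> Hom Q (fst \<sigma>) (fst \<sigma>')"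
    using limp_prop(1)[OF psh_hom[OF X s(1)] psh_hom[OF X s(2)]] by blast
  from le_hinf_iff[OF this u]
  show ?thesis using s limp_prop(2)[OF psh_hom[OF X s(1)] psh_hom[OF X s(2)] u] by (simp add: P_def)
qed

lemma P_Hm_cmp_le:
  assumes X: "qcategory X" and s: "\<sigma> \<in> Car (P X)" "\<sigma>' \<in> Car (P X)" and x: "x \<in> Car X"
  shows "Hm (P X) \<sigma> \<sigma>' \<cdot> ev \<sigma> x \<preceq> ev \<sigma>' x"
  using le_P_Hm_iff[OF X s P_Hm_hom[OF X s]] qle_refl[OF P_Hm_hom[OF X s]] x by blast

lemma P_qcat:
  assumes X: "qcategory X" shows "qcategory (P X)"
  unfolding qcategory_iff
proof (intro conjI ballI)
  show "Ty (P X) \<in> Car (P X) \<rightarrow>\<^sub>E Ob Q" using psh_Ob[OF X] by (auto simp: P_def)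
  show "qrel (P X) (P X) (Hm (P X))"
    using P_Hm_hom[OF X] by (auto simp: qrel_def P_simps(2)) (auto simp: P_def)
  show "Idn Q (Ty (P X) \<sigma>) \<preceq> Hm (P X) \<sigma> \<sigma>" if s: "\<sigma> \<in> Car (P X)" for \<sigma>
    using le_P_Hm_iff[OF X s s idn_hom[OF psh_Ob[OF X s]]] idn_cmp[OF psh_hom[OF X s]]
      qle_refl[OF psh_hom[OF X s]] s by (simp add: P_simps(2))
  fix a b c assume s: "a \<in> Car (P X)" "b \<in> Car (P X)" "c \<in> Car (P X)"
  let ?f = "Hm (P X) a b" and ?g = "Hm (P X) b c"
  have h: "?f \<in> Hom Q (fst a) (fst b)" "?g \<in> Hom Q (fst b) (fst c)" using P_Hm_hom[OF X] s by auto
  have "(?g \<cdot> ?f) \<cdot> ev a x \<preceq> ev c x" if x: "x \<in> Car X" for x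
  proof -
    note ha = psh_hom[OF X s(1) x] and hb = psh_hom[OF X s(2) x] and hc = psh_hom[OF X s(3) x]
    have "?g \<cdot> ?f \<cdot> ev a x \<preceq> ev c x"
      by (rule qle_trans[OF cmp_mono_right[OF P_Hm_cmp_le[OF X s(1,2) x] cmp_hom[OF ha h(1)] hb h(2)]
            P_Hm_cmp_le[OF X s(2,3) x] cmp_hom[OF cmp_hom[OF ha h(1)] h(2)] cmp_hom[OF hb h(2)] hc])
    then show ?thesis using cmp_assoc[OF ha h] by simp
  qed
  then show "?g \<cdot> ?f \<preceq> Hm (P X) a c" using le_P_Hm_iff[OF X s(1,3) cmp_hom[OF h]] by blast
qed

lemma P_ord_le_iff:
  assumes X: "qcategory X" and s: "\<sigma> \<in> Car (P X)" "\<sigma>' \<in> Car (P X)"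
  shows "ord_le (P X) \<sigma> \<sigma>' \<longleftrightarrow> fst \<sigma> = fst \<sigma>' \<and> (\<forall>x\<in>Car X. ev \<sigma> x \<preceq> ev \<sigma>' x)"
  using le_P_Hm_iff[OF X s, of "Idn Q (fst \<sigma>)"] idn_hom[OF psh_Ob[OF X s(1)]]
    idn_cmp[OF psh_hom[OF X s(1)]] s by (auto simp: ord_le_def P_simps(2))

lemma P_separated:
  assumes X: "qcategory X" shows "separated (P X)"
  unfolding separated_def
proof (intro ballI impI)
  fix a b assume s: "a \<in> Car (P X)" "b \<in> Car (P X)" and le: "ord_le (P X) a b" "ord_le (P X) b a"
  then show "a = b"
    using P_ord_le_iff[OF X s] P_ord_le_iff[OF X s(2,1)] psh_hom[OF X s(1)] psh_hom[OF X s(2)]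
    by (intro psh_eqI[OF X s]) (simp, metis qle_antisym)
qed

lemma yon_car:
  assumes X: "qcategory X" and x: "x \<in> Car X" shows "yon X x \<in> Car (P X)"
  using Ty_Ob[OF X] Hm_hom[OF X] Hm_undef[OF X] Hm_cmp_le[OF X] x by (simp add: P_car_iff[OF X] yon_def)

lemma yon_simps:
  "x \<in> Car X \<Longrightarrow> fst (yon X x) = Ty X x" "x \<in> Car X \<Longrightarrow> ev (yon X x) z = Hm X z x"
  by (simp_all add: yon_def)

lemma yoneda:
  assumes X: "qcategory X" and x: "x \<in> Car X" and s: "\<sigma> \<in> Car (P X)"
  shows "Hm (P X) (yon X x) \<sigma> = ev \<sigma> x"
proof (rule hom_eqI_below)
  note y = yon_car[OF X x]
  show "ev \<sigma> x \<in> Hom Q (Ty X x) (fst \<sigma>)" using psh_hom[OF X s x] .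
  show "Hm (P X) (yon X x) \<sigma> \<in> Hom Q (Ty X x) (fst \<sigma>)" using P_Hm_hom[OF X y s] x by (simp add: yon_simps)
  fix u assume u: "u \<in> Hom Q (Ty X x) (fst \<sigma>)"
  have "(\<forall>z\<in>Car X. u \<cdot> Hm X z x \<preceq> ev \<sigma> z) \<longleftrightarrow> u \<preceq> ev \<sigma> x"
  proof
    assume "\<forall>z\<in>Car X. u \<cdot> Hm X z x \<preceq> ev \<sigma> z"
    then show "u \<preceq> ev \<sigma> x"
      using qle_trans[OF idn_le_cmp_right[OF idn_le_Hm[OF X x] Hm_hom[OF X x x] u] _ u
          cmp_hom[OF Hm_hom[OF X x x] u] psh_hom[OF X s x]] x by blast
  next
    assume le: "u \<preceq> ev \<sigma> x"
    show "\<forall>z\<in>Car X. u \<cdot> Hm X z x \<preceq> ev \<sigma> z"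
    proof
      fix z assume z: "z \<in> Car X"
      note h = Hm_hom[OF X z x]
      show "u \<cdot> Hm X z x \<preceq> ev \<sigma> z"
        by (rule qle_trans[OF cmp_mono_left[OF le u psh_hom[OF X s x] h] psh_act[OF X s z x]
              cmp_hom[OF h u] cmp_hom[OF h psh_hom[OF X s x]] psh_hom[OF X s z]])
    qed
  qed
  then show "u \<preceq> Hm (P X) (yon X x) \<sigma> \<longleftrightarrow> u \<preceq> ev \<sigma> x"
    using le_P_Hm_iff[OF X y s] u x by (simp add: yon_simps)
qed

lemma yon_functor:
  assumes X: "qcategory X" shows "qfunctor X (P X) (yon X)"
  using yon_car[OF X] yoneda[OF X _ yon_car[OF X]] qle_refl[OF Hm_hom[OF X]]
  by (auto simp: qfunctor_def yon_simps P_simps(2)) (auto simp: yon_def)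

lemma yon_full:
  assumes X: "qcategory X" and x: "x \<in> Car X" "x' \<in> Car X"
  shows "Hm (P X) (yon X x) (yon X x') = Hm X x x'"
  using yoneda[OF X x(1) yon_car[OF X x(2)]] x by (simp add: yon_simps)

lemma psh_qrel: "\<sigma> \<in> Car (P X) \<Longrightarrow> qrel X (single (fst \<sigma>)) (snd \<sigma>)"
  by (auto simp: P_simps PCar_def distributor_def)

lemma graph_qrel: "qcategory Y \<Longrightarrow> qfunctor X Y f \<Longrightarrow> qrel X Y (graph X Y f)"
  using qfun_Hm_hom by (auto simp: qrel_def graph_def)

lemma cograph_qrel: "qcategory Y \<Longrightarrow> qfunctor X Y f \<Longrightarrow> qrel Y X (cograph X Y f)"
  using qfun_Hm_hom by (auto simp: qrel_def cograph_def)

text \<open>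
  Restriction along \<open>f\<close>: by the Yoneda argument, the supremum over \<open>Y\<close> in \<open>\<sigma> \<circ> f\<^sub>*\<close> is attained at \<open>y = f x\<close>.
\<close>

lemma Pinv_apply:
  assumes X: "qcategory X" and Y: "qcategory Y" and f: "qfunctor X Y f" and s: "\<sigma> \<in> Car (P Y)"
  shows "fst (Pinv X Y f \<sigma>) = fst \<sigma>"
    and "x \<in> Car X \<Longrightarrow> ev (Pinv X Y f \<sigma>) x = ev \<sigma> (f x)"
    and "Pinv X Y f \<sigma> \<in> Car (P X)"
proof -
  show 1: "fst (Pinv X Y f \<sigma>) = fst \<sigma>" using s by (simp add: Pinv_def split_beta)
  have 2: "ev (Pinv X Y f \<sigma>) x = ev \<sigma> (f x)" if x: "x \<in> Car X" for x
  proof -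
    note fx = qfun_car[OF f x]
    have h: "ev \<sigma> (f x) \<in> Hom Q (Ty X x) (fst \<sigma>)" using psh_hom[OF Y s fx] qfun_ty[OF f x] by simp
    have "rcomp X Y (single (fst \<sigma>)) (snd \<sigma>) (graph X Y f) x () = ev \<sigma> (f x)"
    proof (rule hom_eqI_below_above[OF _ h])
      show "rcomp X Y (single (fst \<sigma>)) (snd \<sigma>) (graph X Y f) x () \<in> Hom Q (Ty X x) (fst \<sigma>)"
        using rcomp_hom[OF graph_qrel[OF Y f] psh_qrel[OF s] x] Ty_Ob[OF X x] psh_Ob[OF Y s] by simp
      fix u assume u: "u \<in> Hom Q (Ty X x) (fst \<sigma>)"
      have "(\<forall>y\<in>Car Y. ev \<sigma> y \<cdot> Hm Y (f x) y \<preceq> u) \<longleftrightarrow> ev \<sigma> (f x) \<preceq> u"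
      proof
        assume "\<forall>y\<in>Car Y. ev \<sigma> y \<cdot> Hm Y (f x) y \<preceq> u"
        then have "ev \<sigma> (f x) \<cdot> Hm Y (f x) (f x) \<preceq> u" using fx by blast
        then show "ev \<sigma> (f x) \<preceq> u"
          using qle_trans[OF idn_le_cmp_right[OF idn_le_Hm[OF Y fx] Hm_hom[OF Y fx fx] psh_hom[OF Y s fx]]]
            cmp_hom[OF Hm_hom[OF Y fx fx] psh_hom[OF Y s fx]] psh_hom[OF Y s fx] u qfun_ty[OF f x]
          by simp
      next
        assume "ev \<sigma> (f x) \<preceq> u"
        then show "\<forall>y\<in>Car Y. ev \<sigma> y \<cdot> Hm Y (f x) y \<preceq> u"
          using qle_trans[OF psh_act[OF Y s fx] _ cmp_hom[OF qfun_Hm_hom(1)[OF Y f x] psh_hom[OF Y s]] h u]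
          by blast
      qed
      then show "rcomp X Y (single (fst \<sigma>)) (snd \<sigma>) (graph X Y f) x () \<preceq> u \<longleftrightarrow> ev \<sigma> (f x) \<preceq> u"
        using rcomp_le_iff[OF graph_qrel[OF Y f] psh_qrel[OF s] x, of "()" u] u x
        by (simp add: graph_def)
    qed
    then show ?thesis using s by (simp add: Pinv_def split_beta)
  qed
  then show "x \<in> Car X \<Longrightarrow> ev (Pinv X Y f \<sigma>) x = ev \<sigma> (f x)" .
  show "Pinv X Y f \<sigma> \<in> Car (P X)"
    unfolding P_car_iff[OF X] 1
  proof (intro conjI ballI allI impI)
    show "fst \<sigma> \<in> Ob Q" by (rule psh_Ob[OF Y s])
    show "ev (Pinv X Y f \<sigma>) x \<in> Hom Q (Ty X x) (fst \<sigma>)" if "x \<in> Car X" for x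
      using 2[OF that] psh_hom[OF Y s qfun_car[OF f that]] qfun_ty[OF f that] by simp
    show "ev (Pinv X Y f \<sigma>) x = undefined" if "x \<notin> Car X" for x
      using that s by (simp add: Pinv_def split_beta rcomp_def)
    fix x x' assume x: "x \<in> Car X" "x' \<in> Car X"
    note fx = qfun_car[OF f x(1)] qfun_car[OF f x(2)]
    have h: "ev \<sigma> (f x) \<in> Hom Q (Ty X x) (fst \<sigma>)" "ev \<sigma> (f x') \<in> Hom Q (Ty X x') (fst \<sigma>)"
      using psh_hom[OF Y s] fx qfun_ty[OF f] x by metis+
    have h': "Hm Y (f x) (f x') \<in> Hom Q (Ty X x) (Ty X x')"
      using qfun_Hm_hom(1)[OF Y f x(1) fx(2)] qfun_ty[OF f x(2)] by simp
    show "ev (Pinv X Y f \<sigma>) x' \<cdot> Hm X x x' \<preceq> ev (Pinv X Y f \<sigma>) x"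
      unfolding 2[OF x(1)] 2[OF x(2)]
      by (rule qle_trans[OF cmp_mono_right[OF qfun_Hm[OF f x] Hm_hom[OF X x] h' h(2)] psh_act[OF Y s fx]
            cmp_hom[OF Hm_hom[OF X x] h(2)] cmp_hom[OF h' h(2)] h(1)])
  qed
qed

lemma Pinv_functor:
  assumes X: "qcategory X" and Y: "qcategory Y" and f: "qfunctor X Y f"
  shows "qfunctor (P Y) (P X) (Pinv X Y f)"
  unfolding qfunctor_def
proof (intro conjI ballI)
  note app = Pinv_apply[OF X Y f]
  show "Pinv X Y f \<in> Car (P Y) \<rightarrow>\<^sub>E Car (P X)" using app(3) by (auto simp: Pinv_def)
  show "Ty (P X) (Pinv X Y f \<sigma>) = Ty (P Y) \<sigma>" if "\<sigma> \<in> Car (P Y)" for \<sigma>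
    using app(1,3)[OF that] that by (simp add: P_simps(2))
  fix a b assume s: "a \<in> Car (P Y)" "b \<in> Car (P Y)"
  show "Hm (P Y) a b \<preceq> Hm (P X) (Pinv X Y f a) (Pinv X Y f b)"
    using le_P_Hm_iff[OF X app(3)[OF s(1)] app(3)[OF s(2)]] P_Hm_hom[OF Y s] P_Hm_cmp_le[OF Y s]
      app(1,2)[OF s(1)] app(1,2)[OF s(2)] qfun_car[OF f] by simp
qed

text \<open>
  A direct image is a supremum and is only ever compared with upper bounds.  The third part includes
  composition with an arrow \<open>u\<close> because upper bounds occur as elements of homs of \<open>P Y\<close>.
\<close>

lemma Pdir_apply:
  assumes X: "qcategory X" and Y: "qcategory Y" and f: "qfunctor X Y f" and s: "\<sigma> \<in> Car (P X)"
  shows "fst (Pdir X Y f \<sigma>) = fst \<sigma>"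
    and "y \<in> Car Y \<Longrightarrow> ev (Pdir X Y f \<sigma>) y \<in> Hom Q (Ty Y y) (fst \<sigma>)"
    and "y \<in> Car Y \<Longrightarrow> u \<in> Hom Q (fst \<sigma>) t \<Longrightarrow> w \<in> Hom Q (Ty Y y) t \<Longrightarrow>
      u \<cdot> ev (Pdir X Y f \<sigma>) y \<preceq> w \<longleftrightarrow> (\<forall>x\<in>Car X. u \<cdot> ev \<sigma> x \<cdot> Hm Y y (f x) \<preceq> w)"
    and "Pdir X Y f \<sigma> \<in> Car (P Y)"
proof -
  show 1: "fst (Pdir X Y f \<sigma>) = fst \<sigma>" using s by (simp add: Pdir_def split_beta)
  have 2: "ev (Pdir X Y f \<sigma>) y = rcomp Y X (single (fst \<sigma>)) (snd \<sigma>) (cograph X Y f) y ()" for y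
    using s by (simp add: Pdir_def split_beta)
  note q = cograph_qrel[OF Y f] psh_qrel[OF s]
  have h: "ev (Pdir X Y f \<sigma>) y \<in> Hom Q (Ty Y y) (fst \<sigma>)" if y: "y \<in> Car Y" for y
    using rcomp_hom[OF q y] Ty_Ob[OF Y y] psh_Ob[OF X s] by (simp add: 2)
  then show "y \<in> Car Y \<Longrightarrow> ev (Pdir X Y f \<sigma>) y \<in> Hom Q (Ty Y y) (fst \<sigma>)" .
  show "u \<cdot> ev (Pdir X Y f \<sigma>) y \<preceq> w \<longleftrightarrow> (\<forall>x\<in>Car X. u \<cdot> ev \<sigma> x \<cdot> Hm Y y (f x) \<preceq> w)"
    if y: "y \<in> Car Y" and u: "u \<in> Hom Q (fst \<sigma>) t" and w: "w \<in> Hom Q (Ty Y y) t"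
    using cmp_rcomp_le_iff[OF q y, of "()" u t w] u w y by (simp add: 2 cograph_def)
  show "Pdir X Y f \<sigma> \<in> Car (P Y)"
    unfolding P_car_iff[OF Y] 1
  proof (intro conjI ballI allI impI)
    show "fst \<sigma> \<in> Ob Q" by (rule psh_Ob[OF X s])
    show "ev (Pdir X Y f \<sigma>) y \<in> Hom Q (Ty Y y) (fst \<sigma>)" if "y \<in> Car Y" for y
      using h that .
    show "ev (Pdir X Y f \<sigma>) y = undefined" if "y \<notin> Car Y" for y
      using that by (simp add: 2 rcomp_def)
    fix y y' assume y: "y \<in> Car Y" "y' \<in> Car Y"
    note hy = Hm_hom[OF Y y]
    have "(ev \<sigma> x \<cdot> Hm Y y' (f x)) \<cdot> Hm Y y y' \<preceq> ev (Pdir X Y f \<sigma>) y" if x: "x \<in> Car X" for x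
    proof -
      note hs = psh_hom[OF X s x] and hf = qfun_Hm_hom(2)[OF Y f x]
      have "ev \<sigma> x \<cdot> Hm Y y' (f x) \<cdot> Hm Y y y' \<preceq> ev \<sigma> x \<cdot> Hm Y y (f x)"
        using cmp_mono_right[OF Hm_cmp_le[OF Y y qfun_car[OF f x]] _ hf[OF y(1)] hs] cmp_hom[OF hy hf[OF y(2)]]
        by simp
      moreover have "ev \<sigma> x \<cdot> Hm Y y (f x) \<preceq> ev (Pdir X Y f \<sigma>) y"
        using rcomp_le_iff[OF q y(1), of "()" "ev (Pdir X Y f \<sigma>) y"] h[OF y(1)] qle_refl[OF h[OF y(1)]] x y
        by (simp add: 2 cograph_def)
      ultimately show ?thesis
        using qle_trans[OF _ _ cmp_hom[OF cmp_hom[OF hy hf[OF y(2)]] hs] cmp_hom[OF hf[OF y(1)] hs] h[OF y(1)]]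
          cmp_assoc[OF hy hf[OF y(2)] hs] by simp
    qed
    then show "ev (Pdir X Y f \<sigma>) y' \<cdot> Hm Y y y' \<preceq> ev (Pdir X Y f \<sigma>) y"
      using rcomp_cmp_le_iff[OF q y(2) _ hy, of "()" "ev (Pdir X Y f \<sigma>) y"] h[OF y(1)] y
      by (simp add: 2 cograph_def)
  qed
qed

text \<open>
  The direct image is the left Kan extension along \<open>f\<close>; its functoriality is part of the adjunction.
\<close>

lemma Pdir_ladj:
  assumes X: "qcategory X" and Y: "qcategory Y" and f: "qfunctor X Y f"
  shows "ladj (P X) (P Y) (Pdir X Y f) (Pinv X Y f)"
proof (rule ladjI_right[OF P_qcat[OF X] P_qcat[OF Y] Pinv_functor[OF X Y f]])
  note app = Pdir_apply[OF X Y f]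
  show "Pdir X Y f \<in> Car (P X) \<rightarrow>\<^sub>E Car (P Y)" using app(4) by (auto simp: Pdir_def)
  show "Ty (P Y) (Pdir X Y f \<sigma>) = Ty (P X) \<sigma>" if "\<sigma> \<in> Car (P X)" for \<sigma>
    using app(1,4)[OF that] that by (simp add: P_simps(2))
  fix a b assume a: "a \<in> Car (P X)" and b: "b \<in> Car (P Y)"
  note fb = Pinv_apply[OF X Y f b]
  show "Hm (P Y) (Pdir X Y f a) b = Hm (P X) a (Pinv X Y f b)"
  proof (rule hom_eqI_below)
    show "Hm (P Y) (Pdir X Y f a) b \<in> Hom Q (fst a) (fst b)"
      using P_Hm_hom[OF Y app(4)[OF a] b] app(1)[OF a] by simp
    show "Hm (P X) a (Pinv X Y f b) \<in> Hom Q (fst a) (fst b)"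
      using P_Hm_hom[OF X a fb(3)] fb(1) by simp
    fix u assume u: "u \<in> Hom Q (fst a) (fst b)"
    have "(\<forall>y\<in>Car Y. u \<cdot> ev a x \<cdot> Hm Y y (f x) \<preceq> ev b y) \<longleftrightarrow> u \<cdot> ev a x \<preceq> ev b (f x)"
      if x: "x \<in> Car X" for x
    proof -
      note ha = psh_hom[OF X a x] and fx = qfun_car[OF f x] and hf = qfun_Hm_hom(2)[OF Y f x]
      have hu: "u \<cdot> ev a x \<in> Hom Q (Ty X x) (fst b)" using cmp_hom[OF ha u] .
      have hb: "ev b (f x) \<in> Hom Q (Ty X x) (fst b)" using psh_hom[OF Y b fx] qfun_ty[OF f x] by simp
      have ass: "u \<cdot> ev a x \<cdot> Hm Y y (f x) = (u \<cdot> ev a x) \<cdot> Hm Y y (f x)" if "y \<in> Car Y" for y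
        using cmp_assoc[OF hf[OF that] ha u] .
      show ?thesis
      proof
        assume "\<forall>y\<in>Car Y. u \<cdot> ev a x \<cdot> Hm Y y (f x) \<preceq> ev b y"
        then have le: "(u \<cdot> ev a x) \<cdot> Hm Y (f x) (f x) \<preceq> ev b (f x)" using ass fx by simp
        have hff: "Hm Y (f x) (f x) \<in> Hom Q (Ty X x) (Ty X x)" using hf[OF fx] qfun_ty[OF f x] by simp
        show "u \<cdot> ev a x \<preceq> ev b (f x)"
          using qle_trans[OF idn_le_cmp_right[OF _ hff hu] le hu cmp_hom[OF hff hu] hb]
            idn_le_Hm[OF Y fx] qfun_ty[OF f x] by simp
      next
        assume le: "u \<cdot> ev a x \<preceq> ev b (f x)"
        have "(u \<cdot> ev a x) \<cdot> Hm Y y (f x) \<preceq> ev b y" if y: "y \<in> Car Y" for y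
          by (rule qle_trans[OF cmp_mono_left[OF le hu hb hf[OF y]] psh_act[OF Y b y fx]
              cmp_hom[OF hf[OF y] hu] cmp_hom[OF hf[OF y] hb] psh_hom[OF Y b y]])
        then show "\<forall>y\<in>Car Y. u \<cdot> ev a x \<cdot> Hm Y y (f x) \<preceq> ev b y" using ass by simp
      qed
    qed
    then show "u \<preceq> Hm (P Y) (Pdir X Y f a) b \<longleftrightarrow> u \<preceq> Hm (P X) a (Pinv X Y f b)"
      using le_P_Hm_iff[OF Y app(4)[OF a] b] app(1)[OF a] u le_P_Hm_iff[OF X a fb(3)] fb(1,2)
        app(3)[OF a _ u psh_hom[OF Y b]] by auto
  qed
qed

section \<open>Copresheaves\<close>

text \<open>
  The mirror image of the previous section.  Since the order of \<open>P\<^sup>\<dagger> X\<close> reverses that of arrows, direct image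
  is here the right adjoint of restriction.
\<close>

abbreviation cev :: "('a, 'o, 'q) copsh \<Rightarrow> 'a \<Rightarrow> 'q" where
  "cev \<tau> x \<equiv> snd \<tau> () x"

lemma single_qcat: "s \<in> Ob Q \<Longrightarrow> qcategory (single s)"
  using idn_hom[of s] cmp_idn[of "Idn Q s" s s] qle_refl[of "Idn Q s" s s] qrel_single[of s]
  by (auto simp: qcategory_iff)

lemma Pdag_simps: "Car (Pdag X) = PdagCar X" "\<tau> \<in> Car (Pdag X) \<Longrightarrow> Ty (Pdag X) \<tau> = fst \<tau>"
  by (simp_all add: Pdag_def)

lemma Pdag_car_iff:
  assumes X: "qcategory X"
  shows "\<tau> \<in> Car (Pdag X) \<longleftrightarrow> fst \<tau> \<in> Ob Q \<and>
    (\<forall>x\<in>Car X. cev \<tau> x \<in> Hom Q (fst \<tau>) (Ty X x)) \<and>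
    (\<forall>x. x \<notin> Car X \<longrightarrow> cev \<tau> x = undefined) \<and>
    (\<forall>x\<in>Car X. \<forall>x'\<in>Car X. Hm X x x' \<cdot> cev \<tau> x \<preceq> cev \<tau> x')"
proof (cases "fst \<tau> \<in> Ob Q")
  case True
  have "cev \<tau> x \<cdot> Idn Q (fst \<tau>) = cev \<tau> x" if "cev \<tau> x \<in> Hom Q (fst \<tau>) (Ty X x)" for x
    using cmp_idn that by blast
  then show ?thesis
    using True distributor_iff[OF single_qcat[OF True] Hm_qrel[OF X] Ty_Ob[OF X], of "snd \<tau>"]
    by (auto simp: Pdag_simps PdagCar_def split_beta qrel_def)
next
  case False
  then show ?thesis by (auto simp: Pdag_simps PdagCar_def)
qed

lemma copshD:
  assumes "qcategory X" "\<tau> \<in> Car (Pdag X)"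
  shows copsh_Ob: "fst \<tau> \<in> Ob Q"
    and copsh_hom: "x \<in> Car X \<Longrightarrow> cev \<tau> x \<in> Hom Q (fst \<tau>) (Ty X x)"
    and copsh_undef: "x \<notin> Car X \<Longrightarrow> cev \<tau> x = undefined"
    and copsh_act: "x \<in> Car X \<Longrightarrow> x' \<in> Car X \<Longrightarrow> Hm X x x' \<cdot> cev \<tau> x \<preceq> cev \<tau> x'"
  using assms Pdag_car_iff by blast+

lemma copsh_eqI:
  assumes "qcategory X" "\<tau> \<in> Car (Pdag X)" "\<tau>' \<in> Car (Pdag X)" "fst \<tau> = fst \<tau>'"
    and "\<And>x. x \<in> Car X \<Longrightarrow> cev \<tau> x = cev \<tau>' x"
  shows "\<tau> = \<tau>'"
proof (rule prod_eqI[OF assms(4)], intro ext)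
  fix x and u :: unit
  show "snd \<tau> u x = snd \<tau>' u x"
    using assms(5) copsh_undef[OF assms(1,2)] copsh_undef[OF assms(1,3)]
    by (cases u; cases "x \<in> Car X") auto
qed

lemma Pdag_Hm_hom:
  assumes X: "qcategory X" and s: "\<tau> \<in> Car (Pdag X)" "\<tau>' \<in> Car (Pdag X)"
  shows "Hm (Pdag X) \<tau> \<tau>' \<in> Hom Q (fst \<tau>) (fst \<tau>')"
proof -
  have "(\<lambda>x. rimp (cev \<tau>' x) (cev \<tau> x)) ` Car X \<subseteq> Hom Q (fst \<tau>) (fst \<tau>')"
    using rimp_prop(1)[OF copsh_hom[OF X s(2)] copsh_hom[OF X s(1)]] by blast
  from hinf_hom[OF this copsh_Ob[OF X s(1)] copsh_Ob[OF X s(2)]]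
  show ?thesis using s by (simp add: Pdag_def)
qed

lemma le_Pdag_Hm_iff:
  assumes X: "qcategory X" and s: "\<tau> \<in> Car (Pdag X)" "\<tau>' \<in> Car (Pdag X)"
    and u: "u \<in> Hom Q (fst \<tau>) (fst \<tau>')"
  shows "u \<preceq> Hm (Pdag X) \<tau> \<tau>' \<longleftrightarrow> (\<forall>x\<in>Car X. cev \<tau>' x \<cdot> u \<preceq> cev \<tau> x)"
proof -
  have "(\<lambda>x. rimp (cev \<tau>' x) (cev \<tau> x)) ` Car X \<subseteq> Hom Q (fst \<tau>) (fst \<tau>')"
    using rimp_prop(1)[OF copsh_hom[OF X s(2)] copsh_hom[OF X s(1)]] by blast
  from le_hinf_iff[OF this u]
  show ?thesis using s rimp_prop(2)[OF copsh_hom[OF X s(2)] copsh_hom[OF X s(1)] u]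
    by (simp add: Pdag_def)
qed

lemma Pdag_Hm_cmp_le:
  assumes X: "qcategory X" and s: "\<tau> \<in> Car (Pdag X)" "\<tau>' \<in> Car (Pdag X)" and x: "x \<in> Car X"
  shows "cev \<tau>' x \<cdot> Hm (Pdag X) \<tau> \<tau>' \<preceq> cev \<tau> x"
  using le_Pdag_Hm_iff[OF X s Pdag_Hm_hom[OF X s]] qle_refl[OF Pdag_Hm_hom[OF X s]] x by blast

lemma Pdag_qcat:
  assumes X: "qcategory X" shows "qcategory (Pdag X)"
  unfolding qcategory_iff
proof (intro conjI ballI)
  show "Ty (Pdag X) \<in> Car (Pdag X) \<rightarrow>\<^sub>E Ob Q" using copsh_Ob[OF X] by (auto simp: Pdag_def)
  show "qrel (Pdag X) (Pdag X) (Hm (Pdag X))"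
    using Pdag_Hm_hom[OF X] by (auto simp: qrel_def Pdag_simps(2)) (auto simp: Pdag_def)
  show "Idn Q (Ty (Pdag X) \<tau>) \<preceq> Hm (Pdag X) \<tau> \<tau>" if s: "\<tau> \<in> Car (Pdag X)" for \<tau>
    using le_Pdag_Hm_iff[OF X s s idn_hom[OF copsh_Ob[OF X s]]] cmp_idn[OF copsh_hom[OF X s]]
      qle_refl[OF copsh_hom[OF X s]] s by (simp add: Pdag_simps(2))
  fix a b c assume s: "a \<in> Car (Pdag X)" "b \<in> Car (Pdag X)" "c \<in> Car (Pdag X)"
  let ?f = "Hm (Pdag X) a b" and ?g = "Hm (Pdag X) b c"
  have h: "?f \<in> Hom Q (fst a) (fst b)" "?g \<in> Hom Q (fst b) (fst c)" using Pdag_Hm_hom[OF X] s by auto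
  have "cev c x \<cdot> ?g \<cdot> ?f \<preceq> cev a x" if x: "x \<in> Car X" for x
  proof -
    note ha = copsh_hom[OF X s(1) x] and hb = copsh_hom[OF X s(2) x] and hc = copsh_hom[OF X s(3) x]
    have "(cev c x \<cdot> ?g) \<cdot> ?f \<preceq> cev a x"
      by (rule qle_trans[OF cmp_mono_left[OF Pdag_Hm_cmp_le[OF X s(2,3) x] cmp_hom[OF h(2) hc] hb h(1)]
            Pdag_Hm_cmp_le[OF X s(1,2) x] cmp_hom[OF h(1) cmp_hom[OF h(2) hc]] cmp_hom[OF h(1) hb] ha])
    then show ?thesis using cmp_assoc[OF h hc] by simp
  qed
  then show "?g \<cdot> ?f \<preceq> Hm (Pdag X) a c" using le_Pdag_Hm_iff[OF X s(1,3) cmp_hom[OF h]] by blast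
qed

lemma Pdag_ord_le_iff:
  assumes X: "qcategory X" and s: "\<tau> \<in> Car (Pdag X)" "\<tau>' \<in> Car (Pdag X)"
  shows "ord_le (Pdag X) \<tau> \<tau>' \<longleftrightarrow> fst \<tau> = fst \<tau>' \<and> (\<forall>x\<in>Car X. cev \<tau>' x \<preceq> cev \<tau> x)"
proof (cases "fst \<tau> = fst \<tau>'")
  case True
  then show ?thesis
    using le_Pdag_Hm_iff[OF X s, of "Idn Q (fst \<tau>)"] idn_hom[OF copsh_Ob[OF X s(1)]]
      cmp_idn[OF copsh_hom[OF X s(2)]] s by (auto simp: ord_le_def Pdag_simps(2))
qed (use s in \<open>simp add: ord_le_def Pdag_simps(2)\<close>)

lemma Pdag_separated:
  assumes X: "qcategory X" shows "separated (Pdag X)"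
  unfolding separated_def
proof (intro ballI impI)
  fix a b assume s: "a \<in> Car (Pdag X)" "b \<in> Car (Pdag X)"
    and le: "ord_le (Pdag X) a b" "ord_le (Pdag X) b a"
  then show "a = b"
    using Pdag_ord_le_iff[OF X s] Pdag_ord_le_iff[OF X s(2,1)] copsh_hom[OF X s(1)] copsh_hom[OF X s(2)]
    by (intro copsh_eqI[OF X s]) (simp, metis qle_antisym)
qed

lemma coyon_car:
  assumes X: "qcategory X" and x: "x \<in> Car X" shows "coyon X x \<in> Car (Pdag X)"
  using Ty_Ob[OF X] Hm_hom[OF X] Hm_undef[OF X] Hm_cmp_le[OF X] x
  by (simp add: Pdag_car_iff[OF X] coyon_def)

lemma coyon_simps:
  "x \<in> Car X \<Longrightarrow> fst (coyon X x) = Ty X x" "x \<in> Car X \<Longrightarrow> cev (coyon X x) z = Hm X x z"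
  by (simp_all add: coyon_def)

lemma coyoneda:
  assumes X: "qcategory X" and x: "x \<in> Car X" and s: "\<tau> \<in> Car (Pdag X)"
  shows "Hm (Pdag X) \<tau> (coyon X x) = cev \<tau> x"
proof (rule hom_eqI_below)
  note y = coyon_car[OF X x]
  show "cev \<tau> x \<in> Hom Q (fst \<tau>) (Ty X x)" using copsh_hom[OF X s x] .
  show "Hm (Pdag X) \<tau> (coyon X x) \<in> Hom Q (fst \<tau>) (Ty X x)"
    using Pdag_Hm_hom[OF X s y] x by (simp add: coyon_simps)
  fix u assume u: "u \<in> Hom Q (fst \<tau>) (Ty X x)"
  have "(\<forall>z\<in>Car X. Hm X x z \<cdot> u \<preceq> cev \<tau> z) \<longleftrightarrow> u \<preceq> cev \<tau> x"
  proof
    assume "\<forall>z\<in>Car X. Hm X x z \<cdot> u \<preceq> cev \<tau> z"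
    then show "u \<preceq> cev \<tau> x"
      using qle_trans[OF idn_le_cmp_left[OF idn_le_Hm[OF X x] Hm_hom[OF X x x] u] _ u
          cmp_hom[OF u Hm_hom[OF X x x]] copsh_hom[OF X s x]] x by blast
  next
    assume le: "u \<preceq> cev \<tau> x"
    show "\<forall>z\<in>Car X. Hm X x z \<cdot> u \<preceq> cev \<tau> z"
    proof
      fix z assume z: "z \<in> Car X"
      note h = Hm_hom[OF X x z]
      show "Hm X x z \<cdot> u \<preceq> cev \<tau> z"
        by (rule qle_trans[OF cmp_mono_right[OF le u copsh_hom[OF X s x] h] copsh_act[OF X s x z]
              cmp_hom[OF u h] cmp_hom[OF copsh_hom[OF X s x] h] copsh_hom[OF X s z]])
    qed
  qed
  then show "u \<preceq> Hm (Pdag X) \<tau> (coyon X x) \<longleftrightarrow> u \<preceq> cev \<tau> x"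
    using le_Pdag_Hm_iff[OF X s y] u x by (simp add: coyon_simps)
qed

lemma coyon_functor:
  assumes X: "qcategory X" shows "qfunctor X (Pdag X) (coyon X)"
  using coyon_car[OF X] coyoneda[OF X _ coyon_car[OF X]] qle_refl[OF Hm_hom[OF X]]
  by (auto simp: qfunctor_def coyon_simps Pdag_simps(2)) (auto simp: coyon_def)

lemma coyon_full:
  assumes X: "qcategory X" and x: "x \<in> Car X" "x' \<in> Car X"
  shows "Hm (Pdag X) (coyon X x) (coyon X x') = Hm X x x'"
  using coyoneda[OF X x(2) coyon_car[OF X x(1)]] x by (simp add: coyon_simps)

lemma copsh_qrel: "\<tau> \<in> Car (Pdag X) \<Longrightarrow> qrel (single (fst \<tau>)) X (snd \<tau>)"
  by (auto simp: Pdag_simps PdagCar_def distributor_def)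

lemma Cinv_apply:
  assumes X: "qcategory X" and Y: "qcategory Y" and f: "qfunctor X Y f" and s: "\<tau> \<in> Car (Pdag Y)"
  shows "fst (Cinv X Y f \<tau>) = fst \<tau>"
    and "x \<in> Car X \<Longrightarrow> cev (Cinv X Y f \<tau>) x = cev \<tau> (f x)"
    and "Cinv X Y f \<tau> \<in> Car (Pdag X)"
proof -
  show 1: "fst (Cinv X Y f \<tau>) = fst \<tau>" using s by (simp add: Cinv_def split_beta)
  have 2: "cev (Cinv X Y f \<tau>) x = cev \<tau> (f x)" if x: "x \<in> Car X" for x
  proof -
    note fx = qfun_car[OF f x]
    have h: "cev \<tau> (f x) \<in> Hom Q (fst \<tau>) (Ty X x)" using copsh_hom[OF Y s fx] qfun_ty[OF f x] by simp
    have "rcomp (single (fst \<tau>)) Y X (cograph X Y f) (snd \<tau>) () x = cev \<tau> (f x)"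
    proof (rule hom_eqI_below_above[OF _ h])
      show "rcomp (single (fst \<tau>)) Y X (cograph X Y f) (snd \<tau>) () x \<in> Hom Q (fst \<tau>) (Ty X x)"
        using rcomp_hom[OF copsh_qrel[OF s] cograph_qrel[OF Y f] _ x] Ty_Ob[OF X x] copsh_Ob[OF Y s] by simp
      fix u assume u: "u \<in> Hom Q (fst \<tau>) (Ty X x)"
      have "(\<forall>y\<in>Car Y. Hm Y y (f x) \<cdot> cev \<tau> y \<preceq> u) \<longleftrightarrow> cev \<tau> (f x) \<preceq> u"
      proof
        assume "\<forall>y\<in>Car Y. Hm Y y (f x) \<cdot> cev \<tau> y \<preceq> u"
        then have "Hm Y (f x) (f x) \<cdot> cev \<tau> (f x) \<preceq> u" using fx by blast
        then show "cev \<tau> (f x) \<preceq> u"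
          using qle_trans[OF idn_le_cmp_left[OF idn_le_Hm[OF Y fx] Hm_hom[OF Y fx fx] copsh_hom[OF Y s fx]]]
            cmp_hom[OF copsh_hom[OF Y s fx] Hm_hom[OF Y fx fx]] copsh_hom[OF Y s fx] u qfun_ty[OF f x]
          by simp
      next
        assume "cev \<tau> (f x) \<preceq> u"
        then show "\<forall>y\<in>Car Y. Hm Y y (f x) \<cdot> cev \<tau> y \<preceq> u"
          using qle_trans[OF copsh_act[OF Y s _ fx] _ cmp_hom[OF copsh_hom[OF Y s] qfun_Hm_hom(2)[OF Y f x]] h u]
          by blast
      qed
      then show "rcomp (single (fst \<tau>)) Y X (cograph X Y f) (snd \<tau>) () x \<preceq> u \<longleftrightarrow> cev \<tau> (f x) \<preceq> u"
        using rcomp_le_iff[OF copsh_qrel[OF s] cograph_qrel[OF Y f] _ x, of "()" u] u x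
        by (simp add: cograph_def)
    qed
    then show ?thesis using s by (simp add: Cinv_def split_beta)
  qed
  then show "x \<in> Car X \<Longrightarrow> cev (Cinv X Y f \<tau>) x = cev \<tau> (f x)" .
  show "Cinv X Y f \<tau> \<in> Car (Pdag X)"
    unfolding Pdag_car_iff[OF X] 1
  proof (intro conjI ballI allI impI)
    show "fst \<tau> \<in> Ob Q" by (rule copsh_Ob[OF Y s])
    show "cev (Cinv X Y f \<tau>) x \<in> Hom Q (fst \<tau>) (Ty X x)" if "x \<in> Car X" for x
      using 2[OF that] copsh_hom[OF Y s qfun_car[OF f that]] qfun_ty[OF f that] by simp
    show "cev (Cinv X Y f \<tau>) x = undefined" if "x \<notin> Car X" for x
      using that s by (simp add: Cinv_def split_beta rcomp_def)
    fix x x' assume x: "x \<in> Car X" "x' \<in> Car X"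
    note fx = qfun_car[OF f x(1)] qfun_car[OF f x(2)]
    have h: "cev \<tau> (f x) \<in> Hom Q (fst \<tau>) (Ty X x)" "cev \<tau> (f x') \<in> Hom Q (fst \<tau>) (Ty X x')"
      using copsh_hom[OF Y s] fx qfun_ty[OF f] x by metis+
    have h': "Hm Y (f x) (f x') \<in> Hom Q (Ty X x) (Ty X x')"
      using qfun_Hm_hom(1)[OF Y f x(1) fx(2)] qfun_ty[OF f x(2)] by simp
    show "Hm X x x' \<cdot> cev (Cinv X Y f \<tau>) x \<preceq> cev (Cinv X Y f \<tau>) x'"
      unfolding 2[OF x(1)] 2[OF x(2)]
      by (rule qle_trans[OF cmp_mono_left[OF qfun_Hm[OF f x] Hm_hom[OF X x] h' h(1)] copsh_act[OF Y s fx]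
            cmp_hom[OF h(1) Hm_hom[OF X x]] cmp_hom[OF h(1) h'] h(2)])
  qed
qed

lemma Cinv_functor:
  assumes X: "qcategory X" and Y: "qcategory Y" and f: "qfunctor X Y f"
  shows "qfunctor (Pdag Y) (Pdag X) (Cinv X Y f)"
  unfolding qfunctor_def
proof (intro conjI ballI)
  note app = Cinv_apply[OF X Y f]
  show "Cinv X Y f \<in> Car (Pdag Y) \<rightarrow>\<^sub>E Car (Pdag X)" using app(3) by (auto simp: Cinv_def)
  show "Ty (Pdag X) (Cinv X Y f \<tau>) = Ty (Pdag Y) \<tau>" if "\<tau> \<in> Car (Pdag Y)" for \<tau>
    using app(1,3)[OF that] that by (simp add: Pdag_simps(2))
  fix a b assume s: "a \<in> Car (Pdag Y)" "b \<in> Car (Pdag Y)"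
  show "Hm (Pdag Y) a b \<preceq> Hm (Pdag X) (Cinv X Y f a) (Cinv X Y f b)"
    using le_Pdag_Hm_iff[OF X app(3)[OF s(1)] app(3)[OF s(2)]] Pdag_Hm_hom[OF Y s] Pdag_Hm_cmp_le[OF Y s]
      app(1,2)[OF s(1)] app(1,2)[OF s(2)] qfun_car[OF f] by simp
qed

lemma Cdir_apply:
  assumes X: "qcategory X" and Y: "qcategory Y" and f: "qfunctor X Y f" and s: "\<tau> \<in> Car (Pdag X)"
  shows "fst (Cdir X Y f \<tau>) = fst \<tau>"
    and "y \<in> Car Y \<Longrightarrow> cev (Cdir X Y f \<tau>) y \<in> Hom Q (fst \<tau>) (Ty Y y)"
    and "y \<in> Car Y \<Longrightarrow> u \<in> Hom Q t (fst \<tau>) \<Longrightarrow> w \<in> Hom Q t (Ty Y y) \<Longrightarrow>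
      cev (Cdir X Y f \<tau>) y \<cdot> u \<preceq> w \<longleftrightarrow> (\<forall>x\<in>Car X. (Hm Y (f x) y \<cdot> cev \<tau> x) \<cdot> u \<preceq> w)"
    and "Cdir X Y f \<tau> \<in> Car (Pdag Y)"
proof -
  show 1: "fst (Cdir X Y f \<tau>) = fst \<tau>" using s by (simp add: Cdir_def split_beta)
  have 2: "cev (Cdir X Y f \<tau>) y = rcomp (single (fst \<tau>)) X Y (graph X Y f) (snd \<tau>) () y" for y
    using s by (simp add: Cdir_def split_beta)
  note q = copsh_qrel[OF s] graph_qrel[OF Y f]
  have h: "cev (Cdir X Y f \<tau>) y \<in> Hom Q (fst \<tau>) (Ty Y y)" if y: "y \<in> Car Y" for y
    using rcomp_hom[OF q _ y] Ty_Ob[OF Y y] copsh_Ob[OF X s] by (simp add: 2)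
  then show "y \<in> Car Y \<Longrightarrow> cev (Cdir X Y f \<tau>) y \<in> Hom Q (fst \<tau>) (Ty Y y)" .
  show "cev (Cdir X Y f \<tau>) y \<cdot> u \<preceq> w \<longleftrightarrow> (\<forall>x\<in>Car X. (Hm Y (f x) y \<cdot> cev \<tau> x) \<cdot> u \<preceq> w)"
    if y: "y \<in> Car Y" and u: "u \<in> Hom Q t (fst \<tau>)" and w: "w \<in> Hom Q t (Ty Y y)"
    using rcomp_cmp_le_iff[OF q _ y, of "()" u t w] u w y by (simp add: 2 graph_def)
  show "Cdir X Y f \<tau> \<in> Car (Pdag Y)"
    unfolding Pdag_car_iff[OF Y] 1
  proof (intro conjI ballI allI impI)
    show "fst \<tau> \<in> Ob Q" by (rule copsh_Ob[OF X s])
    show "cev (Cdir X Y f \<tau>) y \<in> Hom Q (fst \<tau>) (Ty Y y)" if "y \<in> Car Y" for y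
      using h that .
    show "cev (Cdir X Y f \<tau>) y = undefined" if "y \<notin> Car Y" for y
      using that by (simp add: 2 rcomp_def)
    fix y y' assume y: "y \<in> Car Y" "y' \<in> Car Y"
    note hy = Hm_hom[OF Y y]
    have "Hm Y y y' \<cdot> Hm Y (f x) y \<cdot> cev \<tau> x \<preceq> cev (Cdir X Y f \<tau>) y'" if x: "x \<in> Car X" for x
    proof -
      note hs = copsh_hom[OF X s x] and hf = qfun_Hm_hom(1)[OF Y f x]
      have "(Hm Y y y' \<cdot> Hm Y (f x) y) \<cdot> cev \<tau> x \<preceq> Hm Y (f x) y' \<cdot> cev \<tau> x"
        using cmp_mono_left[OF Hm_cmp_le[OF Y qfun_car[OF f x] y] _ hf[OF y(2)] hs] cmp_hom[OF hf[OF y(1)] hy]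
        by simp
      moreover have "Hm Y (f x) y' \<cdot> cev \<tau> x \<preceq> cev (Cdir X Y f \<tau>) y'"
        using rcomp_le_iff[OF q _ y(2), of "()" "cev (Cdir X Y f \<tau>) y'"] h[OF y(2)] qle_refl[OF h[OF y(2)]] x y
        by (simp add: 2 graph_def)
      ultimately show ?thesis
        using qle_trans[OF _ _ cmp_hom[OF hs cmp_hom[OF hf[OF y(1)] hy]] cmp_hom[OF hs hf[OF y(2)]] h[OF y(2)]]
          cmp_assoc[OF hs hf[OF y(1)] hy] by simp
    qed
    then show "Hm Y y y' \<cdot> cev (Cdir X Y f \<tau>) y \<preceq> cev (Cdir X Y f \<tau>) y'"
      using cmp_rcomp_le_iff[OF q _ y(1) hy, of "()" "cev (Cdir X Y f \<tau>) y'"] h[OF y(2)] y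
      by (simp add: 2 graph_def)
  qed
qed

text \<open>
  Direct image of copresheaves is a supremum of arrows, hence, in the reversed order, a right Kan extension.
\<close>

lemma Cinv_ladj:
  assumes X: "qcategory X" and Y: "qcategory Y" and f: "qfunctor X Y f"
  shows "ladj (Pdag Y) (Pdag X) (Cinv X Y f) (Cdir X Y f)"
proof (rule ladjI_left[OF Pdag_qcat[OF Y] Pdag_qcat[OF X] Cinv_functor[OF X Y f]])
  note app = Cdir_apply[OF X Y f]
  show "Cdir X Y f \<in> Car (Pdag X) \<rightarrow>\<^sub>E Car (Pdag Y)" using app(4) by (auto simp: Cdir_def)
  show "Ty (Pdag Y) (Cdir X Y f \<tau>) = Ty (Pdag X) \<tau>" if "\<tau> \<in> Car (Pdag X)" for \<tau>
    using app(1,4)[OF that] that by (simp add: Pdag_simps(2))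
  fix b a assume b: "b \<in> Car (Pdag Y)" and a: "a \<in> Car (Pdag X)"
  note fb = Cinv_apply[OF X Y f b]
  show "Hm (Pdag X) (Cinv X Y f b) a = Hm (Pdag Y) b (Cdir X Y f a)"
  proof (rule hom_eqI_below)
    show "Hm (Pdag Y) b (Cdir X Y f a) \<in> Hom Q (fst b) (fst a)"
      using Pdag_Hm_hom[OF Y b app(4)[OF a]] app(1)[OF a] by simp
    show "Hm (Pdag X) (Cinv X Y f b) a \<in> Hom Q (fst b) (fst a)"
      using Pdag_Hm_hom[OF X fb(3) a] fb(1) by simp
    fix u assume u: "u \<in> Hom Q (fst b) (fst a)"
    have "(\<forall>y\<in>Car Y. (Hm Y (f x) y \<cdot> cev a x) \<cdot> u \<preceq> cev b y) \<longleftrightarrow> cev a x \<cdot> u \<preceq> cev b (f x)"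
      if x: "x \<in> Car X" for x
    proof -
      note ha = copsh_hom[OF X a x] and fx = qfun_car[OF f x] and hf = qfun_Hm_hom(1)[OF Y f x]
      have hu: "cev a x \<cdot> u \<in> Hom Q (fst b) (Ty X x)" using cmp_hom[OF u ha] .
      have hb: "cev b (f x) \<in> Hom Q (fst b) (Ty X x)" using copsh_hom[OF Y b fx] qfun_ty[OF f x] by simp
      have ass: "(Hm Y (f x) y \<cdot> cev a x) \<cdot> u = Hm Y (f x) y \<cdot> cev a x \<cdot> u" if "y \<in> Car Y" for y
        using cmp_assoc[OF u ha hf[OF that]] by simp
      show ?thesis
      proof
        assume "\<forall>y\<in>Car Y. (Hm Y (f x) y \<cdot> cev a x) \<cdot> u \<preceq> cev b y"
        then have le: "Hm Y (f x) (f x) \<cdot> cev a x \<cdot> u \<preceq> cev b (f x)" using ass fx by simp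
        have hff: "Hm Y (f x) (f x) \<in> Hom Q (Ty X x) (Ty X x)" using hf[OF fx] qfun_ty[OF f x] by simp
        show "cev a x \<cdot> u \<preceq> cev b (f x)"
          using qle_trans[OF idn_le_cmp_left[OF _ hff hu] le hu cmp_hom[OF hu hff] hb]
            idn_le_Hm[OF Y fx] qfun_ty[OF f x] by simp
      next
        assume le: "cev a x \<cdot> u \<preceq> cev b (f x)"
        have "Hm Y (f x) y \<cdot> cev a x \<cdot> u \<preceq> cev b y" if y: "y \<in> Car Y" for y
          by (rule qle_trans[OF cmp_mono_right[OF le hu hb hf[OF y]] copsh_act[OF Y b fx y]
              cmp_hom[OF hu hf[OF y]] cmp_hom[OF hb hf[OF y]] copsh_hom[OF Y b y]])
        then show "\<forall>y\<in>Car Y. (Hm Y (f x) y \<cdot> cev a x) \<cdot> u \<preceq> cev b y" using ass by simp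
      qed
    qed
    then show "u \<preceq> Hm (Pdag X) (Cinv X Y f b) a \<longleftrightarrow> u \<preceq> Hm (Pdag Y) b (Cdir X Y f a)"
      using le_Pdag_Hm_iff[OF Y b app(4)[OF a]] app(1)[OF a] u le_Pdag_Hm_iff[OF X fb(3) a] fb(1,2)
        app(3)[OF a _ u copsh_hom[OF Y b]] by auto
  qed
qed

section \<open>Calculus of direct and inverse images\<close>

lemma ladjI_unit_counit:
  assumes X: "qcategory X" and Y: "qcategory Y" and f: "qfunctor X Y f" and g: "qfunctor Y X g"
    and unit: "\<And>x. x \<in> Car X \<Longrightarrow> ord_le X x (g (f x))"
    and counit: "\<And>y. y \<in> Car Y \<Longrightarrow> ord_le Y (f (g y)) y"
  shows "ladj X Y f g"
proof -
  have "Hm Y (f x) y = Hm X x (g y)" if x: "x \<in> Car X" and y: "y \<in> Car Y" for x y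
  proof -
    note fx = qfun_car[OF f x] and gy = qfun_car[OF g y]
    note h = qfun_Hm_hom(1)[OF Y f x y]
    have h2: "Hm X x (g y) \<in> Hom Q (Ty X x) (Ty Y y)"
      using qfun_Hm_hom(2)[OF X g y x] .
    have h3: "Hm X (g (f x)) (g y) \<in> Hom Q (Ty X x) (Ty Y y)"
      using qfun_Hm_hom(2)[OF X g y qfun_car[OF g fx]] qfun_ty[OF g fx] qfun_ty[OF f x] by simp
    have h4: "Hm Y (f x) (f (g y)) \<in> Hom Q (Ty X x) (Ty Y y)"
      using qfun_Hm_hom(1)[OF Y f x qfun_car[OF f gy]] qfun_ty[OF f gy] qfun_ty[OF g y] by simp
    have "Hm Y (f x) y \<preceq> Hm X x (g y)"
      by (rule qle_trans[OF qfun_Hm[OF g fx y] ord_le_HmD(2)[OF X unit[OF x] x qfun_car[OF g fx] gy] h h3 h2])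
    moreover have "Hm X x (g y) \<preceq> Hm Y (f x) y"
      by (rule qle_trans[OF qfun_Hm[OF f x gy] ord_le_HmD(1)[OF Y counit[OF y] qfun_car[OF f gy] y fx] h2 h4 h])
    ultimately show ?thesis using qle_antisym[OF h h2] by blast
  qed
  then show ?thesis using f g by (simp add: ladj_def)
qed

lemma Pdir_functor:
  "qcategory X \<Longrightarrow> qcategory Y \<Longrightarrow> qfunctor X Y f \<Longrightarrow> qfunctor (P X) (P Y) (Pdir X Y f)"
  using Pdir_ladj ladjD(1) by blast

lemma Cdir_functor:
  "qcategory X \<Longrightarrow> qcategory Y \<Longrightarrow> qfunctor X Y f \<Longrightarrow> qfunctor (Pdag X) (Pdag Y) (Cdir X Y f)"
  using Cinv_ladj ladjD(2) by blast

lemma Pinv_comp: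
  assumes X: "qcategory X" and Y: "qcategory Y" and Z: "qcategory Z"
    and f: "qfunctor X Y f" and g: "qfunctor Y Z g" and s: "\<rho> \<in> Car (P Z)"
  shows "Pinv X Y f (Pinv Y Z g \<rho>) = Pinv X Z (compose (Car X) g f) \<rho>"
  using Pinv_apply[OF X Y f Pinv_apply(3)[OF Y Z g s]] Pinv_apply[OF Y Z g s]
    Pinv_apply[OF X Z qfun_comp[OF X Y Z f g] s] qfun_car[OF f]
  by (intro psh_eqI[OF X]) (simp_all add: compose_def)

lemma Cinv_comp:
  assumes X: "qcategory X" and Y: "qcategory Y" and Z: "qcategory Z"
    and f: "qfunctor X Y f" and g: "qfunctor Y Z g" and s: "\<rho> \<in> Car (Pdag Z)"
  shows "Cinv X Y f (Cinv Y Z g \<rho>) = Cinv X Z (compose (Car X) g f) \<rho>"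
  using Cinv_apply[OF X Y f Cinv_apply(3)[OF Y Z g s]] Cinv_apply[OF Y Z g s]
    Cinv_apply[OF X Z qfun_comp[OF X Y Z f g] s] qfun_car[OF f]
  by (intro copsh_eqI[OF X]) (simp_all add: compose_def)

lemma Pdir_comp:
  assumes X: "qcategory X" and Y: "qcategory Y" and Z: "qcategory Z"
    and f: "qfunctor X Y f" and g: "qfunctor Y Z g" and s: "\<sigma> \<in> Car (P X)"
  shows "Pdir Y Z g (Pdir X Y f \<sigma>) = Pdir X Z (compose (Car X) g f) \<sigma>"
proof -
  note l = ladj_comp[OF P_qcat[OF X] P_qcat[OF Y] P_qcat[OF Z] Pdir_ladj[OF X Y f] Pdir_ladj[OF Y Z g]]
  from left_adjoint_unique[OF l Pdir_ladj[OF X Z qfun_comp[OF X Y Z f g]] P_separated[OF Z] P_qcat[OF Z] s]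
  show ?thesis using Pinv_comp[OF X Y Z f g] s by (simp add: compose_def)
qed

lemma Cdir_comp:
  assumes X: "qcategory X" and Y: "qcategory Y" and Z: "qcategory Z"
    and f: "qfunctor X Y f" and g: "qfunctor Y Z g" and s: "\<tau> \<in> Car (Pdag X)"
  shows "Cdir Y Z g (Cdir X Y f \<tau>) = Cdir X Z (compose (Car X) g f) \<tau>"
proof -
  note l = ladj_comp[OF Pdag_qcat[OF Z] Pdag_qcat[OF Y] Pdag_qcat[OF X] Cinv_ladj[OF Y Z g] Cinv_ladj[OF X Y f]]
  from right_adjoint_unique[OF l Cinv_ladj[OF X Z qfun_comp[OF X Y Z f g]] Pdag_separated[OF Z] Pdag_qcat[OF Z] s]
  show ?thesis using Cinv_comp[OF X Y Z f g] s by (simp add: compose_def)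
qed

lemma Pinv_id:
  assumes X: "qcategory X" and s: "\<sigma> \<in> Car (P X)" shows "Pinv X X (\<lambda>x\<in>Car X. x) \<sigma> = \<sigma>"
  using Pinv_apply[OF X X qfun_id[OF X] s] s by (intro psh_eqI[OF X]) simp_all

lemma Cinv_id:
  assumes X: "qcategory X" and t: "\<tau> \<in> Car (Pdag X)" shows "Cinv X X (\<lambda>x\<in>Car X. x) \<tau> = \<tau>"
  using Cinv_apply[OF X X qfun_id[OF X] t] t by (intro copsh_eqI[OF X]) simp_all

lemma Pdir_id:
  assumes X: "qcategory X" and s: "\<sigma> \<in> Car (P X)" shows "Pdir X X (\<lambda>x\<in>Car X. x) \<sigma> = \<sigma>"
  using left_adjoint_unique[OF Pdir_ladj[OF X X qfun_id[OF X]] ladj_id[OF P_qcat[OF X]]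
      P_separated[OF X] P_qcat[OF X] s] Pinv_id[OF X] s by simp

lemma Cdir_id:
  assumes X: "qcategory X" and s: "\<tau> \<in> Car (Pdag X)" shows "Cdir X X (\<lambda>x\<in>Car X. x) \<tau> = \<tau>"
  using right_adjoint_unique[OF Cinv_ladj[OF X X qfun_id[OF X]] ladj_id[OF Pdag_qcat[OF X]]
      Pdag_separated[OF X] Pdag_qcat[OF X] s] Cinv_id[OF X] s by simp

text \<open>
  A presheaf is its own hom out of representables, and these depend monotonically on the
  representing element.
\<close>

lemma psh_antimono:
  assumes X: "qcategory X" and s: "\<sigma> \<in> Car (P X)" and x: "x \<in> Car X" "x' \<in> Car X" "ord_le X x x'"
  shows "ev \<sigma> x' \<preceq> ev \<sigma> x"
  using ord_le_HmD(2)[OF P_qcat[OF X] qfun_mono[OF X P_qcat[OF X] yon_functor[OF X] x(3,1,2)]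
      yon_car[OF X x(1)] yon_car[OF X x(2)] s] yoneda[OF X x(1) s] yoneda[OF X x(2) s] by simp

lemma copsh_mono:
  assumes X: "qcategory X" and s: "\<tau> \<in> Car (Pdag X)" and x: "x \<in> Car X" "x' \<in> Car X" "ord_le X x x'"
  shows "cev \<tau> x \<preceq> cev \<tau> x'"
  using ord_le_HmD(1)[OF Pdag_qcat[OF X] qfun_mono[OF X Pdag_qcat[OF X] coyon_functor[OF X] x(3,1,2)]
      coyon_car[OF X x(1)] coyon_car[OF X x(2)] s] coyoneda[OF X x(1) s] coyoneda[OF X x(2) s] by simp

text \<open>
  Passing to left adjoints reverses the order of maps, and restriction of presheaves is contravariant in
  the order of \<open>f\<close>; so direct image is covariant.
\<close>

lemma Pdir_mono:
  assumes X: "qcategory X" and Y: "qcategory Y" and f: "qfunctor X Y f" and g: "qfunctor X Y g"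
    and le: "fun_le X Y f g" and s: "\<sigma> \<in> Car (P X)"
  shows "ord_le (P Y) (Pdir X Y f \<sigma>) (Pdir X Y g \<sigma>)"
proof -
  note gs = Pdir_apply(4)[OF X Y g s]
  note a = Pinv_apply[OF X Y f gs] and b = Pinv_apply[OF X Y g gs]
  have "ord_le (P X) (Pinv X Y g (Pdir X Y g \<sigma>)) (Pinv X Y f (Pdir X Y g \<sigma>))"
    using psh_antimono[OF Y gs qfun_car[OF f] qfun_car[OF g]] le a b P_ord_le_iff[OF X b(3) a(3)]
    by (simp add: fun_le_def)
  with ladj_unit[OF Pdir_ladj[OF X Y g] P_qcat[OF Y] s]
  have "ord_le (P X) \<sigma> (Pinv X Y f (Pdir X Y g \<sigma>))"
    using ord_le_trans[OF P_qcat[OF X] _ _ s b(3) a(3)] by blast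
  then show ?thesis using ladj_ord_le_iff[OF Pdir_ladj[OF X Y f] s gs] by blast
qed

lemma Cdir_mono:
  assumes X: "qcategory X" and Y: "qcategory Y" and f: "qfunctor X Y f" and g: "qfunctor X Y g"
    and le: "fun_le X Y f g" and s: "\<tau> \<in> Car (Pdag X)"
  shows "ord_le (Pdag Y) (Cdir X Y f \<tau>) (Cdir X Y g \<tau>)"
proof -
  note fs = Cdir_apply(4)[OF X Y f s]
  note a = Cinv_apply[OF X Y f fs] and b = Cinv_apply[OF X Y g fs]
  have "ord_le (Pdag X) (Cinv X Y g (Cdir X Y f \<tau>)) (Cinv X Y f (Cdir X Y f \<tau>))"
    using copsh_mono[OF Y fs qfun_car[OF f] qfun_car[OF g]] le a b Pdag_ord_le_iff[OF X b(3) a(3)]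
    by (simp add: fun_le_def)
  with ladj_counit[OF Cinv_ladj[OF X Y f] Pdag_qcat[OF Y] s]
  have "ord_le (Pdag X) (Cinv X Y g (Cdir X Y f \<tau>)) \<tau>"
    using ord_le_trans[OF Pdag_qcat[OF X] _ _ b(3) a(3) s] by blast
  then show ?thesis using ladj_ord_le_iff[OF Cinv_ladj[OF X Y g] fs s] by blast
qed

lemma Pdir_yon:
  assumes X: "qcategory X" and Y: "qcategory Y" and f: "qfunctor X Y f" and x: "x \<in> Car X"
  shows "Pdir X Y f (yon X x) = yon Y (f x)"
proof (rule separated_eqI[OF P_separated[OF Y] P_qcat[OF Y]])
  note fx = qfun_car[OF f x] and yx = yon_car[OF X x]
  show c: "Pdir X Y f (yon X x) \<in> Car (P Y)" "yon Y (f x) \<in> Car (P Y)"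
    using Pdir_apply(4)[OF X Y f yx] yon_car[OF Y fx] .
  show "Ty (P Y) (Pdir X Y f (yon X x)) = Ty (P Y) (yon Y (f x))"
    using c Pdir_apply(1)[OF X Y f yx] qfun_ty[OF f x] x fx by (simp add: P_simps(2) yon_simps)
  show "(\<forall>z\<in>Car (P Y). Hm (P Y) z (Pdir X Y f (yon X x)) = Hm (P Y) z (yon Y (f x))) \<or>
    (\<forall>z\<in>Car (P Y). Hm (P Y) (Pdir X Y f (yon X x)) z = Hm (P Y) (yon Y (f x)) z)"
    using ladjD(3)[OF Pdir_ladj[OF X Y f] yx] yoneda[OF X x Pinv_apply(3)[OF X Y f]]
      Pinv_apply(2)[OF X Y f _ x] yoneda[OF Y fx] by simp
qed

lemma Cdir_coyon:
  assumes X: "qcategory X" and Y: "qcategory Y" and f: "qfunctor X Y f" and x: "x \<in> Car X"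
  shows "Cdir X Y f (coyon X x) = coyon Y (f x)"
proof (rule separated_eqI[OF Pdag_separated[OF Y] Pdag_qcat[OF Y]])
  note fx = qfun_car[OF f x] and yx = coyon_car[OF X x]
  show c: "Cdir X Y f (coyon X x) \<in> Car (Pdag Y)" "coyon Y (f x) \<in> Car (Pdag Y)"
    using Cdir_apply(4)[OF X Y f yx] coyon_car[OF Y fx] .
  show "Ty (Pdag Y) (Cdir X Y f (coyon X x)) = Ty (Pdag Y) (coyon Y (f x))"
    using c Cdir_apply(1)[OF X Y f yx] qfun_ty[OF f x] x fx by (simp add: Pdag_simps(2) coyon_simps)
  show "(\<forall>z\<in>Car (Pdag Y). Hm (Pdag Y) z (Cdir X Y f (coyon X x)) = Hm (Pdag Y) z (coyon Y (f x))) \<or>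
    (\<forall>z\<in>Car (Pdag Y). Hm (Pdag Y) (Cdir X Y f (coyon X x)) z = Hm (Pdag Y) (coyon Y (f x)) z)"
    using ladjD(3)[OF Cinv_ladj[OF X Y f] _ yx] coyoneda[OF X x Cinv_apply(3)[OF X Y f]]
      Cinv_apply(2)[OF X Y f _ x] coyoneda[OF Y fx] by simp
qed

text \<open>
  For a left adjoint \<open>f\<close> the restriction of a representable is representable, which is a reformulation of
  the hom-set bijection.
\<close>

lemma Pinv_ladj_yon:
  assumes X: "qcategory X" and Y: "qcategory Y" and l: "ladj X Y f g" and y: "y \<in> Car Y"
  shows "Pinv X Y f (yon Y y) = yon X (g y)"
  using Pinv_apply[OF X Y ladjD(1)[OF l] yon_car[OF Y y]] yon_car[OF X qfun_car[OF ladjD(2)[OF l] y]]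
    qfun_car[OF ladjD(2)[OF l] y] qfun_ty[OF ladjD(2)[OF l] y] ladjD(3)[OF l _ y] y
    qfun_car[OF ladjD(1)[OF l]]
  by (intro psh_eqI[OF X]) (simp_all add: yon_simps)

text \<open>
  If \<open>g\<close> is left adjoint to \<open>h\<close>, the distributors \<open>g\<^sub>*\<close> and \<open>h\<^sup>*\<close> coincide; thus direct image along \<open>g\<close> is
  restriction along \<open>h\<close>, and the adjunction between restriction and direct image along \<open>h\<close> becomes an
  adjunction between the direct images along \<open>g\<close> and \<open>h\<close>.
\<close>

lemma Cdir_left_adjoint:
  assumes X: "qcategory X" and Y: "qcategory Y" and l: "ladj X Y g h" and t: "\<tau> \<in> Car (Pdag X)"
  shows "Cdir X Y g \<tau> = Cinv Y X h \<tau>"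
proof -
  note g = ladjD(1)[OF l] and h = ladjD(2)[OF l]
  note a = Cdir_apply[OF X Y g t] and b = Cinv_apply[OF Y X h t]
  note ga = Cinv_apply[OF X Y g a(4)] and gb = Cinv_apply[OF X Y g b(3)]
  have "cev \<tau> x \<preceq> cev \<tau> (h (g x))" if x: "x \<in> Car X" for x
    using copsh_mono[OF X t x qfun_car[OF h qfun_car[OF g x]] ladj_unit[OF l Y x]] .
  then have "ord_le (Pdag X) (Cinv X Y g (Cinv Y X h \<tau>)) \<tau>"
    using Pdag_ord_le_iff[OF X gb(3) t] gb b qfun_car[OF g] by simp
  then have 1: "ord_le (Pdag Y) (Cinv Y X h \<tau>) (Cdir X Y g \<tau>)"
    using ladj_ord_le_iff[OF Cinv_ladj[OF X Y g] b(3) t] by blast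
  have "cev \<tau> (h y) \<preceq> cev (Cdir X Y g \<tau>) y" if y: "y \<in> Car Y" for y
  proof -
    note hy = qfun_car[OF h y] and hyt = qfun_ty[OF h y]
    have "cev \<tau> (h y) \<preceq> cev (Cdir X Y g \<tau>) (g (h y))"
      using ladj_counit[OF Cinv_ladj[OF X Y g] Pdag_qcat[OF Y] t] hy
        Pdag_ord_le_iff[OF X ga(3) t] ga(2) by simp
    from qle_trans[OF this copsh_mono[OF Y a(4) qfun_car[OF g hy] y ladj_counit[OF l X y]]]
    show ?thesis
      using copsh_hom[OF X t hy] a(2)[OF qfun_car[OF g hy]] a(2)[OF y] hyt qfun_ty[OF g hy] by simp
  qed
  then have 2: "ord_le (Pdag Y) (Cdir X Y g \<tau>) (Cinv Y X h \<tau>)"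
    using Pdag_ord_le_iff[OF Y a(4) b(3)] a(1) b(1,2) by simp
  show ?thesis by (rule separatedD[OF Pdag_separated[OF Y] 2 1 a(4) b(3)])
qed

lemma ladj_Cdir:
  assumes X: "qcategory X" and Y: "qcategory Y" and l: "ladj X Y g h"
  shows "ladj (Pdag X) (Pdag Y) (Cdir X Y g) (Cdir Y X h)"
proof -
  have "Cdir X Y g = Cinv Y X h"
    by (rule extensionalityI[OF qfun_ext[OF Cdir_functor[OF X Y ladjD(1)[OF l]]]
          qfun_ext[OF Cinv_functor[OF Y X ladjD(2)[OF l]]] Cdir_left_adjoint[OF X Y l]])
  then show ?thesis using Cinv_ladj[OF Y X ladjD(2)[OF l]] by simp
qed

lemma Cinv_Cdir_full:
  assumes X: "qcategory X" and Y: "qcategory Y" and f: "qfunctor X Y f"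
    and full: "\<And>x x'. x \<in> Car X \<Longrightarrow> x' \<in> Car X \<Longrightarrow> Hm Y (f x) (f x') = Hm X x x'"
    and t: "\<tau> \<in> Car (Pdag X)"
  shows "Cinv X Y f (Cdir X Y f \<tau>) = \<tau>"
proof -
  note a = Cdir_apply[OF X Y f t]
  note b = Cinv_apply[OF X Y f a(4)]
  have "cev (Cdir X Y f \<tau>) (f x) \<preceq> cev \<tau> x" if x: "x \<in> Car X" for x
  proof -
    note fx = qfun_car[OF f x]
    have h: "cev \<tau> x \<in> Hom Q (fst \<tau>) (Ty Y (f x))" using copsh_hom[OF X t x] qfun_ty[OF f x] by simp
    have "(Hm Y (f x') (f x) \<cdot> cev \<tau> x') \<cdot> Idn Q (fst \<tau>) \<preceq> cev \<tau> x" if x': "x' \<in> Car X" for x'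
      using full[OF x' x] cmp_idn[OF cmp_hom[OF copsh_hom[OF X t x'] Hm_hom[OF X x' x]]]
        copsh_act[OF X t x' x] by simp
    then show ?thesis
      using a(3)[OF fx idn_hom[OF copsh_Ob[OF X t]] h] cmp_idn[OF a(2)[OF fx]] by simp
  qed
  then have "ord_le (Pdag X) \<tau> (Cinv X Y f (Cdir X Y f \<tau>))"
    using Pdag_ord_le_iff[OF X t b(3)] b a(1) by simp
  from separatedD[OF Pdag_separated[OF X] ladj_counit[OF Cinv_ladj[OF X Y f] Pdag_qcat[OF Y] t] this b(3) t]
  show ?thesis .
qed

section \<open>Suprema of presheaves and infima of double copresheaves\<close>

lemma Pmult_apply:
  assumes X: "qcategory X" and s: "\<Sigma> \<in> Car (P (P X))"
  shows "fst (Pmult X \<Sigma>) = fst \<Sigma>" "x \<in> Car X \<Longrightarrow> ev (Pmult X \<Sigma>) x = ev \<Sigma> (yon X x)"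
    "Pmult X \<Sigma> \<in> Car (P X)"
  using Pinv_apply[OF X P_qcat[OF X] yon_functor[OF X] s] by (simp_all add: Pmult_def)

lemma Pmult_yon:
  assumes X: "qcategory X" and s: "\<sigma> \<in> Car (P X)"
  shows "Pmult X (yon (P X) \<sigma>) = \<sigma>"
  using Pmult_apply[OF X yon_car[OF P_qcat[OF X] s]] yoneda[OF X _ s] s
  by (intro psh_eqI[OF X]) (simp_all add: yon_simps P_simps(2))

text \<open>
  Restriction along \<open>y\<close> computes suprema in \<open>P X\<close>: the unit \<open>\<Sigma> \<le> y (s \<Sigma>)\<close> is the action of \<open>P X\<close> on \<open>\<Sigma>\<close> at
  representables.
\<close>

lemma Pmult_ladj:
  assumes X: "qcategory X" shows "ladj (P (P X)) (P X) (Pmult X) (yon (P X))"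
proof (rule ladjI_unit_counit)
  note PX = P_qcat[OF X] and PPX = P_qcat[OF P_qcat[OF X]]
  show "qcategory (P X)" "qcategory (P (P X))" using PX PPX .
  show "qfunctor (P X) (P (P X)) (yon (P X))" using yon_functor[OF PX] .
  show "qfunctor (P (P X)) (P X) (Pmult X)"
    using Pinv_functor[OF X PX yon_functor[OF X]] by (simp add: Pmult_def)
  show "ord_le (P X) (Pmult X (yon (P X) \<sigma>)) \<sigma>" if "\<sigma> \<in> Car (P X)" for \<sigma>
    using Pmult_yon[OF X that] ord_le_refl[OF PX that] by simp
  fix S assume S: "S \<in> Car (P (P X))"
  note m = Pmult_apply[OF X S]
  have "ev S \<sigma> \<preceq> Hm (P X) \<sigma> (Pmult X S)" if s: "\<sigma> \<in> Car (P X)" for \<sigma>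
  proof -
    have h: "ev S \<sigma> \<in> Hom Q (fst \<sigma>) (fst (Pmult X S))"
      using psh_hom[OF PX S s] s m(1) by (simp add: P_simps(2))
    show ?thesis
      using le_P_Hm_iff[OF X s m(3) h] m(2) psh_act[OF PX S yon_car[OF X] s] yoneda[OF X _ s] by simp
  qed
  then show "ord_le (P (P X)) S (yon (P X) (Pmult X S))"
    using P_ord_le_iff[OF PX S yon_car[OF PX m(3)]] m by (simp add: yon_simps P_simps(2))
qed

lemma Pmult_functor: "qcategory X \<Longrightarrow> qfunctor (P (P X)) (P X) (Pmult X)"
  using Pmult_ladj ladjD(1) by blast

lemma Pmult_Pdir_yon:
  assumes X: "qcategory X" and s: "\<sigma> \<in> Car (P X)"
  shows "Pmult X (Pdir X (P X) (yon X) \<sigma>) = \<sigma>"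
proof -
  note PX = P_qcat[OF X] and PPX = P_qcat[OF P_qcat[OF X]]
  note l = ladj_comp[OF PX PPX PX Pdir_ladj[OF X PX yon_functor[OF X]] Pmult_ladj[OF X]]
  from left_adjoint_unique[OF l ladj_id[OF PX] P_separated[OF X] PX s]
  show ?thesis using Pmult_yon[OF X] s by (simp add: Pmult_def compose_def)
qed

text \<open>
  Both sides are left adjoint to \<open>y \<cdot> f\<^sup>!\<close>.
\<close>

lemma Pmult_natural:
  assumes X: "qcategory X" and Y: "qcategory Y" and f: "qfunctor X Y f" and s: "\<Sigma> \<in> Car (P (P X))"
  shows "Pmult Y (Pdir (P X) (P Y) (Pdir X Y f) \<Sigma>) = Pdir X Y f (Pmult X \<Sigma>)"
proof -
  note PX = P_qcat[OF X] and PY = P_qcat[OF Y]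
  note PPX = P_qcat[OF PX] and PPY = P_qcat[OF PY]
  note f1 = Pdir_ladj[OF X Y f]
  note l1 = ladj_comp[OF PPX PPY PY Pdir_ladj[OF PX PY ladjD(1)[OF f1]] Pmult_ladj[OF Y]]
  note l2 = ladj_comp[OF PPX PX PY Pmult_ladj[OF X] f1]
  from left_adjoint_unique[OF l1 l2 P_separated[OF Y] PY s] Pinv_ladj_yon[OF PX PY f1] s
  show ?thesis by (simp add: compose_def)
qed

text \<open>
  Both sides are left adjoint to \<open>y \<cdot> y : P X \<rightarrow> P P P X\<close>.
\<close>

lemma Pmult_assoc:
  assumes X: "qcategory X" and s: "\<Sigma> \<in> Car (P (P (P X)))"
  shows "Pmult X (Pmult (P X) \<Sigma>) = Pmult X (Pdir (P (P X)) (P X) (Pmult X) \<Sigma>)"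
proof -
  note PX = P_qcat[OF X]
  note PPX = P_qcat[OF PX]
  note PPPX = P_qcat[OF PPX]
  note l1 = ladj_comp[OF PPPX PPX PX Pmult_ladj[OF PX] Pmult_ladj[OF X]]
  note l2 = ladj_comp[OF PPPX PPX PX Pdir_ladj[OF PPX PX Pmult_functor[OF X]] Pmult_ladj[OF X]]
  from left_adjoint_unique[OF l1 l2 P_separated[OF X] PX s] Pinv_ladj_yon[OF PPX PX Pmult_ladj[OF X]] s
  show ?thesis by (simp add: compose_def)
qed

text \<open>
  The inequality \<open>y\<^sub>! \<le> y\<close> that makes the presheaf monad lax idempotent: it is the transpose of
  \<open>1 \<le> s \<cdot> y\<close>.
\<close>

lemma Pdir_yon_le:
  assumes X: "qcategory X" and s: "\<sigma> \<in> Car (P X)"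
  shows "ord_le (P (P X)) (Pdir X (P X) (yon X) \<sigma>) (yon (P X) \<sigma>)"
  using ladj_ord_le_iff[OF Pdir_ladj[OF X P_qcat[OF X] yon_functor[OF X]] s yon_car[OF P_qcat[OF X] s]]
    Pmult_yon[OF X s] ord_le_refl[OF P_qcat[OF X] s] by (simp add: Pmult_def)

text \<open>
  The corresponding inequality for copresheaves, the transpose of the co-Yoneda lemma.
\<close>

lemma coyon_le_Cdir_coyon:
  assumes X: "qcategory X" and t: "\<tau> \<in> Car (Pdag X)"
  shows "ord_le (Pdag (Pdag X)) (coyon (Pdag X) \<tau>) (Cdir X (Pdag X) (coyon X) \<tau>)"
proof -
  note CX = Pdag_qcat[OF X] and e = coyon_functor[OF X]
  note c = coyon_car[OF CX t]
  have "Cinv X (Pdag X) (coyon X) (coyon (Pdag X) \<tau>) = \<tau>"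
    using Cinv_apply[OF X CX e c] coyoneda[OF X _ t] t
    by (intro copsh_eqI[OF X]) (simp_all add: coyon_simps Pdag_simps(2))
  then show ?thesis
    using ladj_ord_le_iff[OF Cinv_ladj[OF X CX e] c t] ord_le_refl[OF CX t] by simp
qed

section \<open>The double copresheaf monad and its distributive law\<close>

lemma T_qcat: "qcategory X \<Longrightarrow> qcategory (T X)"
  by (simp add: T_def P_qcat Pdag_qcat)

lemma Tmap_functor:
  "qcategory X \<Longrightarrow> qcategory Y \<Longrightarrow> qfunctor X Y f \<Longrightarrow> qfunctor (T X) (T Y) (Tmap X Y f)"
  by (simp add: T_def Tmap_def P_qcat Pdir_functor Cdir_functor)

lemma Tmap_comp:
  assumes X: "qcategory X" and Y: "qcategory Y" and Z: "qcategory Z"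
    and f: "qfunctor X Y f" and g: "qfunctor Y Z g" and t: "\<tau> \<in> Car (T X)"
  shows "Tmap Y Z g (Tmap X Y f \<tau>) = Tmap X Z (compose (Car X) g f) \<tau>"
proof -
  have "compose (Car (P X)) (Pdir Y Z g) (Pdir X Y f) = Pdir X Z (compose (Car X) g f)"
    using Pdir_comp[OF X Y Z f g] qfun_ext[OF Pdir_functor[OF X Z qfun_comp[OF X Y Z f g]]]
    by (intro extensionalityI[of _ "Car (P X)"]) (simp_all add: compose_eq)
  then show ?thesis
    using Cdir_comp[OF P_qcat[OF X] P_qcat[OF Y] P_qcat[OF Z] Pdir_functor[OF X Y f] Pdir_functor[OF Y Z g]] t
    by (simp add: Tmap_def T_def)
qed

text \<open>
  The functor \<open>(-)\<^sub>c\<close> applied to the supremum map \<open>s\<close>.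
\<close>

definition Tsup :: "('a, 'o, 'q) qcat \<Rightarrow> (('a, 'o, 'q) psh, 'o, 'q) dcopsh \<Rightarrow> ('a, 'o, 'q) dcopsh" where
  "Tsup X = Cdir (P (P X)) (P X) (Pmult X)"

lemma Tmap_yon_ladj:
  assumes X: "qcategory X"
  shows "ladj (T X) (T (P X)) (Tmap X (P X) (yon X)) (Tsup X)"
  using ladj_Cdir[OF P_qcat[OF X] P_qcat[OF P_qcat[OF X]] Pdir_ladj[OF X P_qcat[OF X] yon_functor[OF X]]]
  by (simp add: Tmap_def T_def Tsup_def Pmult_def)

lemma Tsup_functor: "qcategory X \<Longrightarrow> qfunctor (T (P X)) (T X) (Tsup X)"
  using Tmap_yon_ladj ladjD(2) by blast

lemma Lam_unfold:
  "Lam X \<Theta> = (if \<Theta> \<in> Car (T (P X)) then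
     (Ty (T (P X)) \<Theta>, \<lambda>\<tau> _. graph (T X) (T (P X)) (Tmap X (P X) (yon X)) \<tau> \<Theta>) else undefined)"
  by (simp add: Lam_def left_arrow_def)

text \<open>
  The graph of a left adjoint is the cograph of its right adjoint, so its presheaf at \<open>\<Theta>\<close> is represented
  by the image of \<open>\<Theta>\<close> under the right adjoint.
\<close>

lemma Lam_eq:
  assumes X: "qcategory X" and t: "\<Theta> \<in> Car (T (P X))"
  shows "Lam X \<Theta> = yon (T X) (Tsup X \<Theta>)"
proof -
  note l = Tmap_yon_ladj[OF X]
  note s = qfun_car[OF ladjD(2)[OF l] t]
  \<comment> \<open>Off the carrier of \<open>T X\<close> both sides are \<open>undefined\<close>.\<close>
  have "graph (T X) (T (P X)) (Tmap X (P X) (yon X)) \<tau> \<Theta> = Hm (T X) \<tau> (Tsup X \<Theta>)" for \<tau>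
    using t ladjD(3)[OF l _ t] Hm_undef[OF T_qcat[OF X], of \<tau> "Tsup X \<Theta>"] by (simp add: graph_def)
  then show ?thesis
    using t s qfun_ty[OF ladjD(2)[OF l] t] by (simp add: Lam_unfold yon_def)
qed

lemma Lam_compose:
  assumes X: "qcategory X"
  shows "Lam X = compose (Car (T (P X))) (yon (T X)) (Tsup X)"
  using Lam_eq[OF X] by (intro ext) (simp add: compose_def Lam_unfold)

lemma Lam_functor: "qcategory X \<Longrightarrow> qfunctor (T (P X)) (P (T X)) (Lam X)"
  unfolding Lam_compose
  by (intro qfun_comp[of _ "T X"]) (simp_all add: T_qcat P_qcat Tsup_functor yon_functor)

lemma Lam_as_inverse_image:
  assumes X: "qcategory X"
  shows "Lam X = compose (Car (T (P X))) (Pinv (T X) (T (P X)) (Tmap X (P X) (yon X))) (yon (T (P X)))"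
  using Pinv_ladj_yon[OF T_qcat[OF X] T_qcat[OF P_qcat[OF X]] Tmap_yon_ladj[OF X]] Lam_eq[OF X]
  by (intro ext) (simp add: compose_def Lam_unfold)

lemma Tsup_natural:
  assumes X: "qcategory X" and Y: "qcategory Y" and f: "qfunctor X Y f" and t: "\<Theta> \<in> Car (T (P X))"
  shows "Tsup Y (Tmap (P X) (P Y) (Pdir X Y f) \<Theta>) = Tmap X Y f (Tsup X \<Theta>)"
proof -
  note PX = P_qcat[OF X] and PY = P_qcat[OF Y]
  note PPX = P_qcat[OF PX] and PPY = P_qcat[OF PY]
  note f1 = Pdir_functor[OF X Y f]
  have "compose (Car (P (P X))) (Pmult Y) (Pdir (P X) (P Y) (Pdir X Y f))
      = compose (Car (P (P X))) (Pdir X Y f) (Pmult X)"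
    using Pmult_natural[OF X Y f] by (auto simp: compose_def)
  then show ?thesis
    using Cdir_comp[OF PPX PPY PY Pdir_functor[OF PX PY f1] Pmult_functor[OF Y]]
      Cdir_comp[OF PPX PX PY Pmult_functor[OF X] f1] t
    by (simp add: Tsup_def Tmap_def T_def)
qed

text \<open>
  The image under \<open>(-)\<^sub>c\<close> of the unit law \<open>s \<cdot> y\<^sub>! = 1\<close>; this is what makes \<open>\<Lambda>\<close> flat.
\<close>

lemma Tsup_Tmap_yon:
  assumes X: "qcategory X" and t: "\<tau> \<in> Car (T X)"
  shows "Tsup X (Tmap X (P X) (yon X) \<tau>) = \<tau>"
proof -
  note PX = P_qcat[OF X]
  have "compose (Car (P X)) (Pmult X) (Pdir X (P X) (yon X)) = (\<lambda>\<sigma>\<in>Car (P X). \<sigma>)"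
    using Pmult_Pdir_yon[OF X] by (auto simp: compose_def)
  then show ?thesis
    using Cdir_comp[OF PX P_qcat[OF PX] PX Pdir_functor[OF X PX yon_functor[OF X]] Pmult_functor[OF X]]
      Cdir_id[OF PX] t
    by (simp add: Tsup_def Tmap_def T_def)
qed

lemma Tsup_assoc:
  assumes X: "qcategory X" and t: "\<Theta> \<in> Car (T (P (P X)))"
  shows "Tsup X (Tsup (P X) \<Theta>) = Tsup X (Tmap (P (P X)) (P X) (Pmult X) \<Theta>)"
proof -
  note PX = P_qcat[OF X]
  note PPX = P_qcat[OF PX]
  note PPPX = P_qcat[OF PPX]
  have "compose (Car (P (P (P X)))) (Pmult X) (Pmult (P X))
      = compose (Car (P (P (P X)))) (Pmult X) (Pdir (P (P X)) (P X) (Pmult X))"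
    using Pmult_assoc[OF X] by (auto simp: compose_def)
  then show ?thesis
    using Cdir_comp[OF PPPX PPX PX Pmult_functor[OF PX] Pmult_functor[OF X]]
      Cdir_comp[OF PPPX PPX PX Pdir_functor[OF PPX PX Pmult_functor[OF X]] Pmult_functor[OF X]] t
    by (simp add: Tsup_def Tmap_def T_def)
qed

lemma Tsup_coyon:
  assumes X: "qcategory X" and s: "\<Sigma> \<in> Car (P (P X))"
  shows "Tsup X (coyon (P (P X)) \<Sigma>) = coyon (P X) (Pmult X \<Sigma>)"
  using Cdir_coyon[OF P_qcat[OF P_qcat[OF X]] P_qcat[OF X] Pmult_functor[OF X] s] by (simp add: Tsup_def)

text \<open>
  The map \<open>y \<cdot> y\<^sup>\<dagger>\<close> along which the multiplication of \<open>T\<close> is restriction.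
\<close>

definition yon_coyon :: "('a, 'o, 'q) qcat \<Rightarrow> ('a, 'o, 'q) psh \<Rightarrow> (('a, 'o, 'q) dcopsh, 'o, 'q) psh" where
  "yon_coyon X = compose (Car (P X)) (yon (T X)) (coyon (P X))"

lemma yon_coyon_apply: "\<sigma> \<in> Car (P X) \<Longrightarrow> yon_coyon X \<sigma> = yon (T X) (coyon (P X) \<sigma>)"
  by (simp add: yon_coyon_def compose_def)

lemma Pcoyon_functor: "qcategory X \<Longrightarrow> qfunctor (P X) (T X) (coyon (P X))"
  by (simp add: T_def coyon_functor P_qcat)

lemma yon_coyon_functor:
  assumes X: "qcategory X" shows "qfunctor (P X) (P (T X)) (yon_coyon X)"
  unfolding yon_coyon_def
  by (rule qfun_comp[OF P_qcat[OF X] T_qcat[OF X] P_qcat[OF T_qcat[OF X]] Pcoyon_functor[OF X]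
        yon_functor[OF T_qcat[OF X]]])

lemma yon_coyon_full:
  assumes X: "qcategory X" and s: "\<sigma> \<in> Car (P X)" "\<sigma>' \<in> Car (P X)"
  shows "Hm (P (T X)) (yon_coyon X \<sigma>) (yon_coyon X \<sigma>') = Hm (P X) \<sigma> \<sigma>'"
  using yon_full[OF T_qcat[OF X] qfun_car[OF Pcoyon_functor[OF X] s(1)] qfun_car[OF Pcoyon_functor[OF X] s(2)]]
    coyon_full[OF P_qcat[OF X] s] s by (simp add: yon_coyon_apply) (simp add: T_def)

lemma Tmult_eq: "Tmult X = Cinv (P X) (P (T X)) (yon_coyon X)"
  by (simp add: Tmult_def yon_coyon_def)

lemma Tmult_functor: "qcategory X \<Longrightarrow> qfunctor (T (T X)) (T X) (Tmult X)"
  using Cinv_functor[of "P X" "P (T X)" "yon_coyon X"] yon_coyon_functor[of X] T_qcat[of X]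
  by (simp add: Tmult_eq P_qcat) (simp add: T_def)

lemma Tunit_apply: "x \<in> Car X \<Longrightarrow> Tunit X x = coyon (P X) (yon X x)"
  by (simp add: Tunit_def compose_def)

lemma Tunit_functor: "qcategory X \<Longrightarrow> qfunctor X (T X) (Tunit X)"
  unfolding Tunit_def by (intro qfun_comp[of X "P X"]) (simp_all add: T_qcat P_qcat yon_functor Pcoyon_functor)

text \<open>
  Up to the natural map \<open>y\<^sup>\<dagger>\<close>, this is \<open>y\<^sub>! \<le> y\<close>.
\<close>

lemma Pdir_Tunit_le:
  assumes X: "qcategory X" and s: "\<sigma> \<in> Car (P X)"
  shows "ord_le (P (T X)) (Pdir X (T X) (Tunit X) \<sigma>) (yon_coyon X \<sigma>)"
proof -
  note PX = P_qcat[OF X] and TX = T_qcat[OF X]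
  note y = yon_functor[OF X] and cy = Pcoyon_functor[OF X]
  have "ord_le (P (T X)) (Pdir (P X) (T X) (coyon (P X)) (Pdir X (P X) (yon X) \<sigma>))
      (Pdir (P X) (T X) (coyon (P X)) (yon (P X) \<sigma>))"
    by (rule qfun_mono[OF P_qcat[OF PX] P_qcat[OF TX] Pdir_functor[OF PX TX cy] Pdir_yon_le[OF X s]
          Pdir_apply(4)[OF X PX y s] yon_car[OF PX s]])
  then show ?thesis
    using Pdir_comp[OF X PX TX y cy s] Pdir_yon[OF PX TX cy s] s
    by (simp add: Tunit_def yon_coyon_apply)
qed

text \<open>
  Write \<open>d = y \<cdot> y\<^sup>\<dagger>\<close>.  The square \<open>d \<cdot> s = (s\<^sub>c)\<^sub>! \<cdot> d\<close> commutes, since \<open>y\<close> and \<open>y\<^sup>\<dagger>\<close> are natural.  As \<open>m\<close> is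
  restriction along \<open>d\<close> and direct image is right adjoint to restriction, the claim is the mate of this
  square.
\<close>

lemma Tmult_Tmap_Tsup_le:
  assumes X: "qcategory X" and t: "\<Xi> \<in> Car (T (T (P X)))"
  shows "ord_le (T X) (Tmult X (Tmap (T (P X)) (T X) (Tsup X) \<Xi>)) (Tsup X (Tmult (P X) \<Xi>))"
proof -
  note PX = P_qcat[OF X] and TX = T_qcat[OF X]
  note PPX = P_qcat[OF PX] and TPX = T_qcat[OF PX] and PTX = P_qcat[OF TX]
  note PTPX = P_qcat[OF TPX]
  note s = Tsup_functor[OF X] and m = Pmult_functor[OF X]
  note s1 = Pdir_functor[OF TPX TX s]
  let ?f = "Pdir (T (P X)) (T X) (Tsup X)" and ?\<Xi> = "Tmap (T (P X)) (T X) (Tsup X) \<Xi>"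
  have eq: "compose (Car (P (P X))) (yon_coyon X) (Pmult X) = compose (Car (P (P X))) ?f (yon_coyon (P X))"
    using Tsup_coyon[OF X] Pdir_yon[OF TPX TX s qfun_car[OF Pcoyon_functor[OF PX]]] qfun_car[OF m]
    by (auto simp: compose_def yon_coyon_apply)
  have t': "?\<Xi> \<in> Car (Pdag (P (T X)))"
    using qfun_car[OF Tmap_functor[OF TPX TX s] t] by (simp add: T_def)
  have t2: "\<Xi> \<in> Car (Pdag (P (T (P X))))" using t by (simp add: T_def)
  note l = Cinv_ladj[OF PTPX PTX s1]
  have "ord_le (Pdag (P (T (P X)))) (Cinv (P (T (P X))) (P (T X)) ?f ?\<Xi>) \<Xi>"
    using ladj_counit[OF l Pdag_qcat[OF PTX] t2] by (simp add: Tmap_def)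
  from qfun_mono[OF Pdag_qcat[OF PTPX] T_qcat[OF PX] _ this qfun_car[OF ladjD(1)[OF l] t'] t2]
  have "ord_le (T (P X)) (Tmult (P X) (Cinv (P (T (P X))) (P (T X)) ?f ?\<Xi>)) (Tmult (P X) \<Xi>)"
    using Tmult_functor[OF PX] by (simp add: T_def)
  moreover have "Tmult (P X) (Cinv (P (T (P X))) (P (T X)) ?f ?\<Xi>) = Cinv (P (P X)) (P X) (Pmult X) (Tmult X ?\<Xi>)"
    using Cinv_comp[OF PPX PTPX PTX yon_coyon_functor[OF PX] s1 t'] Cinv_comp[OF PPX PX PTX m yon_coyon_functor[OF X] t'] eq
    by (simp add: Tmult_eq)
  ultimately show ?thesis
    using ladj_ord_le_iff[OF Cinv_ladj[OF PPX PX m]] qfun_car[OF Tmult_functor[OF X]]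
      qfun_car[OF Tmult_functor[OF PX] t] t' by (simp add: Tsup_def T_def)
qed

lemma Lam_natural:
  assumes X: "qcategory X" and Y: "qcategory Y" and f: "qfunctor X Y f" and t: "\<Theta> \<in> Car (T (P X))"
  shows "Pdir (T X) (T Y) (Tmap X Y f) (Lam X \<Theta>) = Lam Y (Tmap (P X) (P Y) (Pdir X Y f) \<Theta>)"
  using Lam_eq[OF X t] Pdir_yon[OF T_qcat[OF X] T_qcat[OF Y] Tmap_functor[OF X Y f] qfun_car[OF Tsup_functor[OF X] t]]
    Lam_eq[OF Y qfun_car[OF Tmap_functor[OF P_qcat[OF X] P_qcat[OF Y] Pdir_functor[OF X Y f]] t]]
    Tsup_natural[OF X Y f t] by simp

lemma Lam_Tmap_yon:
  assumes X: "qcategory X" and t: "\<tau> \<in> Car (T X)"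
  shows "Lam X (Tmap X (P X) (yon X) \<tau>) = yon (T X) \<tau>"
  using Lam_eq[OF X qfun_car[OF ladjD(1)[OF Tmap_yon_ladj[OF X]] t]] Tsup_Tmap_yon[OF X t] by simp

text \<open>
  Because \<open>\<Lambda>\<close> takes representable values, taking the supremum along \<open>p\<close> of such a value just evaluates \<open>p\<close>.
\<close>

lemma Pmult_Pdir_Lam:
  assumes X: "qcategory X" and Z: "qcategory Z" and p: "qfunctor (T X) (P Z) p" and t: "\<Theta> \<in> Car (T (P X))"
  shows "Pmult Z (Pdir (T X) (P Z) p (Lam X \<Theta>)) = p (Tsup X \<Theta>)"
  using Lam_eq[OF X t] qfun_car[OF Tsup_functor[OF X] t]
    Pdir_yon[OF T_qcat[OF X] P_qcat[OF Z] p qfun_car[OF Tsup_functor[OF X] t]]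
    Pmult_yon[OF Z qfun_car[OF p]] by simp

lemma Lam_mult:
  assumes X: "qcategory X" and t: "\<Theta> \<in> Car (T (P (P X)))"
  shows "Pmult (T X) (Pdir (T (P X)) (P (T X)) (Lam X) (Lam (P X) \<Theta>))
    = Lam X (Tmap (P (P X)) (P X) (Pmult X) \<Theta>)"
  using Pmult_Pdir_Lam[OF P_qcat[OF X] T_qcat[OF X] Lam_functor[OF X] t] Tsup_assoc[OF X t]
    Lam_eq[OF X qfun_car[OF Tsup_functor[OF P_qcat[OF X]] t]]
    Lam_eq[OF X qfun_car[OF Tmap_functor[OF P_qcat[OF P_qcat[OF X]] P_qcat[OF X] Pmult_functor[OF X]] t]]
  by simp

lemma Lam_unit_le:
  assumes X: "qcategory X" and s: "\<sigma> \<in> Car (P X)"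
  shows "ord_le (P (T X)) (Pdir X (T X) (Tunit X) \<sigma>) (Lam X (Tunit (P X) \<sigma>))"
  using Pdir_Tunit_le[OF X s] Lam_eq[OF X qfun_car[OF Tunit_functor[OF P_qcat[OF X]] s]]
    Tunit_apply[OF s] Tsup_coyon[OF X yon_car[OF P_qcat[OF X] s]] Pmult_yon[OF X s] yon_coyon_apply[OF s]
  by simp

lemma Lam_Tmult_le:
  assumes X: "qcategory X" and t: "\<Xi> \<in> Car (T (T (P X)))"
  shows "ord_le (P (T X))
    (Pdir (T (T X)) (T X) (Tmult X) (Lam (T X) (Tmap (T (P X)) (P (T X)) (Lam X) \<Xi>)))
    (Lam X (Tmult (P X) \<Xi>))"
proof -
  note PX = P_qcat[OF X] and TX = T_qcat[OF X]
  note TPX = T_qcat[OF PX] and PTX = P_qcat[OF TX] and TTX = T_qcat[OF TX]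
  note s = Tsup_functor[OF X]
  let ?\<Xi> = "Tmap (T (P X)) (T X) (Tsup X) \<Xi>"
  note t' = qfun_car[OF Tmap_functor[OF TPX TX s] t]
  have "Tmap (T (P X)) (P (T X)) (Lam X) \<Xi> = Tmap (T X) (P (T X)) (yon (T X)) ?\<Xi>"
    using Tmap_comp[OF TPX TX PTX s yon_functor[OF TX] t] by (simp add: Lam_compose[OF X])
  then have "Pdir (T (T X)) (T X) (Tmult X) (Lam (T X) (Tmap (T (P X)) (P (T X)) (Lam X) \<Xi>))
      = yon (T X) (Tmult X ?\<Xi>)"
    using Lam_Tmap_yon[OF TX t'] Pdir_yon[OF TTX TX Tmult_functor[OF X] t'] by simp
  moreover note Lam_eq[OF X qfun_car[OF Tmult_functor[OF PX] t]]
  ultimately show ?thesis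
    using qfun_mono[OF TX PTX yon_functor[OF TX] Tmult_Tmap_Tsup_le[OF X t] qfun_car[OF Tmult_functor[OF X] t']
      qfun_car[OF s qfun_car[OF Tmult_functor[OF PX] t]]] by simp
qed

lemma Lam_is_distributive_law: "Lam_distributive_law TYPE('a) TYPE('b)"
  unfolding Lam_distributive_law_def fun_le_def o_apply
proof (intro conjI allI impI ballI)
  fix X :: "('a, 'o, 'q) qcat" and Y :: "('b, 'o, 'q) qcat"
  assume X: "qcategory X"
  note PX = P_qcat[OF X] and TX = T_qcat[OF X]
  note TPX = T_qcat[OF PX] and PTX = P_qcat[OF TX]
  note L = Lam_functor[OF X]
  show "qfunctor (T (P X)) (P (T X)) (Lam X)" by (rule L)
  show "ord_le (P (T Y)) (Pdir (T X) (T Y) (Tmap X Y f) (Lam X \<Theta>)) (Lam Y (Tmap (P X) (P Y) (Pdir X Y f) \<Theta>))"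
    if Y: "qcategory Y" and f: "qfunctor X Y f" and t: "\<Theta> \<in> Car (T (P X))" for f \<Theta>
    unfolding Lam_natural[OF X Y f t, symmetric]
    by (rule ord_le_refl[OF P_qcat[OF T_qcat[OF Y]] Pdir_apply(4)[OF TX T_qcat[OF Y] Tmap_functor[OF X Y f]
          qfun_car[OF L t]]])
  show "ord_le (P (T X)) (yon (T X) \<tau>) (Lam X (Tmap X (P X) (yon X) \<tau>))" if t: "\<tau> \<in> Car (T X)" for \<tau>
    unfolding Lam_Tmap_yon[OF X t] by (rule ord_le_refl[OF PTX yon_car[OF TX t]])
  show "ord_le (P (T X)) (Pmult (T X) (Pdir (T (P X)) (P (T X)) (Lam X) (Lam (P X) \<Theta>)))
      (Lam X (Tmap (P (P X)) (P X) (Pmult X) \<Theta>))" if t: "\<Theta> \<in> Car (T (P (P X)))" for \<Theta>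
    unfolding Lam_mult[OF X t]
    by (rule ord_le_refl[OF PTX qfun_car[OF L qfun_car[OF Tmap_functor[OF P_qcat[OF PX] PX Pmult_functor[OF X]] t]]])
  show "ord_le (P (T X)) (Pdir X (T X) (Tunit X) \<sigma>) (Lam X (Tunit (P X) \<sigma>))" if "\<sigma> \<in> Car (P X)" for \<sigma>
    by (rule Lam_unit_le[OF X that])
  show "ord_le (P (T X))
    (Pdir (T (T X)) (T X) (Tmult X) (Lam (T X) (Tmap (T (P X)) (P (T X)) (Lam X) \<Xi>)))
    (Lam X (Tmult (P X) \<Xi>))" if "\<Xi> \<in> Car (T (T (P X)))" for \<Xi>
    by (rule Lam_Tmult_le[OF X that])
qed

lemma Lam_is_flat: "Lam_flat TYPE('a)"
  unfolding Lam_flat_def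
proof (intro allI impI)
  fix X :: "('a, 'o, 'q) qcat" assume X: "qcategory X"
  show "yon (T X) = compose (Car (T X)) (Lam X) (Tmap X (P X) (yon X))"
    using Lam_Tmap_yon[OF X] by (intro ext) (simp add: compose_def yon_def)
qed

section \<open>Lax algebras and closure spaces\<close>

text \<open>
  Infima in \<open>P X\<close>, computed as restriction along the unit of \<open>T\<close> of the representable presheaf on \<open>\<tau>\<close>:
  at \<open>x\<close> the value is the infimum over \<open>\<sigma>\<close> of the residuals \<open>\<tau> \<sigma> \<searrow> \<sigma> x\<close>.
\<close>

definition Tinf :: "('a, 'o, 'q) qcat \<Rightarrow> ('a, 'o, 'q) dcopsh \<Rightarrow> ('a, 'o, 'q) psh" where
  "Tinf X = compose (Car (T X)) (Pinv X (T X) (Tunit X)) (yon (T X))"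

lemma Tinf_apply:
  assumes X: "qcategory X" and t: "\<tau> \<in> Car (T X)"
  shows "fst (Tinf X \<tau>) = fst \<tau>" "x \<in> Car X \<Longrightarrow> ev (Tinf X \<tau>) x = Hm (T X) (Tunit X x) \<tau>"
    "Tinf X \<tau> \<in> Car (P X)"
  using Pinv_apply[OF X T_qcat[OF X] Tunit_functor[OF X] yon_car[OF T_qcat[OF X] t]] t
  by (simp_all add: Tinf_def compose_def yon_simps) (simp add: T_def Pdag_simps(2))

lemma Tinf_functor: "qcategory X \<Longrightarrow> qfunctor (T X) (P X) (Tinf X)"
  unfolding Tinf_def
  by (intro qfun_comp[of _ "P (T X)"]) (simp_all add: T_qcat P_qcat yon_functor Pinv_functor Tunit_functor)

lemma Tinf_coyon:
  assumes X: "qcategory X" and s: "\<sigma> \<in> Car (P X)"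
  shows "Tinf X (coyon (P X) \<sigma>) = \<sigma>"
proof (rule psh_eqI[OF X _ s])
  note cs = qfun_car[OF Pcoyon_functor[OF X] s]
  note i = Tinf_apply[OF X cs]
  show "Tinf X (coyon (P X) \<sigma>) \<in> Car (P X)" by (rule i(3))
  show "fst (Tinf X (coyon (P X) \<sigma>)) = fst \<sigma>" using i(1) s by (simp add: coyon_simps P_simps(2))
  show "ev (Tinf X (coyon (P X) \<sigma>)) x = ev \<sigma> x" if x: "x \<in> Car X" for x
    using i(2)[OF x] coyon_full[OF P_qcat[OF X] yon_car[OF X x] s] yoneda[OF X x s]
    by (simp add: Tunit_apply[OF x]) (simp add: T_def)
qed

text \<open>
  \<open>P X\<close> is complete.  Evaluated at \<open>\<sigma>\<close>, the counit is the universal property of the residuals that make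
  up \<open>Tinf\<close>.
\<close>

lemma Tinf_ladj:
  assumes X: "qcategory X" shows "ladj (P X) (T X) (coyon (P X)) (Tinf X)"
proof (rule ladjI_unit_counit[OF P_qcat[OF X] T_qcat[OF X] Pcoyon_functor[OF X] Tinf_functor[OF X]])
  note PX = P_qcat[OF X]
  show "ord_le (P X) \<sigma> (Tinf X (coyon (P X) \<sigma>))" if "\<sigma> \<in> Car (P X)" for \<sigma>
    using Tinf_coyon[OF X that] ord_le_refl[OF PX that] by simp
  fix \<tau> assume t: "\<tau> \<in> Car (T X)"
  note i = Tinf_apply[OF X t]
  have t': "\<tau> \<in> Car (Pdag (P X))" using t by (simp add: T_def)
  have "cev \<tau> \<sigma> \<preceq> Hm (P X) (Tinf X \<tau>) \<sigma>" if s: "\<sigma> \<in> Car (P X)" for \<sigma>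
  proof -
    have h: "cev \<tau> \<sigma> \<in> Hom Q (fst (Tinf X \<tau>)) (fst \<sigma>)"
      using copsh_hom[OF PX t' s] i(1) s by (simp add: P_simps(2))
    have "cev \<tau> \<sigma> \<cdot> ev (Tinf X \<tau>) x \<preceq> ev \<sigma> x" if x: "x \<in> Car X" for x
      using Pdag_Hm_cmp_le[OF PX coyon_car[OF PX yon_car[OF X x]] t' s] i(2)[OF x] yoneda[OF X x s]
      by (simp add: Tunit_apply[OF x] coyon_simps(2)[OF yon_car[OF X x]]) (simp add: T_def)
    then show ?thesis using le_P_Hm_iff[OF X i(3) s h] by blast
  qed
  then show "ord_le (T X) (coyon (P X) (Tinf X \<tau>)) \<tau>"
    using Pdag_ord_le_iff[OF PX coyon_car[OF PX i(3)] t'] i by (simp add: T_def coyon_simps P_simps(2))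
qed

text \<open>
  The extension of \<open>p : T X \<rightarrow> P X\<close> along \<open>y\<close> to a supremum-preserving map \<open>P (T X) \<rightarrow> P X\<close>.
\<close>

definition alg_sup :: "('a, 'o, 'q) qcat \<Rightarrow> (('a, 'o, 'q) dcopsh \<Rightarrow> ('a, 'o, 'q) psh) \<Rightarrow>
    (('a, 'o, 'q) dcopsh, 'o, 'q) psh \<Rightarrow> ('a, 'o, 'q) psh" where
  "alg_sup X p = compose (Car (P (T X))) (Pmult X) (Pdir (T X) (P X) p)"

lemma alg_sup_functor:
  "qcategory X \<Longrightarrow> qfunctor (T X) (P X) p \<Longrightarrow> qfunctor (P (T X)) (P X) (alg_sup X p)"
  unfolding alg_sup_def
  by (intro qfun_comp[of _ "P (P X)"]) (simp_all add: T_qcat P_qcat Pdir_functor Pmult_functor)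

lemma alg_sup_yon_coyon:
  assumes X: "qcategory X" and p: "qfunctor (T X) (P X) p" and s: "\<sigma> \<in> Car (P X)"
  shows "alg_sup X p (yon_coyon X \<sigma>) = p (coyon (P X) \<sigma>)"
proof -
  note cs = qfun_car[OF Pcoyon_functor[OF X] s]
  show ?thesis
    using Pdir_yon[OF T_qcat[OF X] P_qcat[OF X] p cs] Pmult_yon[OF X qfun_car[OF p cs]]
      yon_car[OF T_qcat[OF X] cs] s by (simp add: alg_sup_def compose_def yon_coyon_apply)
qed

text \<open>
  With \<open>\<Lambda> = y \<cdot> s\<^sub>c\<close>, the left-hand side \<open>s \<cdot> p\<^sub>! \<cdot> \<Lambda> \<cdot> T p\<close> of the multiplication axiom collapses to
  \<open>p \<cdot> s\<^sub>c \<cdot> (p\<^sub>!)\<^sub>c = p \<cdot> (s \<cdot> p\<^sub>!)\<^sub>c\<close>.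
\<close>

lemma lax_algebra_iff:
  "lax_algebra (X, p) \<longleftrightarrow> qcategory X \<and> qfunctor (T X) (P X) p \<and>
    (\<forall>x\<in>Car X. ord_le (P X) (yon X x) (p (Tunit X x))) \<and>
    (\<forall>\<Xi>\<in>Car (T (T X)). ord_le (P X) (p (Cdir (P (T X)) (P X) (alg_sup X p) \<Xi>)) (p (Tmult X \<Xi>)))"
proof -
  have "(Pmult X \<circ> Pdir (T X) (P X) p \<circ> Lam X \<circ> Tmap (T X) (P X) p) \<Xi> =
      p (Cdir (P (T X)) (P X) (alg_sup X p) \<Xi>)"
    if X: "qcategory X" and p: "qfunctor (T X) (P X) p" and t: "\<Xi> \<in> Car (T (T X))" for \<Xi>
  proof -
    note PX = P_qcat[OF X] and TX = T_qcat[OF X]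
    have t': "\<Xi> \<in> Car (Pdag (P (T X)))" using t by (simp add: T_def)
    show ?thesis
      using Pmult_Pdir_Lam[OF X X p qfun_car[OF Tmap_functor[OF TX PX p] t]]
        Cdir_comp[OF P_qcat[OF TX] P_qcat[OF PX] PX Pdir_functor[OF TX PX p] Pmult_functor[OF X] t']
      by (simp add: Tsup_def Tmap_def alg_sup_def)
  qed
  then show ?thesis unfolding lax_algebra_def fun_le_def by auto
qed

definition alg_closure :: "('a, 'o, 'q) qcat \<Rightarrow> (('a, 'o, 'q) dcopsh \<Rightarrow> ('a, 'o, 'q) psh) \<Rightarrow>
    ('a, 'o, 'q) psh \<Rightarrow> ('a, 'o, 'q) psh" where
  "alg_closure X p = compose (Car (P X)) p (coyon (P X))"

definition closure_alg :: "('a, 'o, 'q) qcat \<Rightarrow> (('a, 'o, 'q) psh \<Rightarrow> ('a, 'o, 'q) psh) \<Rightarrow>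
    ('a, 'o, 'q) dcopsh \<Rightarrow> ('a, 'o, 'q) psh" where
  "closure_alg X c = compose (Car (T X)) (Tinf X) (Cdir (P X) (P X) c)"

lemma alg_closure_apply: "\<sigma> \<in> Car (P X) \<Longrightarrow> alg_closure X p \<sigma> = p (coyon (P X) \<sigma>)"
  by (simp add: alg_closure_def compose_def)

lemma closure_alg_apply: "\<tau> \<in> Car (T X) \<Longrightarrow> closure_alg X c \<tau> = Tinf X (Cdir (P X) (P X) c \<tau>)"
  by (simp add: closure_alg_def compose_def)

lemma alg_closure_functor:
  "qcategory X \<Longrightarrow> qfunctor (T X) (P X) p \<Longrightarrow> qfunctor (P X) (P X) (alg_closure X p)"
  unfolding alg_closure_def by (intro qfun_comp[of _ "T X"]) (simp_all add: T_qcat P_qcat Pcoyon_functor)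

lemma closure_alg_functor:
  "qcategory X \<Longrightarrow> qfunctor (P X) (P X) c \<Longrightarrow> qfunctor (T X) (P X) (closure_alg X c)"
  unfolding closure_alg_def
  by (intro qfun_comp[of _ "T X"]) (simp_all add: T_qcat P_qcat Tinf_functor, simp add: T_def P_qcat Cdir_functor)

lemma closure_alg_coyon:
  assumes X: "qcategory X" and c: "qfunctor (P X) (P X) c" and s: "\<sigma> \<in> Car (P X)"
  shows "closure_alg X c (coyon (P X) \<sigma>) = c \<sigma>"
  using Cdir_coyon[OF P_qcat[OF X] P_qcat[OF X] c s] Tinf_coyon[OF X qfun_car[OF c s]]
    qfun_car[OF Pcoyon_functor[OF X] s] by (simp add: closure_alg_apply)

lemma alg_closure_closure_alg:
  assumes X: "qcategory X" and c: "qfunctor (P X) (P X) c"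
  shows "alg_closure X (closure_alg X c) = c"
  using closure_alg_coyon[OF X c] qfun_ext[OF alg_closure_functor[OF X closure_alg_functor[OF X c]]]
    qfun_ext[OF c] by (intro extensionalityI[of _ "Car (P X)"]) (simp_all add: alg_closure_apply)

text \<open>
  The multiplication axiom at \<open>\<Xi> = d\<^sub>c \<tau>\<close>, where \<open>d = y \<cdot> y\<^sup>\<dagger>\<close>.  As \<open>d\<close> is fully faithful, \<open>m\<close> undoes \<open>d\<^sub>c\<close>; and
  \<open>s \<cdot> p\<^sub>! \<cdot> d\<close> is the closure operator of \<open>p\<close>.
\<close>

lemma lax_algebra_alg_closure_le:
  assumes A: "lax_algebra (X, p)" and t: "\<tau> \<in> Car (T X)"
  shows "ord_le (P X) (p (Cdir (P X) (P X) (alg_closure X p) \<tau>)) (p \<tau>)"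
proof -
  have X: "qcategory X" and p: "qfunctor (T X) (P X) p"
    and mult: "\<And>\<Xi>. \<Xi> \<in> Car (T (T X)) \<Longrightarrow>
      ord_le (P X) (p (Cdir (P (T X)) (P X) (alg_sup X p) \<Xi>)) (p (Tmult X \<Xi>))"
    using A by (auto simp: lax_algebra_iff)
  note PX = P_qcat[OF X] and TX = T_qcat[OF X]
  note PTX = P_qcat[OF TX]
  have t': "\<tau> \<in> Car (Pdag (P X))" using t by (simp add: T_def)
  let ?\<Xi> = "Cdir (P X) (P (T X)) (yon_coyon X) \<tau>"
  have x: "?\<Xi> \<in> Car (T (T X))" using Cdir_apply(4)[OF PX PTX yon_coyon_functor[OF X] t'] by (simp add: T_def)
  have "compose (Car (P X)) (alg_sup X p) (yon_coyon X) = alg_closure X p"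
    using alg_sup_yon_coyon[OF X p] by (auto simp: compose_def alg_closure_def)
  then have "Cdir (P (T X)) (P X) (alg_sup X p) ?\<Xi> = Cdir (P X) (P X) (alg_closure X p) \<tau>"
    using Cdir_comp[OF PX PTX PX yon_coyon_functor[OF X] alg_sup_functor[OF X p] t'] by simp
  moreover have "Tmult X ?\<Xi> = \<tau>"
    unfolding Tmult_eq by (rule Cinv_Cdir_full[OF PX PTX yon_coyon_functor[OF X] yon_coyon_full[OF X] t'])
  ultimately show ?thesis using mult[OF x] by simp
qed

text \<open>
  A presheaf is the supremum of representables, on which \<open>p \<cdot> e\<close> is inflationary by the unit axiom:
  \<open>\<sigma> = s (y\<^sub>! \<sigma>) \<le> s (p\<^sub>! (e\<^sub>! \<sigma>)) \<le> s (p\<^sub>! (y (y\<^sup>\<dagger> \<sigma>))) = p (y\<^sup>\<dagger> \<sigma>)\<close>.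
\<close>

lemma lax_algebra_alg_closure_ge:
  assumes A: "lax_algebra (X, p)" and s: "\<sigma> \<in> Car (P X)"
  shows "ord_le (P X) \<sigma> (alg_closure X p \<sigma>)"
proof -
  have X: "qcategory X" and p: "qfunctor (T X) (P X) p"
    and unit: "\<And>x. x \<in> Car X \<Longrightarrow> ord_le (P X) (yon X x) (p (Tunit X x))"
    using A by (auto simp: lax_algebra_iff)
  note PX = P_qcat[OF X] and TX = T_qcat[OF X]
  note PPX = P_qcat[OF PX] and PTX = P_qcat[OF TX]
  note y = yon_functor[OF X] and e = Tunit_functor[OF X] and m = Pmult_functor[OF X]
  note pe = qfun_comp[OF X TX PX e p]
  have "fun_le X (P X) (yon X) (compose (Car X) p (Tunit X))"
    using unit by (simp add: fun_le_def compose_def)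
  from qfun_mono[OF PPX PX m Pdir_mono[OF X PX y pe this s] Pdir_apply(4)[OF X PX y s] Pdir_apply(4)[OF X PX pe s]]
  have "ord_le (P X) \<sigma> (alg_sup X p (Pdir X (T X) (Tunit X) \<sigma>))"
    using Pmult_Pdir_yon[OF X s] Pdir_comp[OF X TX PX e p s] Pdir_apply(4)[OF X TX e s]
    by (simp add: alg_sup_def compose_def)
  moreover have "ord_le (P X) (alg_sup X p (Pdir X (T X) (Tunit X) \<sigma>)) (alg_sup X p (yon_coyon X \<sigma>))"
    by (rule qfun_mono[OF PTX PX alg_sup_functor[OF X p] Pdir_Tunit_le[OF X s] Pdir_apply(4)[OF X TX e s]
          qfun_car[OF yon_coyon_functor[OF X] s]])
  ultimately show ?thesis
    using ord_le_trans[OF PX _ _ s] qfun_car[OF alg_sup_functor[OF X p]] Pdir_apply(4)[OF X TX e s]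
      qfun_car[OF yon_coyon_functor[OF X] s] alg_sup_yon_coyon[OF X p s] by (metis alg_closure_apply[OF s])
qed

lemma closure_space_iff:
  "closure_space (X, c) \<longleftrightarrow> qcategory X \<and> qfunctor (P X) (P X) c \<and>
    (\<forall>\<sigma>\<in>Car (P X). ord_le (P X) \<sigma> (c \<sigma>)) \<and> (\<forall>\<sigma>\<in>Car (P X). c (c \<sigma>) = c \<sigma>)"
proof -
  have "compose (Car (P X)) c c = c \<longleftrightarrow> (\<forall>\<sigma>\<in>Car (P X). c (c \<sigma>) = c \<sigma>)" if c: "qfunctor (P X) (P X) c"
  proof
    show "\<forall>\<sigma>\<in>Car (P X). c (c \<sigma>) = c \<sigma>" if "compose (Car (P X)) c c = c"
      using that by (metis compose_eq)
    show "compose (Car (P X)) c c = c" if "\<forall>\<sigma>\<in>Car (P X). c (c \<sigma>) = c \<sigma>"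
      using that qfun_ext[OF c] by (intro extensionalityI[of _ "Car (P X)"]) (simp_all add: compose_eq)
  qed
  then show ?thesis unfolding closure_space_def fun_le_def by auto
qed

lemma closure_space_alg_closure:
  assumes A: "lax_algebra (X, p)" shows "closure_space (X, alg_closure X p)"
  unfolding closure_space_iff
proof (intro conjI ballI)
  show X: "qcategory X" using A by (simp add: lax_algebra_iff)
  have p: "qfunctor (T X) (P X) p" using A by (simp add: lax_algebra_iff)
  show c: "qfunctor (P X) (P X) (alg_closure X p)" by (rule alg_closure_functor[OF X p])
  show "ord_le (P X) \<sigma> (alg_closure X p \<sigma>)" if "\<sigma> \<in> Car (P X)" for \<sigma>
    by (rule lax_algebra_alg_closure_ge[OF A that])
  fix \<sigma> assume s: "\<sigma> \<in> Car (P X)"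
  note cs = qfun_car[OF c s]
  note ccs = qfun_car[OF c cs]
  have "ord_le (P X) (alg_closure X p (alg_closure X p \<sigma>)) (alg_closure X p \<sigma>)"
    using lax_algebra_alg_closure_le[OF A qfun_car[OF Pcoyon_functor[OF X] s]]
      Cdir_coyon[OF P_qcat[OF X] P_qcat[OF X] c s] alg_closure_apply[OF cs] alg_closure_apply[OF s] by metis
  from separatedD[OF P_separated[OF X] this lax_algebra_alg_closure_ge[OF A cs] ccs cs]
  show "alg_closure X p (alg_closure X p \<sigma>) = alg_closure X p \<sigma>" .
qed

text \<open>
  The inequality \<open>p \<le> inf \<cdot> c\<^sub>c\<close> holds for every Q-functor \<open>p\<close>, as \<open>p \<tau>\<close> lies below the
  infimum, weighted by \<open>\<tau>\<close>, of the values of \<open>p\<close> on representables.  Conversely \<open>1 \<le> c\<close> gives \<open>inf \<le> p \<cdot> y\<^sup>\<dagger> \<cdot> inf \<le> p\<close>, and hence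
  \<open>inf \<cdot> c\<^sub>c \<le> p \<cdot> c\<^sub>c \<le> p\<close>.
\<close>

lemma closure_alg_alg_closure:
  assumes A: "lax_algebra (X, p)" shows "closure_alg X (alg_closure X p) = p"
proof -
  have X: "qcategory X" and p: "qfunctor (T X) (P X) p" using A by (auto simp: lax_algebra_iff)
  note PX = P_qcat[OF X] and TX = T_qcat[OF X]
  note c = alg_closure_functor[OF X p] and i = Tinf_functor[OF X] and y = Pcoyon_functor[OF X]
  note l = Tinf_ladj[OF X]
  let ?C = "Cdir (P X) (P X) (alg_closure X p)"
  have "closure_alg X (alg_closure X p) \<tau> = p \<tau>" if t: "\<tau> \<in> Car (T X)" for \<tau>
  proof -
    note pt = qfun_car[OF p t]
    have t': "\<tau> \<in> Car (Pdag (P X))" using t by (simp add: T_def)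
    have ct: "?C \<tau> \<in> Car (T X)" using Cdir_apply(4)[OF PX PX c t'] by (simp add: T_def)
    note ict = qfun_car[OF i ct]
    have "ord_le (Pdag (P X)) (Cdir (T X) (P X) p (coyon (T X) \<tau>))
        (Cdir (T X) (P X) p (Cdir (P X) (T X) (coyon (P X)) \<tau>))"
      using qfun_mono[OF Pdag_qcat[OF TX] Pdag_qcat[OF PX] Cdir_functor[OF TX PX p]]
        coyon_le_Cdir_coyon[OF PX t'] coyon_car[OF TX t] Cdir_apply(4)[OF PX TX y t'] by (simp add: T_def)
    then have "ord_le (T X) (coyon (P X) (p \<tau>)) (?C \<tau>)"
      using Cdir_coyon[OF TX PX p t] Cdir_comp[OF PX TX PX y p t'] by (simp add: T_def alg_closure_def)
    then have ge: "ord_le (P X) (p \<tau>) (Tinf X (?C \<tau>))"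
      using ladj_ord_le_iff[OF l pt ct] by simp
    have inf_le: "ord_le (P X) (Tinf X \<tau>') (p \<tau>')" if t2: "\<tau>' \<in> Car (T X)" for \<tau>'
    proof -
      note it = qfun_car[OF i t2]
      have "ord_le (P X) (p (coyon (P X) (Tinf X \<tau>'))) (p \<tau>')"
        by (rule qfun_mono[OF TX PX p ladj_counit[OF l PX t2] qfun_car[OF y it] t2])
      with lax_algebra_alg_closure_ge[OF A it] show ?thesis
        using ord_le_trans[OF PX _ _ it qfun_car[OF p qfun_car[OF y it]] qfun_car[OF p t2]]
        by (simp add: alg_closure_apply[OF it])
    qed
    have le: "ord_le (P X) (Tinf X (?C \<tau>)) (p \<tau>)"
      by (rule ord_le_trans[OF PX inf_le[OF ct] lax_algebra_alg_closure_le[OF A t] ict qfun_car[OF p ct] pt])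
    from separatedD[OF P_separated[OF X] le ge ict pt] show ?thesis
      by (simp add: closure_alg_apply[OF t])
  qed
  then show ?thesis
    using qfun_ext[OF closure_alg_functor[OF X c]] qfun_ext[OF p]
    by (intro extensionalityI[of _ "Car (T X)"]) simp_all
qed

text \<open>
  Let \<open>p = inf \<cdot> c\<^sub>c\<close>, \<open>d = y \<cdot> y\<^sup>\<dagger>\<close> and \<open>g = c \<cdot> s \<cdot> p\<^sub>!\<close>.  Idempotence gives \<open>g \<cdot> d = c \<cdot> c = c\<close>, so
  \<open>g\<^sub>c \<le> g\<^sub>c \<cdot> d\<^sub>c \<cdot> m = c\<^sub>c \<cdot> m\<close> by the unit of the adjunction between restriction and direct image along \<open>d\<close>.
  Applying \<open>inf\<close> yields the multiplication axiom.
\<close>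

lemma lax_algebra_closure_alg:
  assumes C: "closure_space (X, c)" shows "lax_algebra (X, closure_alg X c)"
  unfolding lax_algebra_iff
proof (intro conjI ballI)
  show X: "qcategory X" using C by (simp add: closure_space_iff)
  have c: "qfunctor (P X) (P X) c" and le: "\<And>\<sigma>. \<sigma> \<in> Car (P X) \<Longrightarrow> ord_le (P X) \<sigma> (c \<sigma>)"
    and idem: "\<And>\<sigma>. \<sigma> \<in> Car (P X) \<Longrightarrow> c (c \<sigma>) = c \<sigma>" using C by (auto simp: closure_space_iff)
  let ?p = "closure_alg X c"
  show p: "qfunctor (T X) (P X) ?p" by (rule closure_alg_functor[OF X c])
  show "ord_le (P X) (yon X x) (?p (Tunit X x))" if x: "x \<in> Car X" for x
    using le[OF yon_car[OF X x]] closure_alg_coyon[OF X c yon_car[OF X x]] by (simp add: Tunit_apply[OF x])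
  fix \<Xi> assume t: "\<Xi> \<in> Car (T (T X))"
  note PX = P_qcat[OF X] and TX = T_qcat[OF X]
  note PTX = P_qcat[OF TX]
  have t': "\<Xi> \<in> Car (Pdag (P (T X)))" using t by (simp add: T_def)
  note f = yon_coyon_functor[OF X] and s = alg_sup_functor[OF X p]
  note g = qfun_comp[OF PTX PX PX s c]
  let ?g = "compose (Car (P (T X))) c (alg_sup X ?p)"
  note l = Cinv_ladj[OF PX PTX f]
  note m = qfun_car[OF ladjD(1)[OF l] t']
  have gf: "compose (Car (P X)) ?g (yon_coyon X) = c"
    using qfun_car[OF f] alg_sup_yon_coyon[OF X p] closure_alg_coyon[OF X c] idem qfun_ext[OF c]
    by (intro extensionalityI[of _ "Car (P X)"]) (simp_all add: compose_eq)
  have 1: "ord_le (Pdag (P X)) (Cdir (P (T X)) (P X) ?g \<Xi>)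
      (Cdir (P (T X)) (P X) ?g (Cdir (P X) (P (T X)) (yon_coyon X) (Tmult X \<Xi>)))"
    using qfun_mono[OF Pdag_qcat[OF PTX] Pdag_qcat[OF PX] Cdir_functor[OF PTX PX g]
        ladj_unit[OF l Pdag_qcat[OF PX] t'] t' qfun_car[OF ladjD(2)[OF l] m]] by (simp add: Tmult_eq)
  then have le: "ord_le (T X) (Cdir (P X) (P X) c (Cdir (P (T X)) (P X) (alg_sup X ?p) \<Xi>))
      (Cdir (P X) (P X) c (Tmult X \<Xi>))"
    using Cdir_comp[OF PTX PX PX s c t'] Cdir_comp[OF PX PTX PX f g m] gf by (simp add: T_def Tmult_eq)
  have a: "Cdir (P (T X)) (P X) (alg_sup X ?p) \<Xi> \<in> Car (T X)" "Tmult X \<Xi> \<in> Car (T X)"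
    using Cdir_apply(4)[OF PTX PX s t'] m by (simp_all add: T_def Tmult_eq)
  have b: "Cdir (P X) (P X) c \<tau> \<in> Car (T X)" if "\<tau> \<in> Car (T X)" for \<tau>
    using Cdir_apply(4)[OF PX PX c] that by (simp add: T_def)
  show "ord_le (P X) (?p (Cdir (P (T X)) (P X) (alg_sup X ?p) \<Xi>)) (?p (Tmult X \<Xi>))"
    using qfun_mono[OF TX PX Tinf_functor[OF X] le b[OF a(1)] b[OF a(2)]]
    by (simp add: closure_alg_apply[OF a(1)] closure_alg_apply[OF a(2)])
qed

text \<open>
  Any monotone map is lax for infima; formally, this is the transpose of \<open>T f\<close> applied to the counit
  \<open>y\<^sup>\<dagger> (inf \<tau>) \<le> \<tau>\<close>.
\<close>

lemma Pdir_Tinf_le: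
  assumes X: "qcategory X" and Y: "qcategory Y" and f: "qfunctor X Y f" and t: "\<tau> \<in> Car (T X)"
  shows "ord_le (P Y) (Pdir X Y f (Tinf X \<tau>)) (Tinf Y (Tmap X Y f \<tau>))"
proof -
  note PX = P_qcat[OF X] and PY = P_qcat[OF Y] and TX = T_qcat[OF X] and TY = T_qcat[OF Y]
  note f1 = Pdir_functor[OF X Y f] and l = Tinf_ladj[OF X] and f2 = Tmap_functor[OF X Y f]
  note it = qfun_car[OF ladjD(2)[OF l] t]
  have "ord_le (T Y) (Tmap X Y f (coyon (P X) (Tinf X \<tau>))) (Tmap X Y f \<tau>)"
    by (rule qfun_mono[OF TX TY f2 ladj_counit[OF l PX t] qfun_car[OF ladjD(1)[OF l] it] t])
  then have "ord_le (T Y) (coyon (P Y) (Pdir X Y f (Tinf X \<tau>))) (Tmap X Y f \<tau>)"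
    using Cdir_coyon[OF PX PY f1 it] by (simp add: Tmap_def)
  then show ?thesis
    using ladj_ord_le_iff[OF Tinf_ladj[OF Y] qfun_car[OF f1 it] qfun_car[OF f2 t]] by simp
qed

text \<open>
  From left to right, restrict to representables \<open>y\<^sup>\<dagger> \<sigma>\<close>.  From right to left,
  \<open>f\<^sub>! \<cdot> inf \<cdot> c\<^sub>c \<le> inf \<cdot> (f\<^sub>! \<cdot> c)\<^sub>c \<le> inf \<cdot> (d \<cdot> f\<^sub>!)\<^sub>c\<close>.
\<close>

lemma lax_hom_iff_continuous:
  assumes C: "closure_space (X, c)" and D: "closure_space (Y, d)"
  shows "lax_hom (X, closure_alg X c) (Y, closure_alg Y d) f \<longleftrightarrow> continuous_qfunctor (X, c) (Y, d) f"
proof (cases "qfunctor X Y f")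
  case f: True
  have X: "qcategory X" and c: "qfunctor (P X) (P X) c" and Y: "qcategory Y" and d: "qfunctor (P Y) (P Y) d"
    using C D by (auto simp: closure_space_iff)
  note PX = P_qcat[OF X] and PY = P_qcat[OF Y] and TX = T_qcat[OF X] and TY = T_qcat[OF Y]
  note f1 = Pdir_functor[OF X Y f] and f2 = Tmap_functor[OF X Y f]
  let ?p = "closure_alg X c" and ?q = "closure_alg Y d"
  have "(\<forall>\<tau>\<in>Car (T X). ord_le (P Y) (Pdir X Y f (?p \<tau>)) (?q (Tmap X Y f \<tau>))) \<longleftrightarrow>
    (\<forall>\<sigma>\<in>Car (P X). ord_le (P Y) (Pdir X Y f (c \<sigma>)) (d (Pdir X Y f \<sigma>)))" (is "?L \<longleftrightarrow> ?R")
  proof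
    assume ?L
    show ?R
    proof
      fix \<sigma> assume s: "\<sigma> \<in> Car (P X)"
      have "Tmap X Y f (coyon (P X) \<sigma>) = coyon (P Y) (Pdir X Y f \<sigma>)"
        using Cdir_coyon[OF PX PY f1 s] by (simp add: Tmap_def)
      then show "ord_le (P Y) (Pdir X Y f (c \<sigma>)) (d (Pdir X Y f \<sigma>))"
        using \<open>?L\<close> qfun_car[OF Pcoyon_functor[OF X] s] closure_alg_coyon[OF X c s]
          closure_alg_coyon[OF Y d qfun_car[OF f1 s]] by metis
    qed
  next
    assume ?R
    then have le: "fun_le (P X) (P Y) (compose (Car (P X)) (Pdir X Y f) c) (compose (Car (P X)) d (Pdir X Y f))"
      by (simp add: fun_le_def compose_def)
    show ?L
    proof
      fix \<tau> assume t: "\<tau> \<in> Car (T X)"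
      then have t': "\<tau> \<in> Car (Pdag (P X))" by (simp add: T_def)
      note fc = qfun_comp[OF PX PX PY c f1] and df = qfun_comp[OF PX PY PY f1 d]
      have ct: "Cdir (P X) (P X) c \<tau> \<in> Car (T X)" using Cdir_apply(4)[OF PX PX c t'] by (simp add: T_def)
      have dt: "Cdir (P Y) (P Y) d (Tmap X Y f \<tau>) \<in> Car (T Y)"
        using Cdir_apply(4)[OF PY PY d] qfun_car[OF f2 t] by (simp add: T_def)
      note fct = qfun_car[OF f2 ct]
      have "ord_le (T Y) (Tmap X Y f (Cdir (P X) (P X) c \<tau>)) (Cdir (P Y) (P Y) d (Tmap X Y f \<tau>))"
        using Cdir_mono[OF PX PY fc df le t'] Cdir_comp[OF PX PX PY c f1 t'] Cdir_comp[OF PX PY PY f1 d t']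
        by (simp add: Tmap_def T_def)
      from qfun_mono[OF TY PY Tinf_functor[OF Y] this fct dt]
      have "ord_le (P Y) (Tinf Y (Tmap X Y f (Cdir (P X) (P X) c \<tau>))) (?q (Tmap X Y f \<tau>))"
        by (simp add: closure_alg_apply[OF qfun_car[OF f2 t]])
      from ord_le_trans[OF PY Pdir_Tinf_le[OF X Y f ct] this]
      show "ord_le (P Y) (Pdir X Y f (?p \<tau>)) (?q (Tmap X Y f \<tau>))"
        using qfun_car[OF f1 qfun_car[OF Tinf_functor[OF X] ct]] qfun_car[OF Tinf_functor[OF Y] fct]
          qfun_car[OF closure_alg_functor[OF Y d] qfun_car[OF f2 t]]
        by (simp add: closure_alg_apply[OF t])
    qed
  qed
  then show ?thesis using f by (simp add: lax_hom_def continuous_qfunctor_def fun_le_def)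
qed (simp add: lax_hom_def continuous_qfunctor_def)

section \<open>The isomorphism of 2-categories\<close>

text \<open>
  Any class of Q-functors between structured Q-categories that contains identities and is closed under
  composition inherits a 2-category structure from Q-categories.
\<close>

lemma is_two_cat_over_qcategories:
  assumes qcat: "\<And>A. A \<in> Obs \<Longrightarrow> qcategory (fst A)"
    and qfun: "\<And>A B f. A \<in> Obs \<Longrightarrow> B \<in> Obs \<Longrightarrow> f \<in> H A B \<Longrightarrow> qfunctor (fst A) (fst B) f"
    and ident: "\<And>A. A \<in> Obs \<Longrightarrow> (\<lambda>x\<in>Car (fst A). x) \<in> H A A"
    and comp: "\<And>A B C f g. A \<in> Obs \<Longrightarrow> B \<in> Obs \<Longrightarrow> C \<in> Obs \<Longrightarrow> f \<in> H A B \<Longrightarrow> g \<in> H B C \<Longrightarrow>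
      compose (Car (fst A)) g f \<in> H A C"
  shows "is_two_cat \<lparr>ob2 = Obs, hom2 = H, id2 = (\<lambda>A. \<lambda>x\<in>Car (fst A). x),
     cmp2 = (\<lambda>A B D g f. compose (Car (fst A)) g f), le2 = (\<lambda>A B. fun_le (fst A) (fst B))\<rparr>"
  unfolding is_two_cat_def two_cat.simps
proof (intro conjI ballI impI)
  note car = qfun_car[OF qfun] and ext = qfun_ext[OF qfun]
  fix A assume A: "A \<in> Obs"
  show "(\<lambda>x\<in>Car (fst A). x) \<in> H A A" by (rule ident[OF A])
  fix B assume B: "B \<in> Obs"
  {
    fix f assume f: "f \<in> H A B"
    show "compose (Car (fst A)) f (\<lambda>x\<in>Car (fst A). x) = f"
      using ext[OF A B f] by (intro extensionalityI[of _ "Car (fst A)"]) (simp_all add: compose_eq)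
    show "compose (Car (fst A)) (\<lambda>x\<in>Car (fst B). x) f = f"
      using ext[OF A B f] car[OF A B f]
      by (intro extensionalityI[of _ "Car (fst A)"]) (simp_all add: compose_eq)
    show "fun_le (fst A) (fst B) f f" using ord_le_refl[OF qcat[OF B] car[OF A B f]] by (simp add: fun_le_def)
    fix g h assume g: "g \<in> H A B" and h: "h \<in> H A B"
      and le: "fun_le (fst A) (fst B) f g" "fun_le (fst A) (fst B) g h"
    show "fun_le (fst A) (fst B) f h"
      using ord_le_trans[OF qcat[OF B] _ _ car[OF A B f] car[OF A B g] car[OF A B h]] le
      unfolding fun_le_def by blast
  }
  fix C assume C: "C \<in> Obs"
  show "compose (Car (fst A)) g f \<in> H A C" if "f \<in> H A B" "g \<in> H B C" for f g
    by (rule comp[OF A B C that])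
  show "fun_le (fst A) (fst C) (compose (Car (fst A)) g f) (compose (Car (fst A)) g' f')"
    if f: "f \<in> H A B" and f': "f' \<in> H A B" and g: "g \<in> H B C" and g': "g' \<in> H B C"
      and le: "fun_le (fst A) (fst B) f f'" "fun_le (fst B) (fst C) g g'" for f f' g g'
    unfolding fun_le_def
  proof
    fix x assume x: "x \<in> Car (fst A)"
    note fx = car[OF A B f x] and fx' = car[OF A B f' x]
    have 1: "ord_le (fst C) (g (f x)) (g (f' x))"
      using qfun_mono[OF qcat[OF B] qcat[OF C] qfun[OF B C g] _ fx fx'] le x by (simp add: fun_le_def)
    have 2: "ord_le (fst C) (g (f' x)) (g' (f' x))" using le fx' by (simp add: fun_le_def)
    show "ord_le (fst C) (compose (Car (fst A)) g f x) (compose (Car (fst A)) g' f' x)"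
      using ord_le_trans[OF qcat[OF C] 1 2 car[OF B C g fx] car[OF B C g fx'] car[OF B C g' fx']] x
      by (simp add: compose_eq)
  qed
  fix D assume D: "D \<in> Obs"
  show "compose (Car (fst A)) h (compose (Car (fst A)) g f) = compose (Car (fst A)) (compose (Car (fst B)) h g) f"
    if "f \<in> H A B" for f g h
    using car[OF A B that] by (auto simp: compose_def)
qed

lemma Q_Cls_is_two_cat: "is_two_cat Q_Cls"
  unfolding Q_Cls_def
proof (rule is_two_cat_over_qcategories; clarsimp)
  fix X :: "('a, 'o, 'q) qcat" and c
  assume A: "closure_space (X, c)"
  then show X: "qcategory X" by (simp add: closure_space_iff)
  have c: "qfunctor (P X) (P X) c" using A by (simp add: closure_space_iff)
  show "continuous_qfunctor (X, c) (X, c) (\<lambda>x\<in>Car X. x)"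
    using qfun_id[OF X] Pdir_id[OF X] qfun_car[OF c] ord_le_refl[OF P_qcat[OF X] qfun_car[OF c]]
    by (simp add: continuous_qfunctor_def fun_le_def)
  fix Y :: "('a, 'o, 'q) qcat" and d f
  assume B: "closure_space (Y, d)" and f': "continuous_qfunctor (X, c) (Y, d) f"
  then show f: "qfunctor X Y f" by (simp add: continuous_qfunctor_def)
  have Y: "qcategory Y" and d: "qfunctor (P Y) (P Y) d" using B by (auto simp: closure_space_iff)
  fix Z :: "('a, 'o, 'q) qcat" and e g
  assume C: "closure_space (Z, e)" and g': "continuous_qfunctor (Y, d) (Z, e) g"
  then have g: "qfunctor Y Z g" by (simp add: continuous_qfunctor_def)
  have Z: "qcategory Z" and e: "qfunctor (P Z) (P Z) e" using C by (auto simp: closure_space_iff)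
  note f1 = Pdir_functor[OF X Y f] and g1 = Pdir_functor[OF Y Z g]
  have "ord_le (P Z) (Pdir X Z (compose (Car X) g f) (c \<sigma>)) (e (Pdir X Z (compose (Car X) g f) \<sigma>))"
    if s: "\<sigma> \<in> Car (P X)" for \<sigma>
  proof -
    note cs = qfun_car[OF c s] and fs = qfun_car[OF f1 s]
    have "ord_le (P Y) (Pdir X Y f (c \<sigma>)) (d (Pdir X Y f \<sigma>))"
      using f' s by (simp add: continuous_qfunctor_def fun_le_def)
    from qfun_mono[OF P_qcat[OF Y] P_qcat[OF Z] g1 this qfun_car[OF f1 cs] qfun_car[OF d fs]]
    have 1: "ord_le (P Z) (Pdir Y Z g (Pdir X Y f (c \<sigma>))) (Pdir Y Z g (d (Pdir X Y f \<sigma>)))" .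
    have 2: "ord_le (P Z) (Pdir Y Z g (d (Pdir X Y f \<sigma>))) (e (Pdir Y Z g (Pdir X Y f \<sigma>)))"
      using g' fs by (simp add: continuous_qfunctor_def fun_le_def)
    from ord_le_trans[OF P_qcat[OF Z] 1 2 qfun_car[OF g1 qfun_car[OF f1 cs]] qfun_car[OF g1 qfun_car[OF d fs]]
        qfun_car[OF e qfun_car[OF g1 fs]]]
    show ?thesis using Pdir_comp[OF X Y Z f g s] Pdir_comp[OF X Y Z f g cs] by simp
  qed
  then show "continuous_qfunctor (X, c) (Z, e) (compose (Car X) g f)"
    using qfun_comp[OF X Y Z f g] by (simp add: continuous_qfunctor_def fun_le_def)
qed

lemma lax_hom_iff_continuous_alg_closure:
  assumes A: "lax_algebra (X, p)" and B: "lax_algebra (Y, q)"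
  shows "lax_hom (X, p) (Y, q) f \<longleftrightarrow> continuous_qfunctor (X, alg_closure X p) (Y, alg_closure Y q) f"
  using lax_hom_iff_continuous[OF closure_space_alg_closure[OF A] closure_space_alg_closure[OF B]]
    closure_alg_alg_closure[OF A] closure_alg_alg_closure[OF B] by simp

text \<open>
  Closure of lax homomorphisms under composition is inherited from continuous Q-functors along the
  correspondence between algebras and closure operators.
\<close>

lemma Lax_Alg_is_two_cat: "is_two_cat Lax_Alg"
proof -
  note Cls = Q_Cls_is_two_cat[unfolded is_two_cat_def Q_Cls_def two_cat.simps]
  show ?thesis
    unfolding Lax_Alg_def
  proof (rule is_two_cat_over_qcategories; clarsimp)
    fix X :: "('a, 'o, 'q) qcat" and p
    assume A: "lax_algebra (X, p)"
    then show "qcategory X" by (simp add: lax_algebra_iff)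
    note A' = closure_space_alg_closure[OF A]
    show "lax_hom (X, p) (X, p) (\<lambda>x\<in>Car X. x)"
      using Cls[THEN conjunct1] A' by (auto simp: lax_hom_iff_continuous_alg_closure[OF A A])
    fix Y :: "('a, 'o, 'q) qcat" and q f
    assume B: "lax_algebra (Y, q)" and f: "lax_hom (X, p) (Y, q) f"
    then show "qfunctor X Y f" by (simp add: lax_hom_def)
    note B' = closure_space_alg_closure[OF B]
    fix Z :: "('a, 'o, 'q) qcat" and r g
    assume C: "lax_algebra (Z, r)" and g: "lax_hom (Y, q) (Z, r) g"
    note C' = closure_space_alg_closure[OF C]
    show "lax_hom (X, p) (Z, r) (compose (Car X) g f)"
      using Cls[THEN conjunct2, THEN conjunct1] A' B' C' f g
      unfolding lax_hom_iff_continuous_alg_closure[OF A B] lax_hom_iff_continuous_alg_closure[OF B C]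
        lax_hom_iff_continuous_alg_closure[OF A C] by fastforce
  qed
qed

lemma Lax_Alg_iso_Q_Cls:
  "isomorphic_two_cats
     (Lax_Alg :: (('a, 'o, 'q) qcat \<times> (('a, 'o, 'q) dcopsh \<Rightarrow> ('a, 'o, 'q) psh), 'a \<Rightarrow> 'a) two_cat)
     (Q_Cls :: (('a, 'o, 'q) qcat \<times> (('a, 'o, 'q) psh \<Rightarrow> ('a, 'o, 'q) psh), 'a \<Rightarrow> 'a) two_cat)"
  unfolding isomorphic_two_cats_def
proof (intro conjI exI)
  let ?F = "\<lambda>(X, p). (X, alg_closure X p)" and ?G = "\<lambda>(X, c). (X, closure_alg X c)"
  let ?M = "\<lambda>_ _ f. f"
  show "is_two_cat Lax_Alg" "is_two_cat Q_Cls" by (rule Lax_Alg_is_two_cat Q_Cls_is_two_cat)+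
  show "is_two_functor Lax_Alg Q_Cls ?F ?M"
    unfolding is_two_functor_def Lax_Alg_def Q_Cls_def two_cat.simps
    by (auto simp: closure_space_alg_closure lax_hom_iff_continuous_alg_closure[symmetric])
  show "is_two_functor Q_Cls Lax_Alg ?G ?M"
    unfolding is_two_functor_def Lax_Alg_def Q_Cls_def two_cat.simps
    by (auto simp: lax_algebra_closure_alg lax_hom_iff_continuous)
  show "\<forall>a\<in>ob2 Lax_Alg. ?G (?F a) = a"
    by (auto simp: Lax_Alg_def closure_alg_alg_closure)
  show "\<forall>x\<in>ob2 Q_Cls. ?F (?G x) = x"
    by (auto simp: Q_Cls_def closure_space_iff alg_closure_closure_alg)
qed simp_all

end

theorem theorem7p2:
  fixes Q :: "('o, 'q) qdata"
  assumes "quantaloid Q"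
  shows "(\<forall>X :: ('a, 'o, 'q) qcat. quantaloid.qcategory Q X \<longrightarrow>
            quantaloid.Lam Q X =
            compose (Car (quantaloid.T Q (quantaloid.P Q X)))
              (quantaloid.Pinv Q (quantaloid.T Q X) (quantaloid.T Q (quantaloid.P Q X))
                 (quantaloid.Tmap Q X (quantaloid.P Q X) (quantaloid.yon X)))
              (quantaloid.yon (quantaloid.T Q (quantaloid.P Q X)))) \<and>
         quantaloid.Lam_distributive_law Q TYPE('a) TYPE('b) \<and>
         quantaloid.Lam_flat Q TYPE('a) \<and>
         isomorphic_two_cats
           (quantaloid.Lax_Alg Q ::
              (('a, 'o, 'q) qcat \<times> (('a, 'o, 'q) dcopsh \<Rightarrow> ('a, 'o, 'q) psh), 'a \<Rightarrow> 'a) two_cat)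
           (quantaloid.Q_Cls Q ::
              (('a, 'o, 'q) qcat \<times> (('a, 'o, 'q) psh \<Rightarrow> ('a, 'o, 'q) psh), 'a \<Rightarrow> 'a) two_cat)"
proof -
  interpret quantaloid Q by (rule assms)
  show ?thesis
    by (intro conjI allI impI Lam_as_inverse_image Lam_is_distributive_law Lam_is_flat Lax_Alg_iso_Q_Cls)
qed

end
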